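(* Let $\lambda_1,\ldots,\lambda_{n-1}$ be non-zero integers with $\lambda_1<0,\ldots,\lambda_{n_-}<0$, $\lambda_{n_-+1}>0,\ldots,\lambda_{n-1}>0$, and let $\mu_{j,t}=|\lambda_j|\delta_{j,t}$, $j,t=1,\ldots,n-1$. If $n_-\geq2$ and $n-1-n_-\geq2$, then $$\dim H^0_b(\mathscr{C}H_n,L^k)\sim k^n,$$ where $\mathscr{C}H_n$ is the compact Heisenberg manifold determined by $(\lambda_j)$ and $L\to\mathscr{C}H_n$ is the CR line bundle determined by $(\mu_{j,t})$.
   Context: $\mathscr{C}H_n=(\mathbb{C}^{n-1}\times\mathbb{R})/\sim$, where $(z,\theta)\sim(\tilde z,\tilde\theta)$ if $\tilde z-z=(\alpha_1,\ldots,\alpha_{n-1})\in\sqrt{2\pi}\,\mathbb{Z}^{n-1}+i\sqrt{2\pi}\,\mathbb{Z}^{n-1}$ and $\tilde\theta-\theta-i\sum_{j=1}^{n-1}\lambda_j(z_j\overline\alpha_j-\overline z_j\alpha_j)\in\pi\mathbb{Z}$. It is a compact manifold of dimension $2n-1$ with CR structure $T^{1,0}\mathscr{C}H_n$ spanned by $\frac{\partial}{\partial z_j}+i\lambda_j\overline z_j\frac{\partial}{\partial\theta}$, $j=1,\ldots,n-1$. $L=(\mathbb{C}^{n-1}\times\mathbb{R}\times\mathbb{C})/\equiv$, where $(z,\theta,\eta)\equiv(\tilde z,\tilde\theta,\tilde\eta)$ if $(z,\theta)\sim(\tilde z,\tilde\theta)$ and $\tilde\eta=\eta\exp\big(\sum_{j,t=1}^{n-1}\mu_{j,t}(z_j\overline\alpha_t+\frac12\alpha_j\overline\alpha_t)\big)$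 with $\alpha=\tilde z-z$. This is a CR line bundle over $\mathscr{C}H_n$; $L^k$ is its $k$-th tensor power. $H^0_b(\mathscr{C}H_n,L^k)$ is the space of smooth CR sections of $L^k$: smooth sections given, in the local trivializations of $L^k$ coming from the coordinates $(z,\theta,\eta)$, by functions $f(z,\theta)$ with $\big(\frac{\partial}{\partial\overline z_j}-i\lambda_jz_j\frac{\partial}{\partial\theta}\big)f=0$, $j=1,\ldots,n-1$. $\dim H^0_b(\mathscr{C}H_n,L^k)\sim k^n$ means: there are constants $c,C>0$ and $k_0$ with $ck^n\leq\dim H^0_b(\mathscr{C}H_n,L^k)\leq Ck^n$ for all $k\geq k_0$. *)

theory Defs
  imports "HOL-Analysis.Analysis" "HOL-Library.Function_Algebras"
begin

text \<open>The index type \<open>'d\<close> has \<open>n - 1\<close> elements, so \<open>complex ^ 'd\<close> is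
  the space of the variables \<open>z\<^sub>1, \<dots>, z\<^bsub>n-1\<^esub>\<close>, and
  \<open>(complex ^ 'd) \<times> real\<close> is the space of all \<open>(z, \<theta>)\<close>.\<close>

type_synonym 'd pt = "(complex ^ 'd) \<times> real"


section \<open>The compact Heisenberg manifold\<close>

definition heis_lattice :: "(complex ^ 'd) set" where
  "heis_lattice = {\<alpha>. \<forall>j. \<exists>a b :: int. \<alpha> $ j = complex_of_real (sqrt (2 * pi)) * (of_int a + \<i> * of_int b)}"

definition heis_rel :: "int ^ 'd \<Rightarrow> ('d::finite pt \<times> 'd pt) set" where
  "heis_rel lam = {((z, \<theta>), (z', \<theta>')).
     z' - z \<in> heis_lattice \<and>
     (\<exists>m :: int. complex_of_real (\<theta>' - \<theta>)
        - \<i> * (\<Sum>j\<in>UNIV. of_int (lam $ j) * (z $ j * cnj ((z' - z) $ j) - cnj (z $ j) * (z' - z) $ j))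
        = complex_of_real pi * of_int m)}"

definition heis_mfld :: "int ^ 'd \<Rightarrow> 'd::finite pt set set" where
  "heis_mfld lam = UNIV // heis_rel lam"


section \<open>The line bundle and its tensor powers\<close>

definition trans_factor :: "int ^ 'd ^ 'd \<Rightarrow> complex ^ 'd::finite \<Rightarrow> complex ^ 'd \<Rightarrow> complex" where
  "trans_factor \<mu> z \<alpha> =
     exp (\<Sum>j\<in>UNIV. \<Sum>t\<in>UNIV. of_int (\<mu> $ j $ t) * (z $ j * cnj (\<alpha> $ t) + 1 / 2 * (\<alpha> $ j * cnj (\<alpha> $ t))))"

text \<open>\<open>L\<close> is glued with \<open>trans_factor \<mu>\<close>, that is, it is the case \<open>k = 1\<close>.  The \<open>k\<close>-th tensor
  power of a line bundle is glued with the \<open>k\<close>-th powers of its transition functions; the class of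
  \<open>((z, \<theta>), \<eta>\<^sub>1 \<cdots> \<eta>\<^sub>k)\<close> is the tensor product of the classes of \<open>((z, \<theta>), \<eta>\<^sub>i)\<close> in \<open>L\<close>.\<close>

definition bundle_rel ::
  "int ^ 'd \<Rightarrow> int ^ 'd ^ 'd \<Rightarrow> nat \<Rightarrow> (('d::finite pt \<times> complex) \<times> ('d pt \<times> complex)) set" where
  "bundle_rel lam \<mu> k = {((p, \<eta>), (p', \<eta>')).
     (p, p') \<in> heis_rel lam \<and> \<eta>' = \<eta> * trans_factor \<mu> (fst p) (fst p' - fst p) ^ k}"

definition bundle_power :: "int ^ 'd \<Rightarrow> int ^ 'd ^ 'd \<Rightarrow> nat \<Rightarrow> ('d::finite pt \<times> complex) set set" where
  "bundle_power lam \<mu> k = UNIV // bundle_rel lam \<mu> k"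

text \<open>The bundle projection maps the class of \<open>(p, \<eta>)\<close> to the class of \<open>p\<close>, which is the image
  of the former class under \<open>fst\<close>.\<close>

definition bundle_proj :: "('d::finite pt \<times> complex) set \<Rightarrow> 'd pt set" where
  "bundle_proj v = fst ` v"

definition sections ::
  "int ^ 'd \<Rightarrow> int ^ 'd ^ 'd \<Rightarrow> nat \<Rightarrow> ('d::finite pt set \<Rightarrow> ('d pt \<times> complex) set) set" where
  "sections lam \<mu> k =
     {s \<in> heis_mfld lam \<rightarrow>\<^sub>E bundle_power lam \<mu> k. \<forall>x \<in> heis_mfld lam. bundle_proj (s x) = x}"

text \<open>The function \<open>f\<close> representing a section \<open>s\<close>, with \<open>s [p] = [(p, f p)]\<close>.  If \<open>U\<close> is open and
  \<open>p \<mapsto> [p]\<close> is injective on \<open>U\<close>, then \<open>f\<close> restricted to \<open>U\<close> represents \<open>s\<close> in the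
  local trivialization given by the coordinates \<open>(z, \<theta>, \<eta>)\<close> over \<open>U\<close>.  Such \<open>U\<close> cover
  \<open>(complex ^ 'd) \<times> real\<close>, so local conditions on \<open>s\<close> can be imposed on \<open>f\<close> globally.\<close>

definition coord :: "int ^ 'd \<Rightarrow> ('d::finite pt set \<Rightarrow> ('d pt \<times> complex) set) \<Rightarrow> 'd pt \<Rightarrow> complex" where
  "coord lam s p = (THE \<eta>. (p, \<eta>) \<in> s (heis_rel lam `` {p}))"


section \<open>Smooth CR sections\<close>

primrec times_differentiable :: "nat \<Rightarrow> ('a::real_normed_vector \<Rightarrow> 'b::real_normed_vector) \<Rightarrow> bool" where
  "times_differentiable 0 f = continuous_on UNIV f"
| "times_differentiable (Suc m) f =
     ((\<forall>x. f differentiable (at x)) \<and>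
      (\<forall>v. times_differentiable m (\<lambda>x. frechet_derivative f (at x) v)))"

definition smooth :: "('a::real_normed_vector \<Rightarrow> 'b::real_normed_vector) \<Rightarrow> bool" where
  "smooth f = (\<forall>m. times_differentiable m f)"

text \<open>\<open>\<partial>/\<partial>z\<^sub>j-bar = (\<partial>/\<partial>x\<^sub>j + \<i> \<partial>/\<partial>y\<^sub>j) / 2\<close> for \<open>z\<^sub>j = x\<^sub>j + \<i> y\<^sub>j\<close>.\<close>

definition d_zbar :: "'d::finite \<Rightarrow> ('d pt \<Rightarrow> complex) \<Rightarrow> 'd pt \<Rightarrow> complex" where
  "d_zbar j f p =
     (frechet_derivative f (at p) (axis j 1, 0) + \<i> * frechet_derivative f (at p) (axis j \<i>, 0)) / 2"

definition d_theta :: "('d::finite pt \<Rightarrow> complex) \<Rightarrow> 'd pt \<Rightarrow> complex" where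
  "d_theta f p = frechet_derivative f (at p) (0, 1)"

definition cauchy_riemann :: "int ^ 'd \<Rightarrow> ('d::finite pt \<Rightarrow> complex) \<Rightarrow> bool" where
  "cauchy_riemann lam f =
     (\<forall>j z \<theta>. d_zbar j f (z, \<theta>) - \<i> * of_int (lam $ j) * z $ j * d_theta f (z, \<theta>) = 0)"

definition H0b ::
  "int ^ 'd \<Rightarrow> int ^ 'd ^ 'd \<Rightarrow> nat \<Rightarrow> ('d::finite pt set \<Rightarrow> ('d pt \<times> complex) set) set" where
  "H0b lam \<mu> k = {s \<in> sections lam \<mu> k. smooth (coord lam s) \<and> cauchy_riemann lam (coord lam s)}"


section \<open>Well-definedness\<close>

interpretation cfun: vector_space "\<lambda>(c::complex) (f :: 'a \<Rightarrow> complex) x. c * f x"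
  by unfold_locales (auto simp: algebra_simps fun_eq_iff)

lemma heis_lattice_diff: "\<alpha> \<in> heis_lattice \<Longrightarrow> \<beta> \<in> heis_lattice \<Longrightarrow> \<alpha> - \<beta> \<in> heis_lattice"
  unfolding heis_lattice_def mem_Collect_eq
proof
  fix j
  assume a: "\<forall>j. \<exists>a b :: int. \<alpha> $ j = complex_of_real (sqrt (2 * pi)) * (of_int a + \<i> * of_int b)"
    "\<forall>j. \<exists>a b :: int. \<beta> $ j = complex_of_real (sqrt (2 * pi)) * (of_int a + \<i> * of_int b)"
  obtain a b c d :: int where
    "\<alpha> $ j = complex_of_real (sqrt (2 * pi)) * (of_int a + \<i> * of_int b)"
    "\<beta> $ j = complex_of_real (sqrt (2 * pi)) * (of_int c + \<i> * of_int d)" using a by metis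
  then have "(\<alpha> - \<beta>) $ j = complex_of_real (sqrt (2 * pi)) * (of_int (a - c) + \<i> * of_int (b - d))"
    by (simp add: algebra_simps)
  then show "\<exists>a b :: int. (\<alpha> - \<beta>) $ j = complex_of_real (sqrt (2 * pi)) * (of_int a + \<i> * of_int b)"
    by blast
qed

lemma heis_lattice_0: "0 \<in> heis_lattice"
  unfolding heis_lattice_def by (auto intro!: exI[of _ "0::int"])

lemma heis_lattice_minus: "\<alpha> \<in> heis_lattice \<Longrightarrow> - \<alpha> \<in> heis_lattice"
  using heis_lattice_diff[OF heis_lattice_0] by simp

lemma heis_lattice_add: "\<alpha> \<in> heis_lattice \<Longrightarrow> \<beta> \<in> heis_lattice \<Longrightarrow> \<alpha> + \<beta> \<in> heis_lattice"
  using heis_lattice_diff[OF _ heis_lattice_minus] by fastforce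

lemma heis_lattice_pairing:
  assumes "\<alpha> \<in> heis_lattice" "\<beta> \<in> heis_lattice"
  shows "\<exists>m :: int. \<alpha> $ j * cnj (\<beta> $ t) - cnj (\<alpha> $ j) * \<beta> $ t = 4 * pi * \<i> * of_int m"
proof -
  obtain a b c d :: int where e:
    "\<alpha> $ j = complex_of_real (sqrt (2 * pi)) * (of_int a + \<i> * of_int b)"
    "\<beta> $ t = complex_of_real (sqrt (2 * pi)) * (of_int c + \<i> * of_int d)"
    using assms unfolding heis_lattice_def by blast
  have s: "complex_of_real (sqrt (2 * pi)) * complex_of_real (sqrt (2 * pi)) = 2 * pi"
    unfolding of_real_mult[symmetric] by simp
  have "\<alpha> $ j * cnj (\<beta> $ t) - cnj (\<alpha> $ j) * \<beta> $ t
      = (complex_of_real (sqrt (2 * pi)) * complex_of_real (sqrt (2 * pi)))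
        * (2 * \<i> * of_int (b * c - a * d))"
    unfolding e by (simp add: algebra_simps)
  also have "\<dots> = 4 * pi * \<i> * of_int (b * c - a * d)" unfolding s by simp
  finally show ?thesis by blast
qed

lemma sum_int_multiple:
  assumes "finite S" "\<And>x. x \<in> S \<Longrightarrow> \<exists>m :: int. f x = (w :: complex) * of_int m"
  shows "\<exists>m :: int. sum f S = w * of_int m"
proof -
  obtain g :: "_ \<Rightarrow> int" where g: "\<And>x. x \<in> S \<Longrightarrow> f x = w * of_int (g x)"
    using assms(2) by metis
  have "sum f S = w * of_int (sum g S)" by (simp add: g sum_distrib_left)
  then show ?thesis by blast
qed

definition shift :: "int ^ 'd \<Rightarrow> complex ^ 'd::finite \<Rightarrow> complex ^ 'd \<Rightarrow> complex" where
  "shift lam z \<alpha> = \<i> * (\<Sum>j\<in>UNIV. of_int (lam $ j) * (z $ j * cnj (\<alpha> $ j) - cnj (z $ j) * \<alpha> $ j))"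

lemma shift_lattice:
  assumes "\<alpha> \<in> heis_lattice" "\<beta> \<in> heis_lattice"
  shows "\<exists>m :: int. shift lam \<alpha> \<beta> = pi * of_int m"
proof -
  have "\<exists>m :: int. of_int (lam $ j) * (\<alpha> $ j * cnj (\<beta> $ j) - cnj (\<alpha> $ j) * \<beta> $ j) = (4 * pi * \<i>) * of_int m" for j
  proof -
    obtain m :: int where m: "\<alpha> $ j * cnj (\<beta> $ j) - cnj (\<alpha> $ j) * \<beta> $ j = 4 * pi * \<i> * of_int m"
      using heis_lattice_pairing[OF assms] by blast
    show ?thesis unfolding m by (intro exI[of _ "lam $ j * m"]) (simp add: algebra_simps)
  qed
  then have "\<exists>m :: int. (\<Sum>j\<in>UNIV. of_int (lam $ j) * (\<alpha> $ j * cnj (\<beta> $ j) - cnj (\<alpha> $ j) * \<beta> $ j)) = (4 * pi * \<i>) * of_int m"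
    by (intro sum_int_multiple) auto
  then obtain m :: int where
    "(\<Sum>j\<in>UNIV. of_int (lam $ j) * (\<alpha> $ j * cnj (\<beta> $ j) - cnj (\<alpha> $ j) * \<beta> $ j)) = (4 * pi * \<i>) * of_int m"
    by blast
  then have "shift lam \<alpha> \<beta> = pi * of_int (- 4 * m)"
    unfolding shift_def by (simp add: algebra_simps)
  then show ?thesis by blast
qed

lemma heis_rel_iff:
  "(p, q) \<in> heis_rel lam \<longleftrightarrow> fst q - fst p \<in> heis_lattice \<and>
     (\<exists>m :: int. complex_of_real (snd q - snd p) - shift lam (fst p) (fst q - fst p) = pi * of_int m)"
  by (cases p; cases q) (simp add: heis_rel_def shift_def)

lemma shift_add_right: "shift lam z (a + b) = shift lam z a + shift lam z b"
  by (simp add: shift_def algebra_simps sum.distrib sum_subtractf sum_distrib_left)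
lemma shift_add_left: "shift lam (z + w) a = shift lam z a + shift lam w a"
  by (simp add: shift_def algebra_simps sum.distrib sum_subtractf sum_distrib_left)
lemma shift_self [simp]: "shift lam z z = 0" by (simp add: shift_def mult.commute)
lemma shift_0 [simp]: "shift lam z 0 = 0" by (simp add: shift_def)

lemma heis_rel_refl: "(p, p) \<in> heis_rel lam"
  by (auto simp: heis_rel_iff heis_lattice_0)

lemma heis_rel_trans:
  assumes "(p, q) \<in> heis_rel lam" "(q, r) \<in> heis_rel lam"
  shows "(p, r) \<in> heis_rel lam"
proof -
  define \<alpha> \<beta> where "\<alpha> = fst q - fst p" and "\<beta> = fst r - fst q"
  obtain m m' :: int where m: "\<alpha> \<in> heis_lattice" "complex_of_real (snd q - snd p) - shift lam (fst p) \<alpha> = pi * of_int m"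
    "\<beta> \<in> heis_lattice" "complex_of_real (snd r - snd q) - shift lam (fst q) \<beta> = pi * of_int m'"
    using assms by (auto simp: heis_rel_iff \<alpha>_def \<beta>_def)
  obtain l :: int where l: "shift lam \<alpha> \<beta> = pi * of_int l" using shift_lattice[OF m(1,3)] by blast
  have q: "fst q = fst p + \<alpha>" and r: "fst r - fst p = \<alpha> + \<beta>" by (auto simp: \<alpha>_def \<beta>_def)
  have "complex_of_real (snd r - snd p) - shift lam (fst p) (\<alpha> + \<beta>) = pi * of_int (m + m' + l)"
    using m(2,4) l unfolding q shift_add_left shift_add_right by (simp add: algebra_simps)
  then show ?thesis using heis_lattice_add[OF m(1,3)] unfolding heis_rel_iff r by blast
qed

lemma heis_rel_sym:
  assumes "(p, q) \<in> heis_rel lam"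
  shows "(q, p) \<in> heis_rel lam"
proof -
  define \<alpha> where "\<alpha> = fst q - fst p"
  obtain m :: int where m: "\<alpha> \<in> heis_lattice" "complex_of_real (snd q - snd p) - shift lam (fst p) \<alpha> = pi * of_int m"
    using assms by (auto simp: heis_rel_iff \<alpha>_def)
  have q: "fst q = fst p + \<alpha>" and r: "fst p - fst q = - \<alpha>" by (auto simp: \<alpha>_def)
  have "shift lam z (- \<alpha>) = - shift lam z \<alpha>" for z
    using shift_add_right[of lam z \<alpha> "- \<alpha>"] by (simp add: eq_neg_iff_add_eq_0 add.commute)
  then have "complex_of_real (snd p - snd q) - shift lam (fst q) (- \<alpha>) = pi * of_int (- m)"
    using m(2) unfolding q shift_add_left by (simp add: algebra_simps)
  then show ?thesis using heis_lattice_minus[OF m(1)] unfolding heis_rel_iff r by blast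
qed

lemma equiv_heis_rel: "equiv UNIV (heis_rel lam)"
  by (intro equivI refl_onI symI transI) (auto intro: heis_rel_refl heis_rel_sym heis_rel_trans)

definition tform :: "int ^ 'd ^ 'd \<Rightarrow> complex ^ 'd::finite \<Rightarrow> complex ^ 'd \<Rightarrow> complex" where
  "tform \<mu> z \<alpha> = (\<Sum>j\<in>UNIV. \<Sum>t\<in>UNIV. of_int (\<mu> $ j $ t) * (z $ j * cnj (\<alpha> $ t)))"

lemma tform_add_right: "tform \<mu> z (a + b) = tform \<mu> z a + tform \<mu> z b"
  by (simp add: tform_def algebra_simps sum.distrib)
lemma tform_add_left: "tform \<mu> (z + w) a = tform \<mu> z a + tform \<mu> w a"
  by (simp add: tform_def algebra_simps sum.distrib)
lemma trans_factor_tform: "trans_factor \<mu> z \<alpha> = exp (tform \<mu> z \<alpha> + tform \<mu> \<alpha> \<alpha> / 2)"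
  by (simp add: trans_factor_def tform_def algebra_simps sum.distrib sum_distrib_left sum_divide_distrib)

lemma trans_factor_0 [simp]: "trans_factor \<mu> z 0 = 1" by (simp add: trans_factor_def)

lemma trans_factor_cocycle:
  assumes \<mu>: "\<forall>j t. \<mu> $ j $ t = \<mu> $ t $ j" and l: "\<alpha> \<in> heis_lattice" "\<beta> \<in> heis_lattice"
  shows "trans_factor \<mu> z \<alpha> * trans_factor \<mu> (z + \<alpha>) \<beta> = trans_factor \<mu> z (\<alpha> + \<beta>)"
proof -
  have sw: "tform \<mu> \<beta> \<alpha> = (\<Sum>j\<in>UNIV. \<Sum>t\<in>UNIV. of_int (\<mu> $ j $ t) * (cnj (\<alpha> $ j) * \<beta> $ t))"
    unfolding tform_def by (subst sum.swap) (simp add: \<mu> mult.commute)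
  have "\<exists>m :: int. of_int (\<mu> $ j $ t) * (\<alpha> $ j * cnj (\<beta> $ t) - cnj (\<alpha> $ j) * \<beta> $ t) = (4 * pi * \<i>) * of_int m" for j t
  proof -
    obtain m :: int where m: "\<alpha> $ j * cnj (\<beta> $ t) - cnj (\<alpha> $ j) * \<beta> $ t = 4 * pi * \<i> * of_int m"
      using heis_lattice_pairing[OF l] by blast
    show ?thesis unfolding m by (intro exI[of _ "\<mu> $ j $ t * m"]) (simp add: algebra_simps)
  qed
  then have "\<exists>m :: int. (\<Sum>j\<in>UNIV. \<Sum>t\<in>UNIV. of_int (\<mu> $ j $ t) * (\<alpha> $ j * cnj (\<beta> $ t) - cnj (\<alpha> $ j) * \<beta> $ t)) = (4 * pi * \<i>) * of_int m"
    by (intro sum_int_multiple) auto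
  then obtain m :: int where
    m: "(\<Sum>j\<in>UNIV. \<Sum>t\<in>UNIV. of_int (\<mu> $ j $ t) * (\<alpha> $ j * cnj (\<beta> $ t) - cnj (\<alpha> $ j) * \<beta> $ t)) = (4 * pi * \<i>) * of_int m"
    by blast
  have "tform \<mu> \<alpha> \<beta> - tform \<mu> \<beta> \<alpha> = (4 * pi * \<i>) * of_int m"
    unfolding m[symmetric] sw by (simp add: tform_def right_diff_distrib sum_subtractf)
  then have d: "tform \<mu> \<alpha> \<beta> = tform \<mu> \<beta> \<alpha> + (4 * pi * \<i>) * of_int m"
    by (simp add: algebra_simps)
  have "tform \<mu> z \<alpha> + tform \<mu> \<alpha> \<alpha> / 2 + (tform \<mu> (z + \<alpha>) \<beta> + tform \<mu> \<beta> \<beta> / 2)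
      = (tform \<mu> z (\<alpha> + \<beta>) + tform \<mu> (\<alpha> + \<beta>) (\<alpha> + \<beta>) / 2) + 2 * of_int m * pi * \<i>"
    unfolding tform_add_left tform_add_right d by (simp add: field_simps)
  then have "trans_factor \<mu> z \<alpha> * trans_factor \<mu> (z + \<alpha>) \<beta>
      = exp ((tform \<mu> z (\<alpha> + \<beta>) + tform \<mu> (\<alpha> + \<beta>) (\<alpha> + \<beta>) / 2) + 2 * of_int m * pi * \<i>)"
    unfolding trans_factor_tform exp_add[symmetric] by simp
  also have "\<dots> = trans_factor \<mu> z (\<alpha> + \<beta>)"
    unfolding exp_add trans_factor_tform using exp_integer_2pi[of "of_int m"]
    by (simp add: mult_ac)
  finally show ?thesis .
qed

lemma equiv_bundle_rel:
  assumes \<mu>: "\<forall>j t. \<mu> $ j $ t = \<mu> $ t $ j"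
  shows "equiv UNIV (bundle_rel lam \<mu> k)"
proof (intro equivI refl_onI symI transI)
  fix u v w
  { assume "(u, v) \<in> bundle_rel lam \<mu> k"
    moreover obtain p \<eta> q \<zeta> where "u = (p, \<eta>)" "v = (q, \<zeta>)" by (cases u; cases v) 
    ultimately have u: "u = (p, \<eta>)" "v = (q, \<zeta>)" "(p, q) \<in> heis_rel lam"
      "\<zeta> = \<eta> * trans_factor \<mu> (fst p) (fst q - fst p) ^ k" by (auto simp: bundle_rel_def)
    have a: "fst q - fst p \<in> heis_lattice" "fst p - fst q \<in> heis_lattice"
      using u(3) heis_rel_sym[OF u(3)] by (auto simp: heis_rel_iff)
    show "(v, u) \<in> bundle_rel lam \<mu> k"
      using trans_factor_cocycle[OF \<mu> a, of "fst p"]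
      by (auto simp: u bundle_rel_def mult.assoc power_mult_distrib[symmetric] heis_rel_sym[OF u(3)]) }
  { assume "(u, v) \<in> bundle_rel lam \<mu> k" "(v, w) \<in> bundle_rel lam \<mu> k"
    moreover obtain p \<eta> q \<zeta> r \<xi> where "u = (p, \<eta>)" "v = (q, \<zeta>)" "w = (r, \<xi>)" by (cases u; cases v; cases w) 
    ultimately have u: "u = (p, \<eta>)" "v = (q, \<zeta>)" "(p, q) \<in> heis_rel lam"
      "\<zeta> = \<eta> * trans_factor \<mu> (fst p) (fst q - fst p) ^ k" 
      "w = (r, \<xi>)" "(q, r) \<in> heis_rel lam"
      "\<xi> = \<zeta> * trans_factor \<mu> (fst q) (fst r - fst q) ^ k" 
      by (auto simp: bundle_rel_def)
    have a: "fst q - fst p \<in> heis_lattice" "fst r - fst q \<in> heis_lattice"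
      using u by (auto simp: heis_rel_iff)
    show "(u, w) \<in> bundle_rel lam \<mu> k"
      using trans_factor_cocycle[OF \<mu> a, of "fst p"] heis_rel_trans[OF u(3,6)]
      by (auto simp: u bundle_rel_def mult.assoc power_mult_distrib[symmetric]) }
qed (auto simp: bundle_rel_def heis_rel_refl)

lemma bundle_rel_fibre: "((p, \<eta>), (p, \<zeta>)) \<in> bundle_rel lam \<mu> k \<longleftrightarrow> \<eta> = \<zeta>"
  by (auto simp: bundle_rel_def heis_rel_refl)

lemma section_coord:
  assumes \<mu>: "\<forall>j t. \<mu> $ j $ t = \<mu> $ t $ j" and s: "s \<in> sections lam \<mu> k"
  shows "s (heis_rel lam `` {p}) = bundle_rel lam \<mu> k `` {(p, coord lam s p)}"
proof -
  let ?x = "heis_rel lam `` {p}"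
  note E = equiv_bundle_rel[OF \<mu>, of lam k]
  have x: "?x \<in> heis_mfld lam" by (simp add: heis_mfld_def quotientI)
  have "p \<in> ?x" by (simp add: heis_rel_refl)
  then have "p \<in> fst ` s ?x" using s x by (auto simp: sections_def bundle_proj_def)
  then obtain \<eta> where \<eta>: "(p, \<eta>) \<in> s ?x" by auto
  have sx: "s ?x \<in> UNIV // bundle_rel lam \<mu> k"
    using s x by (auto simp: sections_def bundle_power_def)
  then have "s ?x = bundle_rel lam \<mu> k `` {(p, \<eta>)}"
    using \<eta> E by (smt (verit, ccfv_SIG) Image_singleton_iff equiv_class_eq_iff quotientE)
  moreover from this have "coord lam s p = \<eta>"
    unfolding coord_def by (auto simp: bundle_rel_fibre)
  ultimately show ?thesis by simp
qed

lemma inj_on_coord: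
  assumes \<mu>: "\<forall>j t. \<mu> $ j $ t = \<mu> $ t $ j"
  shows "inj_on (coord lam) (sections lam \<mu> k)"
proof
  fix s t assume a: "s \<in> sections lam \<mu> k" "t \<in> sections lam \<mu> k" "coord lam s = coord lam t"
  show "s = t"
  proof (rule PiE_ext)
    show "s \<in> heis_mfld lam \<rightarrow>\<^sub>E bundle_power lam \<mu> k" "t \<in> heis_mfld lam \<rightarrow>\<^sub>E bundle_power lam \<mu> k"
      using a by (auto simp: sections_def)
    fix x assume "x \<in> heis_mfld lam"
    then obtain p where "x = heis_rel lam `` {p}" by (auto simp: heis_mfld_def elim: quotientE)
    then show "s x = t x" using section_coord[OF \<mu> a(1)] section_coord[OF \<mu> a(2)] a(3) by simp
  qed
qed

lemma coord_image_sections: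
  assumes \<mu>: "\<forall>j t. \<mu> $ j $ t = \<mu> $ t $ j"
  shows "coord lam ` sections lam \<mu> k =
    {f. \<forall>p q. (p, q) \<in> heis_rel lam \<longrightarrow> f q = f p * trans_factor \<mu> (fst p) (fst q - fst p) ^ k}"
    (is "?L = ?R")
proof safe
  note E = equiv_bundle_rel[OF \<mu>, of lam k]
  fix s p q assume s: "s \<in> sections lam \<mu> k" and pq: "(p, q) \<in> heis_rel lam"
  have "heis_rel lam `` {p} = heis_rel lam `` {q}" using equiv_class_eq[OF equiv_heis_rel pq] .
  then have "bundle_rel lam \<mu> k `` {(p, coord lam s p)} = bundle_rel lam \<mu> k `` {(q, coord lam s q)}"
    using section_coord[OF \<mu> s] by metis
  then have "((p, coord lam s p), (q, coord lam s q)) \<in> bundle_rel lam \<mu> k"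
    using E by (simp add: eq_equiv_class)
  then show "coord lam s q = coord lam s p * trans_factor \<mu> (fst p) (fst q - fst p) ^ k"
    by (simp add: bundle_rel_def)
next
  note E = equiv_bundle_rel[OF \<mu>, of lam k]
  fix f assume f: "\<forall>p q. (p, q) \<in> heis_rel lam \<longrightarrow> f q = f p * trans_factor \<mu> (fst p) (fst q - fst p) ^ k"
  define s where "s = (\<lambda>x \<in> heis_mfld lam. bundle_rel lam \<mu> k `` ((\<lambda>p. (p, f p)) ` x))"
  have sp: "s (heis_rel lam `` {p}) = bundle_rel lam \<mu> k `` {(p, f p)}" for p
  proof -
    have "heis_rel lam `` {p} \<in> heis_mfld lam" by (simp add: heis_mfld_def quotientI)
    then have "s (heis_rel lam `` {p}) = (\<Union>q \<in> heis_rel lam `` {p}. bundle_rel lam \<mu> k `` {(q, f q)})"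
      by (auto simp: s_def)
    also have "\<dots> = (\<Union>q \<in> heis_rel lam `` {p}. bundle_rel lam \<mu> k `` {(p, f p)})"
    proof (rule SUP_cong)
      fix q assume "q \<in> heis_rel lam `` {p}"
      then have "((p, f p), (q, f q)) \<in> bundle_rel lam \<mu> k" using f[rule_format, of p q] by (simp add: bundle_rel_def)
      then show "bundle_rel lam \<mu> k `` {(q, f q)} = bundle_rel lam \<mu> k `` {(p, f p)}"
        using equiv_class_eq[OF E] by metis
    qed simp
    also have "\<dots> = bundle_rel lam \<mu> k `` {(p, f p)}" using heis_rel_refl by blast
    finally show ?thesis .
  qed
  have "s \<in> sections lam \<mu> k"
    unfolding sections_def
  proof (intro CollectI conjI ballI PiE_I)
    fix x assume "x \<in> heis_mfld lam"
    then obtain p where x: "x = heis_rel lam `` {p}" by (auto simp: heis_mfld_def elim: quotientE)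
    show "s x \<in> bundle_power lam \<mu> k" by (simp add: x sp bundle_power_def quotientI)
    show "bundle_proj (s x) = x"
      unfolding x sp bundle_proj_def by (force simp: bundle_rel_def image_iff)
  qed (simp add: s_def)
  moreover have "coord lam s = f"
    unfolding coord_def sp by (auto simp: bundle_rel_fibre)
  ultimately show "f \<in> ?L" by blast
qed

lemma times_differentiable_zero: "times_differentiable m (\<lambda>x. 0)"
  by (induction m) auto

lemma fd_add: "f differentiable (at x) \<Longrightarrow> g differentiable (at x) \<Longrightarrow>
   frechet_derivative (\<lambda>x. f x + g x) (at x) = (\<lambda>v. frechet_derivative f (at x) v + frechet_derivative g (at x) v)"
  by (rule frechet_derivative_at[symmetric]) (auto intro!: derivative_eq_intros simp: frechet_derivative_works)

lemma times_differentiable_add: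
  "times_differentiable m f \<Longrightarrow> times_differentiable m g \<Longrightarrow> times_differentiable m (\<lambda>x. f x + g x)"
  by (induction m arbitrary: f g) (auto intro: continuous_on_add simp: fd_add)

lemma fd_cmult: "f differentiable (at x) \<Longrightarrow>
   frechet_derivative (\<lambda>x. (c::complex) * f x) (at x) = (\<lambda>v. c * frechet_derivative f (at x) v)"
  by (rule frechet_derivative_at[symmetric]) (auto intro!: derivative_eq_intros simp: frechet_derivative_works)

lemma times_differentiable_cmult:
  "times_differentiable m f \<Longrightarrow> times_differentiable m (\<lambda>x. (c::complex) * f x)"
  by (induction m arbitrary: f) (auto intro: continuous_on_mult simp: fd_cmult)

lemma smooth_differentiable: "smooth f \<Longrightarrow> f differentiable (at x)"
  unfolding smooth_def by (metis times_differentiable.simps(2))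

lemma subspace_coord_H0b:
  assumes \<mu>: "\<forall>j t. \<mu> $ j $ t = \<mu> $ t $ j"
  shows "cfun.subspace (coord lam ` H0b lam \<mu> k)"
proof -
  have H: "coord lam ` H0b lam \<mu> k = coord lam ` sections lam \<mu> k \<inter> {f. smooth f \<and> cauchy_riemann lam f}"
    unfolding H0b_def by auto
  show ?thesis
    unfolding H coord_image_sections[OF \<mu>]
  proof (rule cfun.subspaceI, goal_cases)
    case 1
    have "smooth (\<lambda>x. 0)" by (simp add: smooth_def times_differentiable_zero)
    then show ?case by (auto simp: zero_fun_def cauchy_riemann_def d_zbar_def d_theta_def)
  next
    case (2 f g)
    then have "smooth (\<lambda>x. f x + g x)" by (simp add: smooth_def times_differentiable_add)
    moreover have "cauchy_riemann lam (\<lambda>x. f x + g x)"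
      unfolding cauchy_riemann_def
    proof (intro allI)
      fix j z \<theta>
      have "d_zbar j f (z, \<theta>) - \<i> * of_int (lam $ j) * z $ j * d_theta f (z, \<theta>) = 0"
        "d_zbar j g (z, \<theta>) - \<i> * of_int (lam $ j) * z $ j * d_theta g (z, \<theta>) = 0"
        using 2 by (auto simp: cauchy_riemann_def)
      moreover have "d_zbar j (\<lambda>x. f x + g x) (z, \<theta>) = d_zbar j f (z, \<theta>) + d_zbar j g (z, \<theta>)"
        "d_theta (\<lambda>x. f x + g x) (z, \<theta>) = d_theta f (z, \<theta>) + d_theta g (z, \<theta>)"
        using 2 by (simp_all add: d_zbar_def d_theta_def fd_add smooth_differentiable field_simps)
      ultimately show "d_zbar j (\<lambda>x. f x + g x) (z, \<theta>) - \<i> * of_int (lam $ j) * z $ j * d_theta (\<lambda>x. f x + g x) (z, \<theta>) = 0"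
        by (simp add: algebra_simps)
    qed
    ultimately show ?case using 2 by (auto simp: plus_fun_def algebra_simps)
  next
    case (3 c f)
    then have "smooth (\<lambda>x. c * f x)" by (simp add: smooth_def times_differentiable_cmult)
    moreover have "cauchy_riemann lam (\<lambda>x. c * f x)"
      unfolding cauchy_riemann_def
    proof (intro allI)
      fix j z \<theta>
      have "d_zbar j f (z, \<theta>) - \<i> * of_int (lam $ j) * z $ j * d_theta f (z, \<theta>) = 0"
        using 3 by (auto simp: cauchy_riemann_def)
      moreover have "d_zbar j (\<lambda>x. c * f x) (z, \<theta>) = c * d_zbar j f (z, \<theta>)"
        "d_theta (\<lambda>x. c * f x) (z, \<theta>) = c * d_theta f (z, \<theta>)"
        using 3 by (simp_all add: d_zbar_def d_theta_def fd_cmult smooth_differentiable field_simps)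
      ultimately show "d_zbar j (\<lambda>x. c * f x) (z, \<theta>) - \<i> * of_int (lam $ j) * z $ j * d_theta (\<lambda>x. c * f x) (z, \<theta>) = 0"
        by (simp add: algebra_simps)
    qed
    ultimately show ?case using 3 by auto
  qed
qed


section \<open>Dimension\<close>

text \<open>The vector space structure of \<open>H0b\<close> is fibrewise, that is,
  \<open>[(p, \<eta>)] + [(p, \<eta>')] = [(p, \<eta> + \<eta>')]\<close> and \<open>c [(p, \<eta>)] = [(p, c \<eta>)]\<close>.  Hence \<open>coord\<close> is a
  linear isomorphism from \<open>H0b\<close> onto a subspace of the complex-valued functions (\<open>inj_on_coord\<close>,
  \<open>subspace_coord_H0b\<close>), and the dimension is computed there.  The library
  function \<open>dim\<close> is \<open>0\<close> on infinite-dimensional spaces, so a positive lower bound on it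
  includes finite dimension.\<close>

definition dim_H0b :: "int ^ 'd \<Rightarrow> int ^ 'd::finite ^ 'd \<Rightarrow> nat \<Rightarrow> nat" where
  "dim_H0b lam \<mu> k = cfun.dim (coord lam ` H0b lam \<mu> k)"

end

theory Submission
  imports Defs "HOL-Complex_Analysis.Cauchy_Integral_Formula"
begin

text \<open>
  In the coordinates \<open>(z, \<theta>)\<close> a CR section is \<open>\<pi>\<close>-periodic in \<open>\<theta>\<close>, and its \<open>m\<close>-th Fourier mode is
  \<open>exp (- 2 m \<Sum> \<lambda>\<^sub>j \<bar>z\<^sub>j\<bar>\<^sup>2) g\<^sub>m z\<close> with \<open>g\<^sub>m\<close> entire and quasi-periodic of weights
  \<open>c\<^sub>j = 4 m \<lambda>\<^sub>j + k \<bar>\<lambda>\<^sub>j\<bar>\<close>, so that \<open>\<bar>g\<^sub>m\<bar> exp (- \<Sum> c\<^sub>j \<bar>z\<^sub>j\<bar>\<^sup>2 / 2)\<close> is lattice periodic.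

  Upper bound: if some \<open>c\<^sub>j\<close> is negative, \<open>g\<^sub>m\<close> vanishes by Liouville's theorem; since both signs occur
  among the \<open>\<lambda>\<^sub>j\<close>, only the \<open>O(k)\<close> modes with \<open>4 \<bar>m\<bar> \<le> k\<close> remain.  For these, \<open>g\<^sub>m\<close> is determined by its
  values on a grid of mesh of order \<open>1 / \<surd>k\<close> in a fundamental cube, that is, at \<open>O(k\<^sup>n\<^sup>-\<^sup>1)\<close> points.

  Lower bound: for \<open>0 \<le> m \<le> k / 8\<close> all \<open>c\<^sub>j\<close> are at least \<open>k / 2\<close>, and products of one-variable theta
  functions give at least \<open>k\<^sup>n\<^sup>-\<^sup>1\<close> sections for each such \<open>m\<close>, which a discrete Fourier transform separates.
\<close>

section \<open>Linear algebra and smooth functions\<close>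

text \<open>On the m-th mode the Cauchy-Riemann equation says that the derivative in cnj z_j is - 2
  m \<open>lam $ j\<close> z_j times the mode, and this is what the Gaussian solves. Half of the
  term 4 m \<open>lam $ j\<close> in the weight comes from the change of the Gaussian under a
  translation, half from the shift of \<theta>; the terms in cnj z cancel between the two, which
  makes the multiplier of the entire factor holomorphic in z. With \<open>lam\<close> of one sign
  only, infinitely many modes would survive.

  Neither bound needs a description of the whole space: functionals that separate its elements bound
  the dimension from above, functionals dual to explicit sections bound it from below. As
  \<open>dim\<close> is 0 on infinite-dimensional spaces, the lower bound takes as a hypothesis the
  finite spanning set that the upper bound supplies. The mesh 1 / sqrt k is the scale on which a
  Gaussian of weight O(k) changes by a bounded factor.\<close>

text \<open>Passing to the kernel of one functional lowers the dimension by at most one, so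
  induction on the functionals works. Linearity is asked on \<open>V\<close> only, because Fourier
  coefficients are additive on continuous functions but not on arbitrary ones.\<close>

lemma (in vector_space) finite_spanning_of_separating_functionals:
  fixes \<phi> :: "'i \<Rightarrow> 'b \<Rightarrow> 'a"
  assumes "finite I" "subspace V"
    and "\<And>i x y. i \<in> I \<Longrightarrow> x \<in> V \<Longrightarrow> y \<in> V \<Longrightarrow> \<phi> i (x + y) = \<phi> i x + \<phi> i y"
    and "\<And>i c x. i \<in> I \<Longrightarrow> x \<in> V \<Longrightarrow> \<phi> i (scale c x) = c * \<phi> i x"
    and "\<And>x. x \<in> V \<Longrightarrow> (\<And>i. i \<in> I \<Longrightarrow> \<phi> i x = 0) \<Longrightarrow> x = 0"
  shows "\<exists>S. finite S \<and> card S \<le> card I \<and> V \<subseteq> span S"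
  using assms
proof (induction I arbitrary: V rule: finite_induct)
  case empty
  then have "V \<subseteq> span {}" by auto
  then show ?case by (intro exI[of _ "{}"]) auto
next
  case (insert i I)
  have add: "\<phi> i (x + y) = \<phi> i x + \<phi> i y" if "x \<in> V" "y \<in> V" for x y
    using insert.prems(2) that by blast
  have scl: "\<phi> i (scale c x) = c * \<phi> i x" if "x \<in> V" for c x
    using insert.prems(3) that by blast
  define W where "W = {x \<in> V. \<phi> i x = 0}"
  have "\<phi> i 0 = 0" using scl[of 0 0] subspace_0[OF insert.prems(1)] by simp
  then have W: "subspace W"
    unfolding W_def using insert.prems(1)
    by (intro subspaceI) (auto simp: subspace_0 subspace_add subspace_scale add scl)
  have "\<exists>S. finite S \<and> card S \<le> card I \<and> W \<subseteq> span S"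
  proof (rule insert.IH[OF W])
    fix x assume "x \<in> W" "\<And>j. j \<in> I \<Longrightarrow> \<phi> j x = 0"
    then show "x = 0" using insert.prems(4)[of x] by (auto simp: W_def)
  qed (use insert.prems in \<open>auto simp: W_def\<close>)
  then obtain S where S: "finite S" "card S \<le> card I" "W \<subseteq> span S" by blast
  show ?case
  proof (cases "V \<subseteq> W")
    case True
    then show ?thesis using S insert.hyps by (intro exI[of _ S]) auto
  next
    case False
    then obtain v where v: "v \<in> V" "\<phi> i v \<noteq> 0" by (auto simp: W_def)
    have "x \<in> span (insert v S)" if x: "x \<in> V" for x
    proof -
      define a where "a = - \<phi> i x / \<phi> i v"
      have "scale a v \<in> V" using v insert.prems(1) by (simp add: subspace_scale)
      then have "x + scale a v \<in> V" "\<phi> i (x + scale a v) = \<phi> i x + a * \<phi> i v"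
        using x v insert.prems(1) by (auto simp only: subspace_add add scl)
      then have "x + scale a v \<in> W" using v by (simp add: W_def a_def)
      then have "x + scale a v \<in> span (insert v S)"
        using S(3) span_mono[of S "insert v S"] by blast
      moreover have "scale a v \<in> span (insert v S)" by (simp add: span_base span_scale)
      ultimately show ?thesis using span_diff[of "x + scale a v" _ "scale a v"] by simp
    qed
    moreover have "card (insert v S) \<le> card (insert i I)"
      using S insert.hyps by (simp add: card_insert_if)
    ultimately show ?thesis using S(1) by (intro exI[of _ "insert v S"]) auto
  qed
qed

text \<open>Applying \<open>\<psi> i\<close> to a linear relation among the \<open>f j\<close>
  isolates the i-th coefficient. The spanning set \<open>S\<close> makes every basis of
  \<open>V\<close> finite, so that \<open>dim V\<close> bounds independent sets.\<close>

lemma (in vector_space) card_le_dim_of_biorthogonal: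
  fixes f :: "'i \<Rightarrow> 'b" and \<psi> :: "'i \<Rightarrow> 'b \<Rightarrow> 'a"
  assumes S: "finite S" "V \<subseteq> span S" and I: "finite I" "f ` I \<subseteq> V"
    and add: "\<And>i x y. i \<in> I \<Longrightarrow> \<psi> i (x + y) = \<psi> i x + \<psi> i y"
    and scl: "\<And>i c x. i \<in> I \<Longrightarrow> \<psi> i (scale c x) = c * \<psi> i x"
    and dual: "\<And>i j. i \<in> I \<Longrightarrow> j \<in> I \<Longrightarrow> \<psi> i (f j) = 0 \<longleftrightarrow> i \<noteq> j"
  shows "card I \<le> dim V"
proof -
  have inj: "inj_on f I" using dual by (metis inj_onI)
  have sm: "\<psi> i (\<Sum>x\<in>T. scale (u x) x) = (\<Sum>x\<in>T. u x * \<psi> i x)" if "i \<in> I" for i T u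
  proof (induction T rule: infinite_finite_induct)
    case (insert x T)
    then show ?case using that by (simp add: add scl)
  qed (use scl[OF that, of 0 0] in auto)
  have "independent (f ` I)"
  proof (rule independent_if_scalars_zero)
    fix u x assume s: "(\<Sum>x\<in>f ` I. scale (u x) x) = 0" and "x \<in> f ` I"
    then obtain i where i: "i \<in> I" "x = f i" by blast
    have "0 = \<psi> i (\<Sum>x\<in>f ` I. scale (u x) x)" using s scl[OF i(1), of 0 0] by simp
    also have "\<dots> = (\<Sum>j\<in>I. u (f j) * \<psi> i (f j))"
      unfolding sm[OF i(1)] by (simp add: sum.reindex[OF inj])
    also have "\<dots> = (\<Sum>j\<in>I. if j = i then u (f i) * \<psi> i (f i) else 0)"
      using dual i by (intro sum.cong) auto
    also have "\<dots> = u (f i) * \<psi> i (f i)" using i I by simp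
    finally show "u x = 0" using dual[OF i(1) i(1)] i(2) by simp
  qed (use I in auto)
  moreover obtain B where B: "B \<subseteq> V" "independent B" "V \<subseteq> span B" "card B = dim V"
    by (rule basis_exists)
  moreover have "finite B" using B S independent_span_bound[of S B] by auto
  ultimately have "card (f ` I) \<le> dim V" using I independent_span_bound[of B "f ` I"] by auto
  then show ?thesis by (simp add: card_image[OF inj])
qed

section \<open>Closure properties of smooth functions\<close>

lemma times_differentiable_SucD: "times_differentiable (Suc m) f \<Longrightarrow> times_differentiable m f"
proof (induction m arbitrary: f)
  case 0
  then show ?case
    by (auto intro!: continuous_at_imp_continuous_on differentiable_imp_continuous_within)
next
  case (Suc m)
  then show ?case by (metis times_differentiable.simps(2))
qed

lemma smooth_frechet_derivative: "smooth f \<Longrightarrow> smooth (\<lambda>x. frechet_derivative f (at x) v)"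
  unfolding smooth_def by (metis times_differentiable.simps(2))

lemma smooth_has_derivative: "smooth f \<Longrightarrow> (f has_derivative frechet_derivative f (at x)) (at x)"
  using smooth_differentiable frechet_derivative_works by blast

lemma smooth_continuous_on: "smooth f \<Longrightarrow> continuous_on S f"
  unfolding smooth_def by (metis continuous_on_subset subset_UNIV times_differentiable.simps(1))

lemma smooth_const: "smooth (\<lambda>x :: 'a::real_normed_vector. c :: 'b::real_normed_vector)"
proof -
  have "times_differentiable m (\<lambda>x :: 'a. c)" for m
    by (cases m) (auto simp: times_differentiable_zero)
  then show ?thesis by (simp add: smooth_def)
qed

lemma smooth_bounded_linear:
  assumes "bounded_linear f"
  shows "smooth f"
proof -
  have "frechet_derivative f (at x) = f" for x
    using bounded_linear_imp_has_derivative[OF assms] frechet_derivative_at by metis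
  then have "times_differentiable (Suc m) f" for m
    using smooth_const assms bounded_linear_imp_differentiable[of f] by (auto simp: smooth_def)
  then show ?thesis unfolding smooth_def using times_differentiable_SucD by blast
qed

lemma smooth_add: "smooth f \<Longrightarrow> smooth g \<Longrightarrow> smooth (\<lambda>x. f x + g x)"
  by (simp add: smooth_def times_differentiable_add)

lemma times_differentiable_mult:
  fixes f g :: "'a::real_normed_vector \<Rightarrow> complex"
  shows "times_differentiable m f \<Longrightarrow> times_differentiable m g \<Longrightarrow> times_differentiable m (\<lambda>x. f x * g x)"
proof (induction m arbitrary: f g)
  case (Suc m)
  then have d: "f differentiable (at x)" "g differentiable (at x)" for x by auto
  have "frechet_derivative (\<lambda>x. f x * g x) (at x)
      = (\<lambda>v. f x * frechet_derivative g (at x) v + frechet_derivative f (at x) v * g x)" for x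
    using d[of x] by (intro frechet_derivative_at[symmetric] has_derivative_mult)
      (auto simp: frechet_derivative_works)
  moreover have "times_differentiable m f" "times_differentiable m g"
    using Suc.prems times_differentiable_SucD by blast+
  ultimately show ?case
    using Suc d by (auto intro!: times_differentiable_add)
qed (auto intro: continuous_on_mult)

lemma smooth_mult:
  fixes f g :: "'a::real_normed_vector \<Rightarrow> complex"
  shows "smooth f \<Longrightarrow> smooth g \<Longrightarrow> smooth (\<lambda>x. f x * g x)"
  by (simp add: smooth_def times_differentiable_mult)

lemma smooth_sum:
  fixes f :: "'i \<Rightarrow> 'a::real_normed_vector \<Rightarrow> complex"
  shows "(\<And>i. i \<in> I \<Longrightarrow> smooth (f i)) \<Longrightarrow> smooth (\<lambda>x. \<Sum>i\<in>I. f i x)"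
  by (induction I rule: infinite_finite_induct) (auto intro: smooth_add smooth_const)

lemma smooth_prod:
  fixes f :: "'i \<Rightarrow> 'a::real_normed_vector \<Rightarrow> complex"
  shows "(\<And>i. i \<in> I \<Longrightarrow> smooth (f i)) \<Longrightarrow> smooth (\<lambda>x. \<Prod>i\<in>I. f i x)"
  by (induction I rule: infinite_finite_induct) (auto intro: smooth_mult smooth_const)

text \<open>The induction runs over all entire \<open>G\<close> with \<open>u\<close> fixed: the
  chain rule produces \<open>deriv G\<close> composed with \<open>u\<close>, and
  \<open>deriv G\<close> is entire again.\<close>

lemma smooth_entire_compose:
  fixes u :: "'a::real_normed_vector \<Rightarrow> complex"
  assumes G: "G holomorphic_on UNIV" and u: "smooth u"
  shows "smooth (\<lambda>x. G (u x))"
proof -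
  have td: "times_differentiable m (\<lambda>x. G (u x))" if "G holomorphic_on UNIV" for m G
    using that
  proof (induction m arbitrary: G)
    case 0
    then show ?case
      using continuous_on_compose2[OF holomorphic_on_imp_continuous_on[OF 0] smooth_continuous_on[OF u]]
      by simp
  next
    case (Suc m)
    have D: "((\<lambda>x. G (u x)) has_derivative (\<lambda>v. deriv G (u x) * frechet_derivative u (at x) v)) (at x)" for x
    proof -
      have "(G has_field_derivative deriv G (u x)) (at (u x))"
        using Suc.prems holomorphic_derivI[of G UNIV] by auto
      then show ?thesis
        using has_derivative_compose[OF smooth_has_derivative[OF u], of G "(*) (deriv G (u x))" x]
        by (simp add: has_field_derivative_def)
    qed
    have f: "frechet_derivative (\<lambda>x. G (u x)) (at x) = (\<lambda>v. deriv G (u x) * frechet_derivative u (at x) v)" for x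
      using frechet_derivative_at[OF D] by simp
    have dG: "deriv G holomorphic_on UNIV" using Suc.prems by (simp add: holomorphic_deriv)
    show ?case
      using D Suc.IH[OF dG] smooth_frechet_derivative[OF u]
      by (auto simp: f differentiable_def smooth_def intro!: times_differentiable_mult)
  qed
  show ?thesis by (simp add: smooth_def td[OF G])
qed

section \<open>Theta functions of one variable\<close>

text \<open>With \<open>exp (c z\<^sup>2 / 2)\<close> split off, quasi-periodicity under real lattice vectors leaves a Fourier
  series with coefficients \<open>a\<^sub>v\<close>, and under imaginary ones it becomes
  \<open>a\<^bsub>v + 2 c\<^esub> = a\<^sub>v exp (- 2 \<pi> (v + c))\<close>, which \<open>exp (- \<pi> v\<^sup>2 / (2 c))\<close> solves.\<close>

definition theta_term :: "int \<Rightarrow> complex \<Rightarrow> int \<Rightarrow> complex" where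
  "theta_term c z v = exp (- (pi * of_int v ^ 2 / (2 * of_int c)) + \<i> * sqrt (2 * pi) * of_int v * z)"

definition theta :: "int \<Rightarrow> int \<Rightarrow> complex \<Rightarrow> complex" where
  "theta c l z = exp (of_int c * z ^ 2 / 2) * (\<Sum>\<^sub>\<infinity>q. theta_term c z (l + 2 * c * q))"

lemma summable_on_exp_neg_abs: "(\<lambda>q :: int. exp (- \<bar>real_of_int q\<bar>)) summable_on UNIV"
proof -
  have "summable (\<lambda>n. exp (- 1 :: real) ^ n)" by (intro summable_geometric) simp
  then have n: "(\<lambda>n. exp (- real n)) summable_on UNIV"
    by (intro norm_summable_imp_summable_on) (simp add: exp_of_nat_mult[symmetric])
  have "(\<lambda>q :: int. exp (- \<bar>real_of_int q\<bar>)) summable_on range int"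
    using n by (subst summable_on_reindex) (auto simp: o_def inj_on_def)
  moreover have "(\<lambda>q :: int. exp (- \<bar>real_of_int q\<bar>)) summable_on range (\<lambda>n. - int n)"
    using n by (subst summable_on_reindex) (auto simp: o_def inj_on_def)
  moreover have "(UNIV :: int set) = range int \<union> range (\<lambda>n. - int n)"
    by (auto simp: image_iff) (metis int_cases2)
  ultimately show ?thesis by (metis summable_on_union)
qed

text \<open>A majorant that is uniform on a disc of radius \<open>R\<close>, as the M-test requires.
  The Gaussian decay in v absorbs the exponential growth caused by Im z and still leaves a factor
  exp (- \<bar>v\<bar>).\<close>

lemma norm_theta_term_le:
  assumes c: "0 < c" and z: "norm z \<le> R"
  shows "norm (theta_term c z (l + 2 * c * q))
     \<le> exp ((sqrt (2 * pi) * R + 1)\<^sup>2 * c / (2 * pi) + \<bar>l\<bar>) * exp (- \<bar>real_of_int q\<bar>)"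
proof -
  define v where "v = l + 2 * c * q"
  define A where "A = sqrt (2 * pi) * R"
  define t where "t = \<bar>real_of_int v\<bar>"
  have c': "real_of_int c > 0" using c by simp
  have "\<bar>q\<bar> \<le> \<bar>2 * c * q\<bar>" using c by (simp add: abs_mult mult_le_cancel_right1)
  then have "\<bar>q\<bar> \<le> \<bar>v\<bar> + \<bar>l\<bar>" unfolding v_def by linarith
  then have q: "\<bar>real_of_int q\<bar> \<le> t + \<bar>l\<bar>" unfolding t_def by linarith
  \<comment> \<open>The square is completed for the slope A + 1 although the exponent grows only
    with slope A; the surplus 1 is the decay in t.\<close>
  have "(pi * t / c - (A + 1))\<^sup>2 * (c / (2 * pi)) \<ge> 0" using c' by simp
  also have "(pi * t / c - (A + 1))\<^sup>2 * (c / (2 * pi)) = pi * t\<^sup>2 / (2 * c) - (A + 1) * t + (A + 1)\<^sup>2 * c / (2 * pi)"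
    using c' by (simp add: power2_eq_square field_simps)
  finally have 1: "- (pi * t\<^sup>2 / (2 * c)) + A * t \<le> (A + 1)\<^sup>2 * c / (2 * pi) - t" by (simp add: algebra_simps)
  have "\<bar>Im z\<bar> \<le> R" using z abs_Im_le_cmod[of z] by linarith
  then have "\<bar>sqrt (2 * pi) * v * Im z\<bar> \<le> sqrt (2 * pi) * (t * R)"
    by (auto simp: abs_mult t_def intro!: mult_left_mono)
  then have 2: "- (sqrt (2 * pi) * v * Im z) \<le> A * t" unfolding A_def by (simp add: mult.commute mult.left_commute)
  have "theta_term c z v = exp (complex_of_real (- (pi * t\<^sup>2 / (2 * c))) + \<i> * complex_of_real (sqrt (2 * pi) * v) * z)"
    by (simp add: theta_term_def t_def mult.assoc)
  then have "norm (theta_term c z v) = exp (- (pi * t\<^sup>2 / (2 * c)) - sqrt (2 * pi) * v * Im z)"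
    by (simp only: norm_exp_eq_Re) simp
  also have "\<dots> \<le> exp (((A + 1)\<^sup>2 * c / (2 * pi) + \<bar>l\<bar>) + - \<bar>real_of_int q\<bar>)" using 1 2 q by simp
  also have "\<dots> = exp ((A + 1)\<^sup>2 * c / (2 * pi) + \<bar>l\<bar>) * exp (- \<bar>real_of_int q\<bar>)" by (rule exp_add)
  finally show ?thesis unfolding A_def v_def .
qed

lemma theta_term_summable:
  assumes "0 < c"
  shows "(\<lambda>q. theta_term c z (l + 2 * c * q)) summable_on UNIV"
proof (rule Infinite_Sum.abs_summable_summable, rule Infinite_Sum.abs_summable_on_comparison_test')
  show "norm (theta_term c z (l + 2 * c * q))
     \<le> exp ((sqrt (2 * pi) * norm z + 1)\<^sup>2 * c / (2 * pi) + \<bar>l\<bar>) * exp (- \<bar>real_of_int q\<bar>)" for q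
    by (rule norm_theta_term_le[OF assms order_refl])
qed (intro summable_on_cmult_right summable_on_exp_neg_abs)

lemma theta_holomorphic:
  assumes c: "0 < c"
  shows "theta c l holomorphic_on UNIV"
proof -
  let ?h = "\<lambda>z. \<Sum>\<^sub>\<infinity>q. theta_term c z (l + 2 * c * q)"
  have "?h holomorphic_on ball 0 r" for r
  proof (rule holomorphic_uniform_limit)
    have "(\<lambda>z. theta_term c z v) holomorphic_on S" for v S
      unfolding theta_term_def by (use c in \<open>intro holomorphic_intros\<close>)
    then have "(\<lambda>z. \<Sum>q\<in>X. theta_term c z (l + 2 * c * q)) holomorphic_on S" for X S
      by (intro holomorphic_intros) auto
    then show "\<forall>\<^sub>F X in finite_subsets_at_top UNIV. continuous_on (cball 0 r) (\<lambda>z. \<Sum>q\<in>X. theta_term c z (l + 2 * c * q))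
         \<and> (\<lambda>z. \<Sum>q\<in>X. theta_term c z (l + 2 * c * q)) holomorphic_on ball 0 r"
      by (intro always_eventually) (auto intro: holomorphic_on_imp_continuous_on)
    show "uniform_limit (cball 0 r) (\<lambda>X z. \<Sum>q\<in>X. theta_term c z (l + 2 * c * q)) ?h (finite_subsets_at_top UNIV)"
      by (rule Weierstrass_m_test_general[OF norm_theta_term_le[OF c]
         summable_on_cmult_right[OF summable_on_exp_neg_abs]]) auto
  qed auto
  then have "?h holomorphic_on (\<Union>r\<in>UNIV. ball 0 r)"
    by (intro holomorphic_on_UN_open) auto
  moreover have "(\<Union>r\<in>UNIV. ball (0::complex) r) = UNIV"
    by (auto intro: gt_ex)
  ultimately have "?h holomorphic_on UNIV" by simp
  then show ?thesis unfolding theta_def[abs_def] by (intro holomorphic_intros) auto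
qed

text \<open>A real period multiplies a term by exp (2 pi \<i> v a) = 1. An imaginary one shifts the
  index by 2 c b, which keeps its class modulo 2 c, and produces a factor free of v that can be
  pulled out of the sum.\<close>

lemma theta_term_translate:
  assumes c: "0 < c"
  shows "theta_term c (z + sqrt (2 * pi) * (of_int a + \<i> * of_int b)) v
    = exp (2 * pi * of_int c * of_int b ^ 2 - 2 * \<i> * sqrt (2 * pi) * of_int c * of_int b * z) * theta_term c z (v + 2 * c * b)"
proof -
  have s: "complex_of_real (sqrt (2 * pi)) * complex_of_real (sqrt (2 * pi)) = 2 * pi"
    unfolding of_real_mult[symmetric] by simp
  have "- (pi * of_int v ^ 2 / (2 * of_int c)) + \<i> * sqrt (2 * pi) * of_int v * (z + sqrt (2 * pi) * (of_int a + \<i> * of_int b))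
    = - (pi * of_int v ^ 2 / (2 * of_int c)) + \<i> * sqrt (2 * pi) * of_int v * z
      + \<i> * of_int v * (complex_of_real (sqrt (2 * pi)) * complex_of_real (sqrt (2 * pi))) * (of_int a + \<i> * of_int b)"
    by (simp add: algebra_simps)
  also have "\<dots> = (2 * pi * of_int c * of_int b ^ 2 - 2 * \<i> * sqrt (2 * pi) * of_int c * of_int b * z)
     + (- (pi * of_int (v + 2 * c * b) ^ 2 / (2 * of_int c)) + \<i> * sqrt (2 * pi) * of_int (v + 2 * c * b) * z)
     + 2 * of_int (v * a) * pi * \<i>"
    unfolding s using c by (simp add: power2_eq_square field_simps)
  finally have "theta_term c (z + sqrt (2 * pi) * (of_int a + \<i> * of_int b)) v
    = exp (2 * pi * of_int c * of_int b ^ 2 - 2 * \<i> * sqrt (2 * pi) * of_int c * of_int b * z)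
      * theta_term c z (v + 2 * c * b) * exp (2 * of_int (v * a) * pi * \<i>)"
    unfolding theta_term_def by (simp only: exp_add[symmetric])
  moreover have "exp (2 * of_int (v * a) * pi * \<i>) = 1" by (rule exp_integer_2pi) simp
  ultimately show ?thesis by simp
qed

text \<open>The prefactor exp (c z^2 / 2) contributes c z \<alpha>. Together with the linear term -
  2 \<i> sqrt (2 pi) c b z from the series this is c z cnj \<alpha>, and what remains is the
  constant c \<alpha> cnj \<alpha> / 2 up to 2 pi \<i> c a b.\<close>

lemma theta_translate:
  assumes c: "0 < c" and \<alpha>: "\<alpha> = sqrt (2 * pi) * (of_int a + \<i> * of_int b)"
  shows "theta c l (z + \<alpha>) = theta c l z * exp (of_int c * (z * cnj \<alpha> + 1 / 2 * (\<alpha> * cnj \<alpha>)))"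
proof -
  have s: "complex_of_real (sqrt (2 * pi)) * complex_of_real (sqrt (2 * pi)) = 2 * pi"
    unfolding of_real_mult[symmetric] by simp
  define E where "E = exp (2 * pi * of_int c * of_int b ^ 2 - 2 * \<i> * sqrt (2 * pi) * of_int c * of_int b * z)"
  have "(\<Sum>\<^sub>\<infinity>q. theta_term c (z + \<alpha>) (l + 2 * c * q)) = (\<Sum>\<^sub>\<infinity>q. E * theta_term c z (l + 2 * c * (q + b)))"
    unfolding \<alpha> theta_term_translate[OF c] E_def by (simp add: algebra_simps)
  also have "\<dots> = E * (\<Sum>\<^sub>\<infinity>q. theta_term c z (l + 2 * c * (q + b)))"
    by (rule infsum_cmult_right')
  also have "(\<Sum>\<^sub>\<infinity>q. theta_term c z (l + 2 * c * (q + b))) = (\<Sum>\<^sub>\<infinity>q. theta_term c z (l + 2 * c * q))"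
    by (rule infsum_reindex_bij_betw[of "\<lambda>q. q + b" UNIV UNIV]) (rule bij_betw_byWitness[of _ "\<lambda>q. q - b"], auto)
  finally have h: "(\<Sum>\<^sub>\<infinity>q. theta_term c (z + \<alpha>) (l + 2 * c * q)) = E * (\<Sum>\<^sub>\<infinity>q. theta_term c z (l + 2 * c * q))" .
  have "\<alpha> * \<alpha> = (complex_of_real (sqrt (2 * pi)) * complex_of_real (sqrt (2 * pi))) * (of_int a + \<i> * of_int b)\<^sup>2"
    unfolding \<alpha> by (simp add: power2_eq_square algebra_simps)
  moreover have "\<alpha> * cnj \<alpha> = (complex_of_real (sqrt (2 * pi)) * complex_of_real (sqrt (2 * pi))) * (of_int a ^ 2 + of_int b ^ 2)"
    unfolding \<alpha> by (simp add: power2_eq_square algebra_simps)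
  ultimately have aa: "\<alpha> * \<alpha> = 2 * pi * (of_int a + \<i> * of_int b)\<^sup>2" "\<alpha> * cnj \<alpha> = 2 * pi * (of_int a ^ 2 + of_int b ^ 2)"
    unfolding s by simp_all
  have cn: "cnj \<alpha> = \<alpha> - 2 * \<i> * sqrt (2 * pi) * of_int b" unfolding \<alpha> by (simp add: algebra_simps)
  have "of_int c * (z + \<alpha>)\<^sup>2 / 2 + (2 * pi * of_int c * of_int b ^ 2 - 2 * \<i> * sqrt (2 * pi) * of_int c * of_int b * z)
     = of_int c * z\<^sup>2 / 2 + of_int c * z * (\<alpha> - 2 * \<i> * sqrt (2 * pi) * of_int b) + of_int c * (\<alpha> * \<alpha>) / 2 + 2 * pi * of_int c * of_int b ^ 2"
    by (simp add: power2_eq_square field_simps)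
  also have "\<dots> = of_int c * z\<^sup>2 / 2 + of_int c * (z * cnj \<alpha> + 1 / 2 * (\<alpha> * cnj \<alpha>)) + 2 * of_int (c * a * b) * pi * \<i>"
    unfolding cn[symmetric] aa by (simp add: power2_eq_square field_simps)
  finally have "exp (of_int c * (z + \<alpha>)\<^sup>2 / 2) * E
      = exp (of_int c * z\<^sup>2 / 2) * exp (of_int c * (z * cnj \<alpha> + 1 / 2 * (\<alpha> * cnj \<alpha>))) * exp (2 * of_int (c * a * b) * pi * \<i>)"
    unfolding E_def by (simp only: exp_add[symmetric])
  moreover have "exp (2 * of_int (c * a * b) * pi * \<i>) = 1" by (rule exp_integer_2pi) simp
  ultimately show ?thesis unfolding theta_def h by (simp add: mult_ac)
qed

text \<open>At the points dividing the real period into 2 c equal parts, all terms of the series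
  carry the same phase, as it depends only on the index modulo 2 c. There theta is a character of r
  times a constant and an explicit Gaussian factor, ready for a discrete Fourier transform.\<close>

lemma theta_sample:
  assumes c: "0 < c" and x: "x = complex_of_real (sqrt (2 * pi) * r / (2 * c))"
  shows "theta c l x = exp (of_int c * x ^ 2 / 2) * exp (2 * of_int (l * int r) * pi * \<i> / (2 * of_int c)) * (\<Sum>\<^sub>\<infinity>q. theta_term c 0 (l + 2 * c * q))"
proof -
  have s: "complex_of_real (sqrt (2 * pi)) * complex_of_real (sqrt (2 * pi)) = 2 * pi"
    unfolding of_real_mult[symmetric] by simp
  have "theta_term c x (l + 2 * c * q) = exp (2 * of_int (l * int r) * pi * \<i> / (2 * of_int c)) * theta_term c 0 (l + 2 * c * q)" for q
  proof -
    have "\<i> * sqrt (2 * pi) * of_int (l + 2 * c * q) * x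
       = \<i> * (complex_of_real (sqrt (2 * pi)) * complex_of_real (sqrt (2 * pi))) * of_int (l + 2 * c * q) * of_nat r / (2 * of_int c)"
      unfolding x by simp
    also have "\<dots> = 2 * of_int (l * int r) * pi * \<i> / (2 * of_int c) + 2 * of_int (q * int r) * pi * \<i>"
      unfolding s using c by (simp add: field_simps)
    finally have e: "\<i> * sqrt (2 * pi) * of_int (l + 2 * c * q) * x
      = 2 * of_int (l * int r) * pi * \<i> / (2 * of_int c) + 2 * of_int (q * int r) * pi * \<i>" .
    have "exp (2 * of_int (q * int r) * pi * \<i>) = 1" by (rule exp_integer_2pi) simp
    then show ?thesis unfolding theta_term_def exp_add e by simp
  qed
  then show ?thesis unfolding theta_def by (simp add: infsum_cmult_right')
qed

text \<open>At z = 0 every term is a positive real number.\<close>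

lemma theta_term_sum_at_0_neq_0:
  assumes c: "0 < c"
  shows "(\<Sum>\<^sub>\<infinity>q. theta_term c 0 (l + 2 * c * q)) \<noteq> 0"
proof -
  define g where "g q = exp (- (pi * real_of_int (l + 2 * c * q) ^ 2 / (2 * of_int c)))" for q
  have g: "theta_term c 0 (l + 2 * c * q) = of_real (g q)" for q
    unfolding theta_term_def g_def exp_of_real[symmetric] by simp
  have "(\<lambda>q. complex_of_real (g q)) summable_on UNIV" using theta_term_summable[OF c, of 0 l] by (simp add: g)
  then have "g summable_on UNIV" using summable_on_Re by fastforce
  then have "infsum g UNIV \<noteq> 0"
    using nonneg_infsum_le_0D[of g UNIV 0] by (auto simp: g_def)
  moreover have "(\<Sum>\<^sub>\<infinity>q. complex_of_real (g q)) = of_real (infsum g UNIV)"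
    using \<open>g summable_on UNIV\<close> by (intro infsumI has_sum_of_real) (rule has_sum_infsum)
  ultimately show ?thesis unfolding g by simp
qed

section \<open>Theta functions as smooth CR sections\<close>

lemma trans_factor_diagonal_power:
  assumes "\<mu> = (\<chi> j t. if j = t then \<bar>lam $ j\<bar> else 0)"
  shows "trans_factor \<mu> z \<alpha> ^ k
    = exp (\<Sum>j\<in>UNIV. of_int (int k * \<bar>lam $ j\<bar>) * (z $ j * cnj (\<alpha> $ j) + 1 / 2 * (\<alpha> $ j * cnj (\<alpha> $ j))))"
proof -
  have "(\<Sum>t\<in>UNIV. of_int (\<mu> $ j $ t) * (z $ j * cnj (\<alpha> $ t) + 1 / 2 * (\<alpha> $ j * cnj (\<alpha> $ t))))
    = of_int \<bar>lam $ j\<bar> * (z $ j * cnj (\<alpha> $ j) + 1 / 2 * (\<alpha> $ j * cnj (\<alpha> $ j)))" for j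
  proof -
    have "(\<Sum>t\<in>UNIV. of_int (\<mu> $ j $ t) * (z $ j * cnj (\<alpha> $ t) + 1 / 2 * (\<alpha> $ j * cnj (\<alpha> $ t))))
      = (\<Sum>t\<in>UNIV. if t = j then of_int \<bar>lam $ j\<bar> * (z $ j * cnj (\<alpha> $ j) + 1 / 2 * (\<alpha> $ j * cnj (\<alpha> $ j))) else 0)"
      by (intro sum.cong) (auto simp: assms)
    then show ?thesis by simp
  qed
  then show ?thesis
    unfolding trans_factor_def exp_of_nat_mult[symmetric] by (simp add: sum_distrib_left mult.assoc)
qed

text \<open>Replaces sections over the quotient by functions of (z, \<theta>). The case \<alpha> = 0
  contains the periodicity in \<theta>.\<close>

lemma coord_H0b_iff:
  fixes lam :: "int ^ 'd::finite"
  assumes \<mu>: "\<mu> = (\<chi> j t. if j = t then \<bar>lam $ j\<bar> else 0)"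
  shows "f \<in> coord lam ` H0b lam \<mu> k \<longleftrightarrow> smooth f \<and> cauchy_riemann lam f \<and>
    (\<forall>z \<theta> \<alpha> \<theta>'. \<alpha> \<in> heis_lattice \<and> (\<exists>m :: int. complex_of_real \<theta>' = \<theta> + shift lam z \<alpha> + pi * of_int m)
      \<longrightarrow> f (z + \<alpha>, \<theta>') = f (z, \<theta>) *
        exp (\<Sum>j\<in>UNIV. of_int (int k * \<bar>lam $ j\<bar>) * (z $ j * cnj (\<alpha> $ j) + 1 / 2 * (\<alpha> $ j * cnj (\<alpha> $ j)))))"
    (is "?L \<longleftrightarrow> _ \<and> _ \<and> ?Q")
proof -
  have sym: "\<forall>j t. \<mu> $ j $ t = \<mu> $ t $ j" by (simp add: \<mu>)
  have "?L \<longleftrightarrow> f \<in> coord lam ` sections lam \<mu> k \<and> smooth f \<and> cauchy_riemann lam f"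
    unfolding H0b_def by auto
  moreover have "f \<in> coord lam ` sections lam \<mu> k \<longleftrightarrow>
      (\<forall>p q. (p, q) \<in> heis_rel lam \<longrightarrow> f q = f p * trans_factor \<mu> (fst p) (fst q - fst p) ^ k)"
    unfolding coord_image_sections[OF sym] by simp
  moreover have "\<dots> \<longleftrightarrow> ?Q"
    unfolding trans_factor_diagonal_power[OF \<mu>]
  proof (intro iffI allI impI)
    fix z \<alpha> :: "complex ^ 'd" and \<theta> \<theta>' :: real
    assume a: "\<forall>p q. (p, q) \<in> heis_rel lam \<longrightarrow> f q = f p *
      exp (\<Sum>j\<in>UNIV. of_int (int k * \<bar>lam $ j\<bar>) * (fst p $ j * cnj ((fst q - fst p) $ j) + 1 / 2 * ((fst q - fst p) $ j * cnj ((fst q - fst p) $ j))))"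
      and b: "\<alpha> \<in> heis_lattice \<and> (\<exists>m :: int. complex_of_real \<theta>' = \<theta> + shift lam z \<alpha> + pi * of_int m)"
    then have "((z, \<theta>), (z + \<alpha>, \<theta>')) \<in> heis_rel lam" by (auto simp: heis_rel_iff algebra_simps)
    with a show "f (z + \<alpha>, \<theta>') = f (z, \<theta>) *
        exp (\<Sum>j\<in>UNIV. of_int (int k * \<bar>lam $ j\<bar>) * (z $ j * cnj (\<alpha> $ j) + 1 / 2 * (\<alpha> $ j * cnj (\<alpha> $ j))))"
      by fastforce
  next
    fix p q :: "'d pt"
    assume a: ?Q and "(p, q) \<in> heis_rel lam"
    then obtain m :: int where m: "fst q - fst p \<in> heis_lattice"
      "complex_of_real (snd q - snd p) - shift lam (fst p) (fst q - fst p) = pi * of_int m"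
      by (auto simp: heis_rel_iff)
    then have "complex_of_real (snd q) = snd p + shift lam (fst p) (fst q - fst p) + pi * of_int m"
      by (simp add: algebra_simps)
    then show "f q = f p * exp (\<Sum>j\<in>UNIV. of_int (int k * \<bar>lam $ j\<bar>) * (fst p $ j * cnj ((fst q - fst p) $ j) + 1 / 2 * ((fst q - fst p) $ j * cnj ((fst q - fst p) $ j))))"
      using a[rule_format, of "fst q - fst p" "snd q" "snd p" "fst p"] m(1) by auto
  qed
  ultimately show ?thesis by blast
qed

definition weight :: "int ^ 'd \<Rightarrow> nat \<Rightarrow> int \<Rightarrow> 'd::finite \<Rightarrow> int" where
  "weight lam k m j = 4 * m * lam $ j + int k * \<bar>lam $ j\<bar>"

lemma sum_axis:
  assumes "\<And>i. g i 0 = 0"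
  shows "(\<Sum>i\<in>UNIV. g i (axis j x $ i)) = g (j :: 'd::finite) x"
proof -
  have "(\<Sum>i\<in>UNIV. g i (axis j x $ i)) = (\<Sum>i\<in>UNIV. if i = j then g j x else 0)"
    using assms by (intro sum.cong) (auto simp: axis_def)
  then show ?thesis by simp
qed

definition theta_section :: "int ^ 'd \<Rightarrow> nat \<Rightarrow> int \<Rightarrow> ('d \<Rightarrow> int) \<Rightarrow> 'd::finite pt \<Rightarrow> complex" where
  "theta_section lam k m l p =
     exp (2 * \<i> * of_int m * of_real (snd p) - (\<Sum>j\<in>UNIV. 2 * of_int (m * lam $ j) * (fst p $ j * cnj (fst p $ j))))
     * (\<Prod>j\<in>UNIV. theta (weight lam k m j) (l j) (fst p $ j))"

lemma bounded_linear_coords: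
  "bounded_linear (\<lambda>p :: 'd::finite pt. fst p $ j)" 
  "bounded_linear (\<lambda>p :: 'd::finite pt. cnj (fst p $ j))"
  "bounded_linear (\<lambda>p :: 'd::finite pt. complex_of_real (snd p))"
  using bounded_linear_compose[OF bounded_linear_vec_nth bounded_linear_fst]
    bounded_linear_compose[OF bounded_linear_cnj bounded_linear_compose[OF bounded_linear_vec_nth bounded_linear_fst]]
    bounded_linear_compose[OF bounded_linear_of_real bounded_linear_snd] by auto

lemma smooth_theta_section:
  fixes lam :: "int ^ 'd::finite"
  assumes "\<And>j. 0 < weight lam k m j"
  shows "smooth (theta_section lam k m l)"
proof -
  have a: "smooth (\<lambda>p :: 'd pt. 2 * \<i> * of_int m * of_real (snd p) + (\<Sum>j\<in>UNIV. - 2 * of_int (m * lam $ j) * (fst p $ j * cnj (fst p $ j))))"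
    by (intro smooth_add smooth_sum smooth_mult smooth_const smooth_bounded_linear bounded_linear_coords)
  have e: "theta_section lam k m l = (\<lambda>p.
     exp (2 * \<i> * of_int m * of_real (snd p) + (\<Sum>j\<in>UNIV. - 2 * of_int (m * lam $ j) * (fst p $ j * cnj (fst p $ j))))
     * (\<Prod>j\<in>UNIV. theta (weight lam k m j) (l j) (fst p $ j)))"
    by (auto simp: theta_section_def fun_eq_iff sum_negf)
  show ?thesis unfolding e
    by (intro smooth_mult smooth_prod smooth_entire_compose[OF _ a]
        smooth_entire_compose[OF theta_holomorphic[OF assms] smooth_bounded_linear] bounded_linear_coords)
      (auto intro: holomorphic_intros)
qed

text \<open>The product of thetas has a complex linear derivative, so it drops out of
  \<open>d_zbar\<close>. The Gaussian contributes - 2 m \<open>lam $ j\<close> z_j, which balances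
  \<i> \<open>lam $ j\<close> z_j times the factor 2 \<i> m from \<open>d_theta\<close>.\<close>

lemma cauchy_riemann_theta_section:
  fixes lam :: "int ^ 'd::finite"
  assumes w: "\<And>j. 0 < weight lam k m j"
  shows "cauchy_riemann lam (theta_section lam k m l)"
  unfolding cauchy_riemann_def
proof (intro allI)
  fix j z \<theta>
  define X where "X p = 2 * \<i> * of_int m * of_real (snd p) - (\<Sum>j\<in>UNIV. 2 * of_int (m * lam $ j) * (fst p $ j * cnj (fst p $ j)))" for p :: "'d pt"
  define P where "P p = (\<Prod>j\<in>UNIV. theta (weight lam k m j) (l j) (fst p $ j))" for p :: "'d pt"
  define DX where "DX v = 2 * \<i> * of_int m * of_real (snd v)
      - (\<Sum>j\<in>UNIV. 2 * of_int (m * lam $ j) * (z $ j * cnj (fst v $ j) + fst v $ j * cnj (z $ j)))" for v :: "'d pt"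
  define a where "a i = deriv (theta (weight lam k m i) (l i)) (z $ i)
      * (\<Prod>j\<in>UNIV - {i}. theta (weight lam k m j) (l j) (z $ j))" for i
  define DP where "DP v = (\<Sum>i\<in>UNIV. a i * fst v $ i)" for v :: "'d pt"
  note bl = bounded_linear_coords[THEN bounded_linear_imp_has_derivative]
  have "(X has_derivative DX) (at (z, \<theta>))"
    unfolding X_def[abs_def] DX_def[abs_def]
    by (rule derivative_eq_intros bl refl)+ (auto simp: fun_eq_iff)
  then have "((\<lambda>p. exp (X p)) has_derivative (\<lambda>v. exp (X (z, \<theta>)) * DX v)) (at (z, \<theta>))"
    using has_derivative_compose[of X DX "(z, \<theta>)" UNIV exp "(*) (exp (X (z, \<theta>)))"] DERIV_exp[of "X (z, \<theta>)"]
    by (simp add: has_field_derivative_def)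
  moreover have "((\<lambda>p :: 'd pt. theta (weight lam k m i) (l i) (fst p $ i)) has_derivative
      (\<lambda>v. deriv (theta (weight lam k m i) (l i)) (z $ i) * fst v $ i)) (at (z, \<theta>))" for i
  proof -
    have "(theta (weight lam k m i) (l i) has_field_derivative deriv (theta (weight lam k m i) (l i)) (z $ i)) (at (z $ i))"
      using holomorphic_derivI[OF theta_holomorphic[OF w]] by auto
    then show ?thesis
      using has_derivative_compose[OF bl(1)[of i "at (z, \<theta>)"], of "theta (weight lam k m i) (l i)"
        "(*) (deriv (theta (weight lam k m i) (l i)) (z $ i))"]
      by (simp add: has_field_derivative_def)
  qed
  then have "(P has_derivative DP) (at (z, \<theta>))"
    unfolding P_def[abs_def] DP_def[abs_def] a_def
    by (rule has_derivative_eq_rhs[OF has_derivative_prod]) (auto simp: mult_ac)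
  ultimately have D: "(theta_section lam k m l has_derivative
       (\<lambda>v. exp (X (z, \<theta>)) * DP v + exp (X (z, \<theta>)) * DX v * P (z, \<theta>))) (at (z, \<theta>))"
    unfolding theta_section_def[abs_def] X_def[symmetric] P_def[symmetric] by (rule has_derivative_mult)
  have ax: "DX (axis j x, 0) = - (2 * of_int (m * lam $ j) * (z $ j * cnj x + x * cnj (z $ j)))"
    "DP (axis j x, 0) = a j * x" for x
    unfolding DX_def DP_def fst_conv snd_conv by (subst sum_axis; simp)+
  have th: "DX (0, 1) = 2 * \<i> * of_int m" "DP (0, 1) = 0" by (simp_all add: DX_def DP_def)
  show "d_zbar j (theta_section lam k m l) (z, \<theta>)
      - \<i> * of_int (lam $ j) * z $ j * d_theta (theta_section lam k m l) (z, \<theta>) = 0"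
    unfolding d_zbar_def d_theta_def frechet_derivative_at[OF D, symmetric] ax th
    by (simp add: field_simps)
qed

text \<open>Write B for z_j cnj \<alpha>_j + \<alpha>_j cnj \<alpha>_j / 2. In coordinate j the
  exponent gains \<open>weight lam k m j\<close> B from theta. The Gaussian and the shift of
  \<theta> together give - 4 m \<open>lam $ j\<close> B, their terms in cnj z_j cancelling, so k
  \<bar>\<open>lam $ j\<close>\<bar> B remains.\<close>

lemma theta_section_translate:
  fixes lam :: "int ^ 'd::finite"
  assumes w: "\<And>j. 0 < weight lam k m j" and \<alpha>: "\<alpha> \<in> heis_lattice"
    and \<theta>': "complex_of_real \<theta>' = \<theta> + shift lam z \<alpha> + pi * of_int n"
  shows "theta_section lam k m l (z + \<alpha>, \<theta>') = theta_section lam k m l (z, \<theta>) *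
     exp (\<Sum>j\<in>UNIV. of_int (int k * \<bar>lam $ j\<bar>) * (z $ j * cnj (\<alpha> $ j) + 1 / 2 * (\<alpha> $ j * cnj (\<alpha> $ j))))"
proof -
  define B where "B j = z $ j * cnj (\<alpha> $ j) + 1 / 2 * (\<alpha> $ j * cnj (\<alpha> $ j))" for j
  have th: "theta (weight lam k m j) (l j) (z $ j + \<alpha> $ j)
      = theta (weight lam k m j) (l j) (z $ j) * exp (of_int (weight lam k m j) * B j)" for j
  proof -
    obtain a b :: int where "\<alpha> $ j = complex_of_real (sqrt (2 * pi)) * (of_int a + \<i> * of_int b)"
      using \<alpha> unfolding heis_lattice_def by blast
    then show ?thesis unfolding B_def by (rule theta_translate[OF w])
  qed
  have sh: "2 * \<i> * of_int m * shift lam z \<alpha>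
      = - (\<Sum>j\<in>UNIV. 2 * of_int (m * lam $ j) * (z $ j * cnj (\<alpha> $ j) - cnj (z $ j) * \<alpha> $ j))"
    unfolding shift_def sum_distrib_left sum_negf[symmetric]
    by (intro sum.cong refl) (simp add: algebra_simps)
  have "2 * \<i> * of_int m * complex_of_real \<theta>' = 2 * \<i> * of_int m * \<theta> + 2 * \<i> * of_int m * shift lam z \<alpha> + 2 * of_int (m * n) * pi * \<i>"
    unfolding \<theta>' by (simp add: algebra_simps)
  then have "2 * \<i> * of_int m * complex_of_real \<theta>' - (\<Sum>j\<in>UNIV. 2 * of_int (m * lam $ j) * ((z + \<alpha>) $ j * cnj ((z + \<alpha>) $ j)))
       + (\<Sum>j\<in>UNIV. of_int (weight lam k m j) * B j)
     = 2 * \<i> * of_int m * \<theta> + 2 * of_int (m * n) * pi * \<i>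
       + (\<Sum>j\<in>UNIV. - (2 * of_int (m * lam $ j) * (z $ j * cnj (\<alpha> $ j) - cnj (z $ j) * \<alpha> $ j))
           - 2 * of_int (m * lam $ j) * ((z + \<alpha>) $ j * cnj ((z + \<alpha>) $ j))
           + of_int (weight lam k m j) * B j)"
    unfolding sh sum.distrib sum_subtractf sum_negf by simp
  also have "(\<Sum>j\<in>UNIV. - (2 * of_int (m * lam $ j) * (z $ j * cnj (\<alpha> $ j) - cnj (z $ j) * \<alpha> $ j))
           - 2 * of_int (m * lam $ j) * ((z + \<alpha>) $ j * cnj ((z + \<alpha>) $ j))
           + of_int (weight lam k m j) * B j)
     = (\<Sum>j\<in>UNIV. of_int (int k * \<bar>lam $ j\<bar>) * B j) - (\<Sum>j\<in>UNIV. 2 * of_int (m * lam $ j) * (z $ j * cnj (z $ j)))"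
    unfolding B_def weight_def sum_subtractf[symmetric] by (intro sum.cong refl) (simp add: field_simps)
  finally have F: "2 * \<i> * of_int m * complex_of_real \<theta>' - (\<Sum>j\<in>UNIV. 2 * of_int (m * lam $ j) * ((z + \<alpha>) $ j * cnj ((z + \<alpha>) $ j)))
       + (\<Sum>j\<in>UNIV. of_int (weight lam k m j) * B j)
     = 2 * \<i> * of_int m * \<theta> + 2 * of_int (m * n) * pi * \<i> + ((\<Sum>j\<in>UNIV. of_int (int k * \<bar>lam $ j\<bar>) * B j)
       - (\<Sum>j\<in>UNIV. 2 * of_int (m * lam $ j) * (z $ j * cnj (z $ j))))" .
  have "exp (2 * \<i> * of_int m * complex_of_real \<theta>' - (\<Sum>j\<in>UNIV. 2 * of_int (m * lam $ j) * ((z + \<alpha>) $ j * cnj ((z + \<alpha>) $ j))))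
      * exp (\<Sum>j\<in>UNIV. of_int (weight lam k m j) * B j)
     = exp (2 * \<i> * of_int m * \<theta> - (\<Sum>j\<in>UNIV. 2 * of_int (m * lam $ j) * (z $ j * cnj (z $ j))))
      * exp (\<Sum>j\<in>UNIV. of_int (int k * \<bar>lam $ j\<bar>) * B j) * exp (2 * of_int (m * n) * pi * \<i>)"
    unfolding exp_add[symmetric] F by (rule arg_cong[of _ _ exp]) algebra
  moreover have "exp (2 * of_int (m * n) * pi * \<i>) = 1" by (rule exp_integer_2pi) simp
  ultimately show ?thesis
    unfolding theta_section_def B_def[symmetric] fst_conv snd_conv vector_add_component th prod.distrib
      exp_sum[OF finite, symmetric] by (simp add: mult_ac)
qed

lemma theta_section_in_coord_H0b:
  fixes lam :: "int ^ 'd::finite"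
  assumes "\<mu> = (\<chi> j t. if j = t then \<bar>lam $ j\<bar> else 0)" and w: "\<And>j. 0 < weight lam k m j"
  shows "theta_section lam k m l \<in> coord lam ` H0b lam \<mu> k"
  unfolding coord_H0b_iff[OF assms(1)]
  using smooth_theta_section[OF w] cauchy_riemann_theta_section[OF w] theta_section_translate[OF w] by blast

section \<open>The lower bound\<close>

lemma mult_cancel_inverse_pairs:
  fixes t :: "'a::comm_monoid_mult"
  assumes "c * c' = d" "a * a' = 1" "b * b' = 1"
  shows "a * b * c * (a' * (b' * c' * t)) = d * t"
proof -
  have "a * b * c * (a' * (b' * c' * t)) = (a * a') * (b * b') * (c * c') * t" by (simp only: mult_ac)
  then show ?thesis by (simp add: assms)
qed

lemma sum_roots_of_unity:
  fixes a :: int and N :: nat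
  assumes "\<bar>a\<bar> < int N"
  shows "(\<Sum>r<N. exp (2 * of_int (a * int r) * pi * \<i> / of_nat N)) = (if a = 0 then of_nat N else 0)"
proof (cases "a = 0")
  case False
  define \<zeta> where "\<zeta> = exp (2 * of_int a * pi * \<i> / of_nat N)"
  have N: "N > 0" using assms by linarith
  have "\<zeta> \<noteq> 1"
  proof
    assume "\<zeta> = 1"
    then obtain n :: int where n: "2 * real_of_int a * pi / real N = of_int (2 * n) * pi"
      unfolding \<zeta>_def exp_eq_1 by auto
    then have "real_of_int a = real_of_int (n * int N)" using N by (simp add: field_simps)
    then have "a = n * int N" by (simp only: of_int_eq_iff)
    then show False using False assms by (auto simp: abs_mult)
  qed
  moreover have "\<zeta> ^ N = 1"
    unfolding \<zeta>_def exp_of_nat_mult[symmetric] using N exp_integer_2pi[of "of_int a"] by simp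
  moreover have "exp (2 * of_int (a * int r) * pi * \<i> / of_nat N) = \<zeta> ^ r" for r
    unfolding \<zeta>_def exp_of_nat_mult[symmetric] by (simp add: mult_ac)
  ultimately show ?thesis using False by (simp add: geometric_sum)
qed simp

section \<open>Discrete Fourier functionals dual to the theta sections\<close>

definition sample_point :: "('d::finite \<Rightarrow> int) \<Rightarrow> ('d \<Rightarrow> nat) \<Rightarrow> complex ^ 'd" where
  "sample_point c r = (\<chi> j. complex_of_real (sqrt (2 * pi) * real (r j) / (2 * of_int (c j))))"

text \<open>The first two factors undo, at a sample point, the Gaussian of the section and the
  prefactor of theta. The third is the conjugate of the character found in
  \<open>theta_sample\<close>.\<close>

definition sample_coeff :: "int ^ 'd \<Rightarrow> nat \<Rightarrow> int \<Rightarrow> ('d \<Rightarrow> int) \<Rightarrow> ('d::finite \<Rightarrow> nat) \<Rightarrow> complex" where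
  "sample_coeff lam k m l r = (let c = weight lam k m in
     \<Prod>j\<in>UNIV. exp (2 * of_int (m * lam $ j) * (sample_point c r $ j * cnj (sample_point c r $ j)))
       * exp (- (of_int (c j) * sample_point c r $ j ^ 2 / 2))
       * exp (- (2 * of_int (l j * int (r j)) * pi * \<i> / (2 * of_int (c j)))))"

text \<open>A discrete Fourier transform over k points of the period in \<theta> and over real
  points in z. Finitely many point values make it linear on all functions, as
  \<open>card_le_dim_of_biorthogonal\<close> demands.\<close>

definition sample_functional :: "int ^ 'd \<Rightarrow> nat \<Rightarrow> int \<Rightarrow> ('d \<Rightarrow> int) \<Rightarrow> ('d::finite pt \<Rightarrow> complex) \<Rightarrow> complex" where
  "sample_functional lam k m l f =
    (\<Sum>s<k. \<Sum>r\<in>PiE UNIV (\<lambda>j. {..<nat (2 * weight lam k m j)}).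
       exp (- (2 * of_int (m * int s) * pi * \<i> / of_nat k)) * sample_coeff lam k m l r
       * f (sample_point (weight lam k m) r, pi * real s / real k))"

text \<open>The sum over s annihilates every m' \<noteq> m, since the frequencies differ by less
  than k. The bounds on \<open>l'\<close> refer to the weight of m and are therefore asked only for
  m' = m; in that case the sum over r factors into one geometric sum per coordinate, which detects
  whether \<open>l j = l' j\<close>.\<close>

lemma sample_functional_theta_section:
  fixes lam :: "int ^ 'd::finite"
  assumes k: "0 < k" and m: "0 \<le> m" "m < int k" "0 \<le> m'" "m' < int k"
    and w: "\<And>j. 0 < weight lam k m j"
    and l: "\<And>j. 0 \<le> l j" "\<And>j. l j < 2 * weight lam k m j"
    and l': "\<And>j. m' = m \<Longrightarrow> 0 \<le> l' j" "\<And>j. m' = m \<Longrightarrow> l' j < 2 * weight lam k m j"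
  shows "sample_functional lam k m l (theta_section lam k m' l') = 0 \<longleftrightarrow> (m, l) \<noteq> (m', l')"
proof -
  define c where "c = weight lam k m"
  define R where "R = PiE UNIV (\<lambda>j. {..<nat (2 * c j)})"
  define T where "T r = theta_section lam k m' l' (sample_point c r, 0)" for r
  define S where "S = (\<Sum>r\<in>R. sample_coeff lam k m l r * T r)"
  have v: "theta_section lam k m' l' (sample_point c r, pi * real s / real k)
      = exp (2 * of_int (m' * int s) * pi * \<i> / of_nat k) * T r" for r s
    unfolding theta_section_def T_def exp_diff by (simp add: mult_ac)
  have e: "exp (- (2 * of_int (m * int s) * pi * \<i> / of_nat k)) * exp (2 * of_int (m' * int s) * pi * \<i> / of_nat k)
      = exp (2 * of_int ((m' - m) * int s) * pi * \<i> / of_nat k)" for s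
    unfolding exp_add[symmetric] by (simp add: algebra_simps diff_divide_distrib)
  have "sample_functional lam k m l (theta_section lam k m' l')
     = (\<Sum>s<k. \<Sum>r\<in>R. (exp (- (2 * of_int (m * int s) * pi * \<i> / of_nat k)) * exp (2 * of_int (m' * int s) * pi * \<i> / of_nat k))
         * (sample_coeff lam k m l r * T r))"
    unfolding sample_functional_def c_def[symmetric] R_def[symmetric] v by (simp only: mult_ac)
  also have "\<dots> = (\<Sum>s<k. exp (2 * of_int ((m' - m) * int s) * pi * \<i> / of_nat k)) * S"
    unfolding S_def e sum_product ..
  also have "\<dots> = (if m' = m then of_nat k * S else 0)"
    using m sum_roots_of_unity[of "m' - m" k] by simp
  finally have 1: "sample_functional lam k m l (theta_section lam k m' l') = (if m' = m then of_nat k * S else 0)" .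
  have "S = 0 \<longleftrightarrow> l \<noteq> l'" if m': "m' = m"
  proof -
    have c: "0 < c j" for j using w by (simp add: c_def)
    define \<Theta> where "\<Theta> j = (\<Sum>\<^sub>\<infinity>q. theta_term (c j) 0 (l' j + 2 * c j * q))" for j
    have "sample_coeff lam k m l r * T r
        = (\<Prod>j\<in>UNIV. exp (2 * of_int ((l' j - l j) * int (r j)) * pi * \<i> / of_nat (nat (2 * c j))) * \<Theta> j)" for r
    proof -
      define x where "x j = sample_point c r $ j" for j
      have th: "theta (c j) (l' j) (x j) = exp (of_int (c j) * x j ^ 2 / 2) *
         exp (2 * of_int (l' j * int (r j)) * pi * \<i> / (2 * of_int (c j))) * \<Theta> j" for j
        unfolding \<Theta>_def by (rule theta_sample[OF c]) (simp add: x_def sample_point_def)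
      have T: "T r = (\<Prod>j\<in>UNIV. exp (- (2 * of_int (m * lam $ j) * (x j * cnj (x j)))) * theta (c j) (l' j) (x j))"
        unfolding T_def theta_section_def m' prod.distrib exp_sum[OF finite, symmetric] x_def c_def
        by (simp add: sum_negf)
      show ?thesis
        unfolding T th sample_coeff_def Let_def c_def[symmetric] x_def[symmetric] prod.distrib[symmetric]
      proof (intro prod.cong refl)
        fix j
        have "exp (- (2 * of_int (l j * int (r j)) * pi * \<i> / (2 * of_int (c j)))) *
            exp (2 * of_int (l' j * int (r j)) * pi * \<i> / (2 * of_int (c j)))
          = exp (2 * of_int ((l' j - l j) * int (r j)) * pi * \<i> / of_nat (nat (2 * c j)))"
          unfolding exp_add[symmetric] using c[of j] by (simp add: algebra_simps diff_divide_distrib)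
        moreover have "exp (2 * of_int (m * lam $ j) * (x j * cnj (x j))) * exp (- (2 * of_int (m * lam $ j) * (x j * cnj (x j)))) = 1"
          "exp (- (of_int (c j) * (x j)\<^sup>2 / 2)) * exp (of_int (c j) * (x j)\<^sup>2 / 2) = 1"
          unfolding exp_add[symmetric] by simp_all
        ultimately show "exp (2 * of_int (m * lam $ j) * (x j * cnj (x j))) * exp (- (of_int (c j) * (x j)\<^sup>2 / 2)) *
            exp (- (2 * of_int (l j * int (r j)) * pi * \<i> / (2 * of_int (c j)))) *
            (exp (- (2 * of_int (m * lam $ j) * (x j * cnj (x j)))) *
              (exp (of_int (c j) * (x j)\<^sup>2 / 2) * exp (2 * of_int (l' j * int (r j)) * pi * \<i> / (2 * of_int (c j))) * \<Theta> j))
          = exp (2 * of_int ((l' j - l j) * int (r j)) * pi * \<i> / of_nat (nat (2 * c j))) * \<Theta> j"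
          by (rule mult_cancel_inverse_pairs)
      qed
    qed
    then have "S = (\<Prod>j\<in>UNIV. \<Sum>n<nat (2 * c j). exp (2 * of_int ((l' j - l j) * int n) * pi * \<i> / of_nat (nat (2 * c j))) * \<Theta> j)"
      unfolding S_def R_def by (subst prod_sum_PiE) simp_all
    also have "\<dots> = (\<Prod>j\<in>UNIV. (if l' j - l j = 0 then of_nat (nat (2 * c j)) else 0) * \<Theta> j)"
      unfolding sum_distrib_right[symmetric]
    proof (intro prod.cong refl arg_cong2[of _ _ _ _ "(*)"] sum_roots_of_unity)
      fix j show "\<bar>l' j - l j\<bar> < int (nat (2 * c j))"
        using l[of j] l'[OF m', of j] unfolding c_def by auto
    qed
    finally have "S = 0 \<longleftrightarrow> (\<exists>j. l' j \<noteq> l j)"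
      using theta_term_sum_at_0_neq_0[OF c] c unfolding \<Theta>_def by (auto simp: nat_eq_iff2 less_le)
    then show ?thesis unfolding fun_eq_iff by (metis (lifting))
  qed
  then show ?thesis using 1 k by auto
qed

lemma dim_H0b_lower_bound:
  fixes lam :: "int ^ 'd::finite"
  assumes \<mu>: "\<mu> = (\<chi> j t. if j = t then \<bar>lam $ j\<bar> else 0)" and k: "0 < k" and lam: "\<And>j. lam $ j \<noteq> 0"
    and fin: "finite S" "coord lam ` H0b lam \<mu> k \<subseteq> cfun.span S"
  shows "real k ^ (CARD('d) + 1) / 8 \<le> real (dim_H0b lam \<mu> k)"
proof -
  \<comment> \<open>For these m every weight is at least k - 4 m \<ge> k / 2, so twice the weight is
    at least k. The box for l can then be the same for all m.\<close>
  define I where "I = {0..int k div 8} \<times> (PiE UNIV (\<lambda>_. {0..<int k}) :: ('d \<Rightarrow> int) set)"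
  have wt: "0 < weight lam k m j" "int k \<le> 2 * weight lam k m j" if "m \<in> {0..int k div 8}" for m j
  proof -
    have m: "0 \<le> m" "8 * m \<le> int k" using that by auto
    have "- (4 * m * \<bar>lam $ j\<bar>) \<le> 4 * m * lam $ j"
      using m abs_ge_minus_self[of "lam $ j"] mult_left_mono[of "- lam $ j" "\<bar>lam $ j\<bar>" "4 * m"] by simp
    then have "(int k - 4 * m) * \<bar>lam $ j\<bar> \<le> weight lam k m j"
      unfolding weight_def by (simp add: algebra_simps)
    moreover have "int k - 4 * m \<le> (int k - 4 * m) * \<bar>lam $ j\<bar>"
      using m lam[of j] by (auto simp: mult_le_cancel_left1)
    ultimately have "int k - 4 * m \<le> weight lam k m j" by (rule order_trans[rotated])
    then show "0 < weight lam k m j" "int k \<le> 2 * weight lam k m j" using m k by auto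
  qed
  have "card I \<le> cfun.dim (coord lam ` H0b lam \<mu> k)"
  proof (rule cfun.card_le_dim_of_biorthogonal[OF fin])
    show "finite I" unfolding I_def by (intro finite_cartesian_product finite_PiE) auto
    show "case_prod (theta_section lam k) ` I \<subseteq> coord lam ` H0b lam \<mu> k"
      using theta_section_in_coord_H0b[OF \<mu>] wt by (force simp: I_def)
    fix i j assume i: "i \<in> I" and j: "j \<in> I"
    obtain m l m' l' where ij: "i = (m, l)" "j = (m', l')" by (cases i; cases j)
    have m: "m \<in> {0..int k div 8}" "m' \<in> {0..int k div 8}" and l: "\<And>j. l j \<in> {0..<int k}" "\<And>j. l' j \<in> {0..<int k}"
      using i j by (auto simp: I_def ij)
    have "sample_functional lam k m l (theta_section lam k m' l') = 0 \<longleftrightarrow> (m, l) \<noteq> (m', l')"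
    proof (rule sample_functional_theta_section[OF k])
      show "l j < 2 * weight lam k m j" "l' j < 2 * weight lam k m j" for j
        using l[of j] wt(2)[OF m(1), of j] by auto
    qed (use m l k wt(1) in auto)
    then show "case_prod (sample_functional lam k) i (case_prod (theta_section lam k) j) = 0 \<longleftrightarrow> i \<noteq> j"
      by (simp add: ij)
  qed (auto simp: sample_functional_def sum.distrib distrib_left sum_distrib_left mult_ac)
  moreover have "card I = (k div 8 + 1) * k ^ CARD('d)"
    unfolding I_def card_cartesian_product
    by (simp add: card_PiE nat_add_distrib nat_div_distrib)
  moreover have "real k / 8 \<le> real (k div 8 + 1)" by (simp add: field_simps)
  then have "real k / 8 * real k ^ CARD('d) \<le> real ((k div 8 + 1) * k ^ CARD('d))"
    unfolding of_nat_mult of_nat_power by (intro mult_right_mono) auto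
  ultimately show ?thesis unfolding dim_H0b_def
    by (smt (verit) of_nat_le_iff power_add power_one_right mult.commute times_divide_eq_left)
qed

section \<open>Fourier coefficients of periodic functions\<close>

lemma integral_translate_real:
  fixes f :: "real \<Rightarrow> 'a::euclidean_space"
  assumes "continuous_on UNIV f"
  shows "integral {a..b} (\<lambda>t. f (t + s)) = integral {a + s..b + s} f"
proof -
  have "f integrable_on {a + s..b + s}"
    using assms by (intro integrable_continuous_interval) (auto intro: continuous_on_subset)
  then have "(f has_integral integral {a + s..b + s} f) (cbox (a + s) (b + s))"
    by (simp add: has_integral_integral)
  from has_integral_affinity'[OF this, of 1 s] show ?thesis by (simp add: integral_unique)
qed

text \<open>By periodicity, the integral over {x..x + p} has zero derivative in x.\<close>

lemma integral_period_translate: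
  fixes f :: "real \<Rightarrow> complex"
  assumes f: "continuous_on UNIV f" and per: "\<And>t. f (t + p) = f t" and p: "0 \<le> p"
  shows "integral {a..a + p} f = integral {0..p} f"
proof -
  \<comment> \<open>This interval contains both a and 0, whatever the sign of a.\<close>
  define c d where "c = min a 0" and "d = max a 0"
  define F where "F x = integral {c..x} f" for x
  have cont: "continuous_on S f" for S using f continuous_on_subset by blast
  have F: "(F has_vector_derivative f x) (at x within {c..d + p})" if "x \<in> {c..d + p}" for x
    unfolding F_def using integral_has_vector_derivative[OF cont that] .
  have G: "F (x + p) - F x = integral {x..x + p} f" if "x \<in> {c..d}" for x
    using that p Henstock_Kurzweil_Integration.integral_combine[where a = c and c = x and b = "x + p" and f = f] integrable_continuous_interval[OF cont]
    by (auto simp: F_def algebra_simps)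
  have "\<exists>k. \<forall>x\<in>{c..d}. F (x + p) - F x = k"
  proof (rule has_vector_derivative_zero_constant)
    fix x assume x: "x \<in> {c..d}"
    have 1: "(F has_vector_derivative f x) (at x within {c..d})"
      by (rule has_vector_derivative_within_subset[OF F]) (use x p in auto)
    have "(F has_vector_derivative f (x + p)) (at (x + p) within (\<lambda>x. x + p) ` {c..d})"
      by (rule has_vector_derivative_within_subset[OF F]) (use x p in auto)
    moreover have "((\<lambda>x. x + p) has_vector_derivative 1) (at x within {c..d})"
      by (auto intro!: derivative_eq_intros simp: has_real_derivative_iff_has_vector_derivative[symmetric])
    ultimately have "((\<lambda>x. F (x + p)) has_vector_derivative f x) (at x within {c..d})"
      using vector_diff_chain_within[of "\<lambda>x. x + p" 1 x "{c..d}" F "f (x + p)"]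
      by (simp add: o_def per)
    from has_vector_derivative_diff[OF this 1]
    show "((\<lambda>x. F (x + p) - F x) has_vector_derivative 0) (at x within {c..d})" by simp
  qed auto
  moreover have ac: "a \<in> {c..d}" "0 \<in> {c..d}" by (auto simp: c_def d_def)
  ultimately have "F (a + p) - F a = F (0 + p) - F 0" by metis
  then show ?thesis using G[OF ac(1)] G[OF ac(2)] by simp
qed

text \<open>The Wallis recursion, from the derivative of sin t cos^(2N+1) t, which vanishes at both
  ends. It is kept in this form because J N - J (Suc N) is the integral of sin^2 cos^(2N).\<close>

lemma cos_power_integral:
  defines "J \<equiv> \<lambda>N. integral {- (pi / 2)..pi / 2} (\<lambda>t. cos t ^ (2 * N))"
  shows "J (Suc N) = of_nat (2 * N + 1) * (J N - J (Suc N))" "0 < J N"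
proof -
  have rec: "J (Suc N) = of_nat (2 * N + 1) * (J N - J (Suc N))" for N
  proof -
    let ?g = "\<lambda>t. cos t ^ (2 * Suc N) - of_nat (2 * N + 1) * (cos t ^ (2 * N) - cos t ^ (2 * Suc N)) :: real"
    have "((\<lambda>t. sin t * cos t ^ (2 * N + 1)) has_real_derivative ?g t) (at t within {- (pi / 2)..pi / 2})" for t
    proof -
      have "((\<lambda>t. cos t ^ (2 * N + 1)) has_real_derivative
          of_nat (2 * N + 1) * (- sin t * cos t ^ (2 * N + 1 - Suc 0))) (at t within {- (pi / 2)..pi / 2})"
        by (rule DERIV_power) (auto intro!: derivative_eq_intros)
      from DERIV_mult[OF DERIV_subset[OF DERIV_sin subset_UNIV] this]
      have "((\<lambda>t. sin t * cos t ^ (2 * N + 1)) has_real_derivative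
          sin t * (of_nat (2 * N + 1) * (cos t ^ (2 * N) * - sin t)) + cos t * cos t ^ (2 * N + 1))
          (at t within {- (pi / 2)..pi / 2})"
        by (rule DERIV_cong) (simp add: mult_ac)
      also have "sin t * (of_nat (2 * N + 1) * (cos t ^ (2 * N) * - sin t))
          = - (of_nat (2 * N + 1) * ((sin t)\<^sup>2 * cos t ^ (2 * N)))"
        by (simp add: power2_eq_square algebra_simps)
      also have "\<dots> + cos t * cos t ^ (2 * N + 1) = ?g t"
        unfolding sin_squared_eq by (simp add: power2_eq_square algebra_simps)
      finally show ?thesis .
    qed
    then have "(?g has_integral (sin (pi / 2) * cos (pi / 2) ^ (2 * N + 1) - sin (- (pi / 2)) * cos (- (pi / 2)) ^ (2 * N + 1))) {- (pi / 2)..pi / 2}"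
      by (intro fundamental_theorem_of_calculus) (auto simp: has_real_derivative_iff_has_vector_derivative)
    then have "integral {- (pi / 2)..pi / 2} ?g = 0" by (simp add: integral_unique)
    moreover have "integral {- (pi / 2)..pi / 2} ?g = J (Suc N) - of_nat (2 * N + 1) * (J N - J (Suc N))"
      unfolding J_def
      by (subst integral_diff integral_mult_right; (intro integrable_continuous_interval continuous_intros)?)+ simp
    ultimately show ?thesis by simp
  qed
  show "J (Suc N) = of_nat (2 * N + 1) * (J N - J (Suc N))" by (rule rec)
  show "0 < J N"
  proof (induction N)
    case (Suc N)
    have "(1 + of_nat (2 * N + 1)) * J (Suc N) = of_nat (2 * N + 1) * J N"
      using rec[of N] by (simp add: algebra_simps)
    moreover have "0 < of_nat (2 * N + 1) * J N" using Suc by simp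
    ultimately show ?case by (metis of_nat_0_le_iff add_pos_nonneg zero_less_mult_pos zero_less_one)
  qed (simp add: J_def)
qed

text \<open>The frequencies are even because the period is pi. There is no factor 1 / pi: the
  coefficients serve as linear functionals whose vanishing is tested.\<close>

definition fourier_coeff :: "int \<Rightarrow> (real \<Rightarrow> complex) \<Rightarrow> complex" where
  "fourier_coeff m \<phi> = integral {0..pi} (\<lambda>t. \<phi> t * exp (- (2 * \<i> * of_int m * of_real t)))"

text \<open>Testing against the kernel \<open>cos\<^sup>2\<^sup>N t\<close>: if \<open>\<phi> 0 \<noteq> 0\<close>, the function \<open>u = Re (cnj (\<phi> 0) \<phi>)\<close>
  satisfies \<open>u \<ge> \<eta> - A sin\<^sup>2 t\<close> on a period, while the Wallis recursion makes the integral of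
  \<open>sin\<^sup>2 t cos\<^sup>2\<^sup>N t\<close> negligible compared with that of \<open>cos\<^sup>2\<^sup>N t\<close>.\<close>

lemma fourier_coeff_zero_imp_zero_at_0:
  assumes cont: "continuous_on UNIV \<phi>" and per: "\<And>t. \<phi> (t + pi) = \<phi> t"
    and zero: "\<And>m. fourier_coeff m \<phi> = 0"
  shows "\<phi> 0 = 0"
proof (rule ccontr)
  assume nz: "\<phi> 0 \<noteq> 0"
  let ?I = "{- (pi / 2)..pi / 2}"
  define J where "J N = integral ?I (\<lambda>t. cos t ^ (2 * N))" for N
  \<comment> \<open>Multiplication by cos^2 mixes only the coefficients m - 1, m and m + 1, so
    vanishing of all coefficients is inherited.\<close>
  have "fourier_coeff m (\<lambda>t. of_real (cos t ^ (2 * N)) * \<phi> t) = 0" for N m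
  proof (induction N arbitrary: m)
    case (Suc N)
    let ?\<psi> = "\<lambda>t. of_real (cos t ^ (2 * N)) * \<phi> t"
    have e: "of_real (cos t ^ (2 * Suc N)) * \<phi> t * exp (- (2 * \<i> * of_int m * of_real t))
       = 1 / 2 * (?\<psi> t * exp (- (2 * \<i> * of_int m * of_real t)))
        + 1 / 4 * (?\<psi> t * exp (- (2 * \<i> * of_int (m - 1) * of_real t)))
        + 1 / 4 * (?\<psi> t * exp (- (2 * \<i> * of_int (m + 1) * of_real t)))" for t
    proof -
      have c: "2 * complex_of_real (cos t) = exp (\<i> * t) + exp (- (\<i> * t))"
        by (simp add: cos_of_real[symmetric] cos_exp_eq)
      have "4 * complex_of_real ((cos t)\<^sup>2) = (2 * complex_of_real (cos t)) * (2 * complex_of_real (cos t))"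
        by (simp add: power2_eq_square)
      also have "\<dots> = exp (\<i> * t + \<i> * t) + 2 * exp (\<i> * t + - (\<i> * t)) + exp (- (\<i> * t) + - (\<i> * t))"
        unfolding c exp_add by (simp add: algebra_simps)
      finally have "complex_of_real ((cos t)\<^sup>2) = 1 / 2 + 1 / 4 * exp (2 * \<i> * t) + 1 / 4 * exp (- (2 * \<i> * t))"
        by (simp add: field_simps)
      then have "complex_of_real ((cos t)\<^sup>2) * exp (- (2 * \<i> * of_int m * of_real t))
        = 1 / 2 * exp (- (2 * \<i> * of_int m * of_real t)) + 1 / 4 * exp (- (2 * \<i> * of_int (m - 1) * of_real t))
         + 1 / 4 * exp (- (2 * \<i> * of_int (m + 1) * of_real t))"
        by (simp add: distrib_right exp_add[symmetric] algebra_simps)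
      moreover have "of_real (cos t ^ (2 * Suc N)) * \<phi> t * exp (- (2 * \<i> * of_int m * of_real t))
         = ?\<psi> t * (complex_of_real ((cos t)\<^sup>2) * exp (- (2 * \<i> * of_int m * of_real t)))"
        by (simp add: power2_eq_square)
      ultimately show ?thesis by (simp only: distrib_left mult_ac)
    qed
    have c: "continuous_on {0..pi} (\<lambda>t. ?\<psi> t * exp (- (2 * \<i> * of_int m * of_real t)))" for m :: int
      by (intro continuous_intros continuous_on_subset[OF cont]) auto
    have "fourier_coeff m (\<lambda>t. of_real (cos t ^ (2 * Suc N)) * \<phi> t)
      = 1 / 2 * fourier_coeff m ?\<psi> + 1 / 4 * fourier_coeff (m - 1) ?\<psi> + 1 / 4 * fourier_coeff (m + 1) ?\<psi>"
      unfolding fourier_coeff_def e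
      by (subst integral_add integral_mult_right; (intro integrable_continuous_interval continuous_on_add continuous_on_mult_left c)?)+ simp
    then show ?case by (simp only: Suc.IH mult_zero_right add_0_right)
  qed (simp add: zero)
  then have "integral {0..pi} (\<lambda>t. of_real (cos t ^ (2 * N)) * \<phi> t) = 0" for N
    unfolding fourier_coeff_def by (metis (no_types, lifting) ext mult_zero_right mult_zero_left of_int_0 neg_equal_0_iff_equal exp_zero mult.right_neutral)
  moreover have "integral {- (pi / 2)..- (pi / 2) + pi} (\<lambda>t. of_real (cos t ^ (2 * N)) * \<phi> t)
      = integral {0..pi} (\<lambda>t. of_real (cos t ^ (2 * N)) * \<phi> t)" for N
    using per by (intro integral_period_translate continuous_intros cont) (auto simp: power_mult)
  ultimately have z: "integral ?I (\<lambda>t. of_real (cos t ^ (2 * N)) * \<phi> t) = 0" for N by simp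
  define u where "u t = Re (cnj (\<phi> 0) * \<phi> t)" for t
  have cu: "continuous_on S u" for S
    unfolding u_def by (intro continuous_intros continuous_on_subset[OF cont]) auto
  have zu: "integral ?I (\<lambda>t. cos t ^ (2 * N) * u t) = 0" for N
  proof -
    have i: "(\<lambda>t. of_real (cos t ^ (2 * N)) * \<phi> t) integrable_on ?I"
      by (intro integrable_continuous_interval continuous_intros continuous_on_subset[OF cont]) auto
    have "bounded_linear (\<lambda>w. Re (cnj (\<phi> 0) * w))"
      by (intro bounded_linear_compose[OF bounded_linear_Re] bounded_linear_mult_right)
    from integral_linear[OF i this] show ?thesis using z[of N] by (simp add: o_def u_def algebra_simps)
  qed
  define \<eta> where "\<eta> = u 0 / 2"
  have u0: "u 0 = (norm (\<phi> 0))\<^sup>2" unfolding u_def cmod_power2 by (simp add: power2_eq_square)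
  then have \<eta>: "\<eta> > 0" using nz by (simp add: \<eta>_def)
  obtain \<delta>' where \<delta>': "\<delta>' > 0" "\<And>t. \<bar>t\<bar> < \<delta>' \<Longrightarrow> \<bar>u t - u 0\<bar> < \<eta>"
    using cu[of UNIV] \<eta> unfolding continuous_on_iff by (force simp: dist_real_def)
  define \<delta> where "\<delta> = min (\<delta>' / 2) 1"
  have \<delta>: "0 < \<delta>" "\<delta> < pi / 2" "\<delta> < \<delta>'" using \<delta>'(1) pi_gt3 by (auto simp: \<delta>_def)
  obtain M where M: "M > 0" "\<And>t. t \<in> ?I \<Longrightarrow> \<bar>u t\<bar> \<le> M"
    using compact_imp_bounded[OF compact_continuous_image[OF cu compact_Icc]]
    unfolding bounded_pos by (metis imageI real_norm_def)
  have s\<delta>: "sin \<delta> > 0" using \<delta> by (intro sin_gt_zero) auto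
  \<comment> \<open>Close to 0 continuity gives u \<ge> \<eta>. Elsewhere on the interval \<bar>sin
    t\<bar> \<ge> sin \<delta>, and this A pushes \<eta> - A sin^2 t down to at most - M.\<close>
  define A where "A = (\<eta> + M) / (sin \<delta>)\<^sup>2"
  have A: "A > 0" using \<eta> M s\<delta> by (simp add: A_def)
  have lower: "\<eta> - A * (sin t)\<^sup>2 \<le> u t" if t: "t \<in> ?I" for t
  proof (cases "\<bar>t\<bar> < \<delta>'")
    case True
    have "\<eta> - A * (sin t)\<^sup>2 \<le> \<eta>" using A by simp
    also have "\<eta> \<le> u t" using \<delta>'(2)[OF True] unfolding \<eta>_def by linarith
    finally show ?thesis .
  next
    case False
    have "sin \<delta> \<le> \<bar>sin t\<bar>"
    proof (cases "t \<ge> 0")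
      case True
      then have "sin \<delta> \<le> sin t" using \<delta> False t by (intro sin_monotone_2pi_le) auto
      then show ?thesis by simp
    next
      case neg: False
      then have "sin \<delta> \<le> sin (- t)" using \<delta> False t by (intro sin_monotone_2pi_le) auto
      then show ?thesis by simp
    qed
    then have "(sin \<delta>)\<^sup>2 \<le> (sin t)\<^sup>2" using s\<delta> by (metis abs_le_square_iff abs_of_pos)
    then have "A * (sin \<delta>)\<^sup>2 \<le> A * (sin t)\<^sup>2" using A by simp
    moreover have "A * (sin \<delta>)\<^sup>2 = \<eta> + M" using s\<delta> by (simp add: A_def)
    ultimately show ?thesis using M(2)[OF t] by linarith
  qed
  have "\<eta> * J N \<le> A * (J N - J (Suc N))" for N
  proof -
    have int: "(\<lambda>t :: real. cos t ^ k * v t) integrable_on ?I" if "continuous_on ?I v" for k v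
      using that by (intro integrable_continuous_interval continuous_intros)
    have "integral ?I (\<lambda>t. cos t ^ (2 * N) * (\<eta> - A * (sin t)\<^sup>2)) \<le> integral ?I (\<lambda>t. cos t ^ (2 * N) * u t)"
      using lower by (intro integral_le int cu continuous_intros mult_left_mono) (auto simp: power_mult)
    moreover have "cos t ^ (2 * N) * (\<eta> - A * (sin t)\<^sup>2) = (\<eta> - A) * cos t ^ (2 * N) + A * cos t ^ (2 * Suc N)" for t
      unfolding sin_squared_eq by (simp add: power2_eq_square algebra_simps)
    moreover have "integral ?I (\<lambda>t. (\<eta> - A) * cos t ^ (2 * N) + A * cos t ^ (2 * Suc N)) = (\<eta> - A) * J N + A * J (Suc N)"
      unfolding J_def
      by (subst integral_add; (intro integrable_continuous_interval continuous_intros)?) simp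
    ultimately show ?thesis using zu[of N] by (simp add: algebra_simps)
  qed
  then have le: "\<eta> * J N \<le> A * (J N - J (Suc N))" for N .
  \<comment> \<open>For this N the inequality \<open>le\<close> and the Wallis recursion give (2N +
    1) \<eta> J N \<le> A J (Suc N) < A J N < (2N + 1) \<eta> J N.\<close>
  obtain N where N: "A / \<eta> < of_nat N" using reals_Archimedean2 by blast
  have J: "J (Suc N) = of_nat (2 * N + 1) * (J N - J (Suc N))" "0 < J N" "0 < J (Suc N)"
    using cos_power_integral[of N] cos_power_integral(2)[of "Suc N"] unfolding J_def by auto
  have "0 < of_nat (2 * N + 1) * (J N - J (Suc N))" using J(1,3) by (rule subst)
  then have "0 < J N - J (Suc N)" by (rule zero_less_mult_pos) (simp del: of_nat_add)
  then have "A * J (Suc N) < A * J N" using A by simp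
  moreover have "of_nat (2 * N + 1) * (\<eta> * J N) \<le> of_nat (2 * N + 1) * (A * (J N - J (Suc N)))"
    by (intro mult_left_mono le) simp
  moreover have "of_nat (2 * N + 1) * (A * (J N - J (Suc N))) = A * J (Suc N)"
    by (subst J(1)) (simp only: mult_ac)
  moreover have "A * J N < of_nat (2 * N + 1) * (\<eta> * J N)"
  proof -
    have "A < of_nat N * \<eta>" using N \<eta> by (simp add: field_simps)
    also have "\<dots> \<le> of_nat (2 * N + 1) * \<eta>" using \<eta> by (intro mult_right_mono) auto
    finally have "A < of_nat (2 * N + 1) * \<eta>" .
    then have "A * J N < of_nat (2 * N + 1) * \<eta> * J N" using J(2) by (rule mult_strict_right_mono)
    then show ?thesis by (simp only: mult_ac)
  qed
  ultimately show False by linarith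
qed

text \<open>Translation by s multiplies each coefficient by a unimodular factor, so the point s can
  be moved to 0.\<close>

lemma fourier_coeff_zero_imp_zero:
  assumes cont: "continuous_on UNIV \<phi>" and per: "\<And>t. \<phi> (t + pi) = \<phi> t"
    and zero: "\<And>m. fourier_coeff m \<phi> = 0"
  shows "\<phi> s = 0"
proof -
  have "(\<lambda>t. \<phi> (t + s)) 0 = 0"
  proof (rule fourier_coeff_zero_imp_zero_at_0)
    show "continuous_on UNIV (\<lambda>t. \<phi> (t + s))"
      by (intro continuous_on_compose2[OF cont] continuous_intros) auto
    show "\<phi> (t + pi + s) = \<phi> (t + s)" for t using per[of "t + s"] by (simp add: add_ac)
    fix m
    let ?g = "\<lambda>t. \<phi> t * exp (- (2 * \<i> * of_int m * of_real t))"
    have cg: "continuous_on UNIV ?g" by (intro continuous_intros cont)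
    have pg: "?g (t + pi) = ?g t" for t
    proof -
      have "exp (2 * of_int (- m) * pi * \<i>) = 1" by (rule exp_integer_2pi) simp
      moreover have "- (2 * \<i> * of_int m * of_real (t + pi)) = - (2 * \<i> * of_int m * of_real t) + 2 * of_int (- m) * pi * \<i>"
        by (simp add: algebra_simps)
      ultimately show ?thesis by (simp only: per exp_add mult_1_right)
    qed
    have "fourier_coeff m (\<lambda>t. \<phi> (t + s)) = integral {0..pi} (\<lambda>t. exp (2 * \<i> * of_int m * of_real s) * ?g (t + s))"
      unfolding fourier_coeff_def by (simp add: algebra_simps exp_add[symmetric])
    also have "\<dots> = exp (2 * \<i> * of_int m * of_real s) * integral {0..pi} (\<lambda>t. ?g (t + s))"
      by (rule integral_mult_right)
    also have "integral {0..pi} (\<lambda>t. ?g (t + s)) = integral {s..s + pi} ?g"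
      using integral_translate_real[OF cg, of 0 pi s] by (simp add: add.commute)
    also have "\<dots> = fourier_coeff m \<phi>"
      unfolding fourier_coeff_def by (rule integral_period_translate[OF cg pg]) simp
    finally show "fourier_coeff m (\<lambda>t. \<phi> (t + s)) = 0" by (simp add: zero)
  qed
  then show ?thesis by simp
qed

section \<open>Fourier modes of CR functions\<close>

definition fourier_mode :: "int \<Rightarrow> ('d::finite pt \<Rightarrow> complex) \<Rightarrow> complex ^ 'd \<Rightarrow> complex" where
  "fourier_mode m f z = fourier_coeff m (\<lambda>t. f (z, t))"

lemma fourier_coeff_add:
  "continuous_on {0..pi} \<phi> \<Longrightarrow> continuous_on {0..pi} \<psi> \<Longrightarrow>
    fourier_coeff m (\<lambda>t. \<phi> t + \<psi> t) = fourier_coeff m \<phi> + fourier_coeff m \<psi>"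
  unfolding fourier_coeff_def distrib_right
  by (intro integral_add integrable_continuous_interval continuous_intros)

lemma fourier_coeff_cmult: "fourier_coeff m (\<lambda>t. c * \<phi> t) = c * fourier_coeff m \<phi>"
  unfolding fourier_coeff_def by (simp add: mult.assoc)

lemma fourier_mode_has_derivative:
  fixes f :: "'d::finite pt \<Rightarrow> complex"
  assumes f: "smooth f"
  shows "(fourier_mode m f has_derivative
     (\<lambda>v. fourier_coeff m (\<lambda>t. frechet_derivative f (at (z, t)) (v, 0)))) (at z)"
proof -
  define h where "h t = exp (- (2 * \<i> * of_int m * of_real t))" for t :: real
  have ch: "continuous_on S h" for S unfolding h_def by (intro continuous_intros)
  define D where "D p v = frechet_derivative f (at p) (v, 0) * h (snd p)" for p :: "'d pt" and v
  have bl: "bounded_linear (D p)" for p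
  proof -
    have "bounded_linear (frechet_derivative f (at p))"
      using smooth_has_derivative[OF f] has_derivative_bounded_linear by blast
    then have "bounded_linear (\<lambda>v. frechet_derivative f (at p) (v, 0))"
      by (rule bounded_linear_compose) (intro bounded_linear_Pair bounded_linear_ident bounded_linear_zero)
    then show ?thesis
      unfolding D_def by (rule bounded_linear_compose[OF bounded_linear_mult_left])
  qed
  have cD: "continuous_on S (\<lambda>p. D p v)" for S v
    unfolding D_def
    by (intro continuous_intros smooth_continuous_on smooth_frechet_derivative f continuous_on_compose2[OF ch[of UNIV]]) auto
  \<comment> \<open>Differentiation under the integral needs the whole derivative to be continuous.
    Smoothness gives this for each fixed direction, which suffices in finite dimension.\<close>
  define B where "B p = Blinfun (D p)" for p
  have B: "blinfun_apply (B p) = D p" for p unfolding B_def by (rule bounded_linear_Blinfun_apply[OF bl])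
  have cB: "continuous_on S B" for S
    by (rule continuous_on_blinfun_componentwise) (simp add: B cD)
  have cB': "continuous_on (cbox 0 pi) (\<lambda>t. B (z, t))"
    by (intro continuous_on_compose2[OF cB[of UNIV]] continuous_intros) auto
  have "((\<lambda>z. integral (cbox 0 pi) (\<lambda>t. f (z, t) * h t)) has_derivative
      blinfun_apply (integral (cbox 0 pi) (\<lambda>t. B (z, t)))) (at z within UNIV)"
  proof (rule leibniz_rule[where U = UNIV and fx = "\<lambda>z t. B (z, t)"])
    fix x :: "complex ^ 'd" and t
    have "((\<lambda>x. f (x, t)) has_derivative (\<lambda>v. frechet_derivative f (at (x, t)) (v, 0))) (at x)"
      by (rule has_derivative_compose[OF _ smooth_has_derivative[OF f]]) (auto intro!: derivative_eq_intros)
    from has_derivative_mult_left[OF this, of "h t"]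
    show "((\<lambda>x. f (x, t) * h t) has_derivative blinfun_apply (B (x, t))) (at x within UNIV)"
      unfolding B D_def by (simp add: o_def)
  next
    show "(\<lambda>t. f (x, t) * h t) integrable_on cbox 0 pi" for x
      by (intro integrable_continuous continuous_intros ch continuous_on_compose2[OF smooth_continuous_on[OF f, of UNIV]]) auto
    show "continuous_on (UNIV \<times> cbox 0 pi) (\<lambda>(x, t). B (x, t))" using cB by simp
  qed auto
  moreover have "blinfun_apply (integral (cbox 0 pi) (\<lambda>t. B (z, t))) v
      = fourier_coeff m (\<lambda>t. frechet_derivative f (at (z, t)) (v, 0))" for v
    unfolding fourier_coeff_def h_def[symmetric]
    by (subst blinfun_apply_integral) (use cB' in \<open>auto simp: B D_def intro!: integrable_continuous_real\<close>)
  ultimately have "((\<lambda>z. integral (cbox 0 pi) (\<lambda>t. f (z, t) * h t)) has_derivative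
      (\<lambda>v. fourier_coeff m (\<lambda>t. frechet_derivative f (at (z, t)) (v, 0)))) (at z)"
    by (metis (no_types, lifting) ext)
  then show ?thesis
    unfolding fourier_mode_def[abs_def] fourier_coeff_def h_def[symmetric] by simp
qed

text \<open>The left side is twice the conjugate-linear part of \<open>A\<close>, hence determined
  by its values on the axes. This links \<open>d_zbar j\<close> to arbitrary complex
  directions.\<close>

lemma linear_antiholomorphic_part:
  fixes A :: "complex ^ 'd::finite \<Rightarrow> complex"
  assumes "bounded_linear A"
  shows "A v + \<i> * A (\<i> *s v) = (\<Sum>j\<in>UNIV. cnj (v $ j) * (A (axis j 1) + \<i> * A (axis j \<i>)))"
proof -
  interpret bounded_linear A by fact
  have e: "A v = (\<Sum>j\<in>UNIV. of_real (Re (v $ j)) * A (axis j 1) + of_real (Im (v $ j)) * A (axis j \<i>))" for v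
  proof -
    have "v = (\<Sum>j\<in>UNIV. Re (v $ j) *\<^sub>R axis j 1 + Im (v $ j) *\<^sub>R axis j \<i>)"
    proof (subst vec_eq_iff, intro allI)
      fix i
      have "(\<Sum>j\<in>UNIV. Re (v $ j) *\<^sub>R axis j 1 + Im (v $ j) *\<^sub>R axis j \<i>) $ i
        = (\<Sum>j\<in>UNIV. if j = i then v $ i else 0)"
        unfolding sum_component by (intro sum.cong) (auto simp: axis_def complex_eq_iff)
      then show "v $ i = (\<Sum>j\<in>UNIV. Re (v $ j) *\<^sub>R axis j 1 + Im (v $ j) *\<^sub>R axis j \<i>) $ i" by simp
    qed
    then have "A v = A (\<Sum>j\<in>UNIV. Re (v $ j) *\<^sub>R axis j 1 + Im (v $ j) *\<^sub>R axis j \<i>)" by simp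
    then show ?thesis by (simp only: sum add scaleR) (simp add: scaleR_conv_of_real)
  qed
  have c: "cnj w = of_real (Re w) - \<i> * of_real (Im w)" for w by (simp add: complex_eq_iff)
  show ?thesis
    unfolding e[of v] e[of "\<i> *s v"] sum_distrib_left sum.distrib[symmetric]
    by (intro sum.cong refl) (simp add: c algebra_simps)
qed

text \<open>Integration by parts; periodicity removes the boundary terms.\<close>

lemma fourier_coeff_d_theta:
  fixes f :: "'d::finite pt \<Rightarrow> complex"
  assumes f: "smooth f" and per: "\<And>z t. f (z, t + pi) = f (z, t)"
  shows "fourier_coeff m (\<lambda>t. d_theta f (z, t)) = 2 * \<i> * of_int m * fourier_mode m f z"
proof -
  define h where "h t = exp (- (2 * \<i> * of_int m * of_real t))" for t :: real
  have dh: "(h has_vector_derivative (- (2 * \<i> * of_int m) * h t)) (at t within S)" for t S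
  proof -
    have "((\<lambda>w. exp (- (2 * \<i> * of_int m) * w)) has_field_derivative - (2 * \<i> * of_int m) * exp (- (2 * \<i> * of_int m) * of_real t)) (at (of_real t))"
      by (auto intro!: derivative_eq_intros)
    from has_vector_derivative_real_field[OF this] show ?thesis
      unfolding h_def by (simp add: has_vector_derivative_at_within)
  qed
  have df: "((\<lambda>t. f (z, t)) has_vector_derivative d_theta f (z, t)) (at t within S)" for t S
  proof -
    have "((\<lambda>t. f (z, t)) has_derivative (\<lambda>s. frechet_derivative f (at (z, t)) (0, s))) (at t)"
      by (rule has_derivative_compose[OF _ smooth_has_derivative[OF f]]) (auto intro!: derivative_eq_intros)
    moreover have "frechet_derivative f (at (z, t)) (0, s) = s *\<^sub>R d_theta f (z, t)" for s
      using linear_scale[OF linear_frechet_derivative[OF smooth_differentiable[OF f]], of "(z, t)" s "(0, 1)"]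
      by (simp add: d_theta_def)
    ultimately show ?thesis unfolding has_vector_derivative_def by (simp add: has_derivative_at_withinI)
  qed
  have cf: "continuous_on {0..pi} (\<lambda>t. f (z, t))"
    by (intro continuous_on_compose2[OF smooth_continuous_on[OF f, of UNIV]] continuous_intros) auto
  have cd: "continuous_on {0..pi} (\<lambda>t. d_theta f (z, t))"
    unfolding d_theta_def
    by (intro continuous_on_compose2[OF smooth_continuous_on[OF smooth_frechet_derivative[OF f], of UNIV]] continuous_intros) auto
  have ch: "continuous_on {0..pi} h" unfolding h_def by (intro continuous_intros)
  have "((\<lambda>t. f (z, t) * (- (2 * \<i> * of_int m) * h t) + d_theta f (z, t) * h t) has_integral
      (f (z, pi) * h pi - f (z, 0) * h 0)) {0..pi}"
    by (intro fundamental_theorem_of_calculus has_vector_derivative_mult df dh) auto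
  moreover have "f (z, pi) = f (z, 0)" using per[of z 0] by simp
  moreover have "h pi = 1" "h 0 = 1"
    using exp_integer_2pi[of "of_int (- m)"] by (simp_all add: h_def mult_ac)
  ultimately have "integral {0..pi} (\<lambda>t. f (z, t) * (- (2 * \<i> * of_int m) * h t) + d_theta f (z, t) * h t) = 0"
    by (simp add: integral_unique)
  moreover have "integral {0..pi} (\<lambda>t. f (z, t) * (- (2 * \<i> * of_int m) * h t) + d_theta f (z, t) * h t)
      = integral {0..pi} (\<lambda>t. - (2 * \<i> * of_int m) * (f (z, t) * h t)) + integral {0..pi} (\<lambda>t. d_theta f (z, t) * h t)"
    by (subst integral_add[symmetric]) (auto intro!: integrable_continuous_interval continuous_intros cf cd ch simp: mult_ac)
  ultimately show ?thesis
    unfolding fourier_mode_def fourier_coeff_def h_def[symmetric] by (simp add: add_eq_0_iff)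
qed

text \<open>With \<open>d_theta\<close> acting as 2 \<i> m, the Cauchy-Riemann equation becomes a
  first-order equation in z alone. The constant is 4 rather than 2 because the left side is twice
  the conjugate-linear part.\<close>

lemma fourier_mode_antiholomorphic:
  fixes f :: "'d::finite pt \<Rightarrow> complex" and lam :: "int ^ 'd" and z :: "complex ^ 'd" and m :: int
  assumes f: "smooth f" "cauchy_riemann lam f" and per: "\<And>z t. f (z, t + pi) = f (z, t)"
  defines "D \<equiv> \<lambda>v. fourier_coeff m (\<lambda>t. frechet_derivative f (at (z, t)) (v, 0))"
  shows "D v + \<i> * D (\<i> *s v) = - (\<Sum>j\<in>UNIV. 4 * of_int (m * lam $ j) * (z $ j * cnj (v $ j))) * fourier_mode m f z"
proof -
  have cD: "continuous_on {0..pi} (\<lambda>t. frechet_derivative f (at (z, t)) w)" for w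
    by (intro continuous_on_compose2[OF smooth_continuous_on[OF smooth_frechet_derivative[OF f(1)], of UNIV]] continuous_intros) auto
  have a: "D (axis j 1) + \<i> * D (axis j \<i>) = - 4 * of_int (m * lam $ j) * z $ j * fourier_mode m f z" for j
  proof -
    have "frechet_derivative f (at (z, t)) (axis j 1, 0) + \<i> * frechet_derivative f (at (z, t)) (axis j \<i>, 0)
       = 2 * \<i> * of_int (lam $ j) * z $ j * d_theta f (z, t)" for t
      using f(2) unfolding cauchy_riemann_def d_zbar_def by (simp add: field_simps)
    then have "D (axis j 1) + \<i> * D (axis j \<i>) = fourier_coeff m (\<lambda>t. 2 * \<i> * of_int (lam $ j) * z $ j * d_theta f (z, t))"
      unfolding D_def fourier_coeff_cmult[symmetric]
      by (subst fourier_coeff_add[symmetric]) (auto intro!: continuous_intros cD)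
    then show ?thesis
      unfolding fourier_coeff_cmult fourier_coeff_d_theta[OF f(1) per] by simp
  qed
  have "bounded_linear D"
    unfolding D_def using fourier_mode_has_derivative[OF f(1)] by (rule has_derivative_bounded_linear)
  then show ?thesis
    unfolding linear_antiholomorphic_part[OF \<open>bounded_linear D\<close>] a sum_negf[symmetric] sum_distrib_right
    by (intro sum.cong refl) (simp add: mult_ac)
qed

definition holomorphic_mode :: "int ^ 'd \<Rightarrow> int \<Rightarrow> ('d::finite pt \<Rightarrow> complex) \<Rightarrow> complex ^ 'd \<Rightarrow> complex" where
  "holomorphic_mode lam m f z =
     exp (\<Sum>j\<in>UNIV. 2 * of_int (m * lam $ j) * (z $ j * cnj (z $ j))) * fourier_mode m f z"

text \<open>Liouville's theorem and Cauchy's estimate are applied on one complex line at a time, so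
  this is the form of holomorphy that they consume.\<close>

definition entire_on_lines :: "(complex ^ 'd::finite \<Rightarrow> complex) \<Rightarrow> bool" where
  "entire_on_lines g \<longleftrightarrow> (\<forall>z w. (\<lambda>t. g (z + t *s w)) holomorphic_on UNIV)"

lemma complex_linear_derivative_imp_entire_on_lines:
  fixes g :: "complex ^ 'd::finite \<Rightarrow> complex"
  assumes D: "\<And>z. (g has_derivative D z) (at z)" and i: "\<And>z v. D z v + \<i> * D z (\<i> *s v) = 0"
  shows "entire_on_lines g"
  unfolding entire_on_lines_def
proof (intro allI)
  fix z w :: "complex ^ 'd"
  have "((\<lambda>t. g (z + t *s w)) has_field_derivative D (z + t *s w) w) (at t)" for t
  proof -
    have lin: "bounded_linear (\<lambda>t. t *s w)"
      by (rule linear_conv_bounded_linear[THEN iffD1], rule linearI) (auto simp: vec_eq_iff algebra_simps)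
    have "((\<lambda>t. z + t *s w) has_derivative (\<lambda>t. t *s w)) (at t)"
      using has_derivative_add[OF has_derivative_const bounded_linear_imp_has_derivative[OF lin]] by simp
    from has_derivative_compose[OF this D]
    have "((\<lambda>t. g (z + t *s w)) has_derivative (\<lambda>\<tau>. D (z + t *s w) (\<tau> *s w))) (at t)" .
    moreover have "D y (\<tau> *s w) = D y w * \<tau>" for y \<tau>
    proof -
      interpret bounded_linear "D y" using D by (rule has_derivative_bounded_linear)
      have "D y (\<i> *s w) = \<i> * D y w"
        using arg_cong[OF i[of y w], of "\<lambda>x. - \<i> * x"] by (simp add: algebra_simps)
      moreover have "\<tau> *s w = Re \<tau> *\<^sub>R w + Im \<tau> *\<^sub>R (\<i> *s w)"
        by (simp add: vec_eq_iff complex_eq_iff)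
      ultimately have "D y (\<tau> *s w) = of_real (Re \<tau>) * D y w + of_real (Im \<tau>) * (\<i> * D y w)"
        by (simp only: add scaleR) (simp add: scaleR_conv_of_real)
      then show ?thesis by (simp add: complex_eq_iff)
    qed
    ultimately show ?thesis by (simp add: has_field_derivative_def)
  qed
  then show "(\<lambda>t. g (z + t *s w)) holomorphic_on UNIV"
    by (auto simp: holomorphic_on_open)
qed

text \<open>The conjugate-linear part of the derivative of the exponent is exactly opposite to the
  multiplier in \<open>fourier_mode_antiholomorphic\<close>, so the derivative of the product is
  complex linear.\<close>

lemma holomorphic_mode_entire:
  fixes f :: "'d::finite pt \<Rightarrow> complex" and lam :: "int ^ 'd"
  assumes f: "smooth f" "cauchy_riemann lam f" and per: "\<And>z t. f (z, t + pi) = f (z, t)"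
  shows "entire_on_lines (holomorphic_mode lam m f)" "continuous_on UNIV (holomorphic_mode lam m f)"
proof -
  define Q where "Q z = (\<Sum>j\<in>UNIV. 2 * of_int (m * lam $ j) * (z $ j * cnj (z $ j)))" for z :: "complex ^ 'd"
  define DQ where "DQ z v = (\<Sum>j\<in>UNIV. 2 * of_int (m * lam $ j) * (z $ j * cnj (v $ j) + v $ j * cnj (z $ j)))" for z v :: "complex ^ 'd"
  define DF where "DF z v = fourier_coeff m (\<lambda>t. frechet_derivative f (at (z, t)) (v, 0))" for z v
  have "(Q has_derivative DQ z) (at z)" for z
    unfolding Q_def[abs_def] DQ_def[abs_def]
    by (rule derivative_eq_intros bounded_linear_imp_has_derivative[OF bounded_linear_vec_nth]
        bounded_linear_imp_has_derivative[OF bounded_linear_compose[OF bounded_linear_cnj bounded_linear_vec_nth]] refl)+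
      (auto simp: fun_eq_iff)
  then have "((\<lambda>z. exp (Q z)) has_derivative (\<lambda>v. exp (Q z) * DQ z v)) (at z)" for z
    using has_derivative_compose[of Q "DQ z" z UNIV exp "(*) (exp (Q z))"] DERIV_exp[of "Q z"]
    by (simp add: has_field_derivative_def)
  then have D: "(holomorphic_mode lam m f has_derivative
      (\<lambda>v. exp (Q z) * DF z v + exp (Q z) * DQ z v * fourier_mode m f z)) (at z)" for z
    unfolding holomorphic_mode_def[abs_def] Q_def[symmetric] DF_def
    by (rule has_derivative_mult[OF _ fourier_mode_has_derivative[OF f(1)]])
  have Qi: "DQ z v + \<i> * DQ z (\<i> *s v) = (\<Sum>j\<in>UNIV. 4 * of_int (m * lam $ j) * (z $ j * cnj (v $ j)))" for z v
    unfolding DQ_def sum_distrib_left sum.distrib[symmetric]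
    by (intro sum.cong refl) (simp add: algebra_simps)
  have Fi: "DF z v + \<i> * DF z (\<i> *s v) = - (\<Sum>j\<in>UNIV. 4 * of_int (m * lam $ j) * (z $ j * cnj (v $ j))) * fourier_mode m f z" for z v
    unfolding DF_def by (rule fourier_mode_antiholomorphic[OF f per])
  have "exp (Q z) * DF z v + exp (Q z) * DQ z v * fourier_mode m f z
      + \<i> * (exp (Q z) * DF z (\<i> *s v) + exp (Q z) * DQ z (\<i> *s v) * fourier_mode m f z) = 0" for z v
  proof -
    have "exp (Q z) * DF z v + exp (Q z) * DQ z v * fourier_mode m f z
        + \<i> * (exp (Q z) * DF z (\<i> *s v) + exp (Q z) * DQ z (\<i> *s v) * fourier_mode m f z)
      = exp (Q z) * ((DF z v + \<i> * DF z (\<i> *s v)) + (DQ z v + \<i> * DQ z (\<i> *s v)) * fourier_mode m f z)"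
      by (simp add: algebra_simps)
    also have "\<dots> = 0" unfolding Fi Qi by simp
    finally show ?thesis .
  qed
  from complex_linear_derivative_imp_entire_on_lines[OF D this]
  show "entire_on_lines (holomorphic_mode lam m f)" .
  show "continuous_on UNIV (holomorphic_mode lam m f)"
    using D by (intro has_derivative_continuous_on) auto
qed

text \<open>The shift of \<theta> moves the interval of integration, periodicity moves it back, and
  the character leaves the factor exp (- 2 \<i> m \<open>shift lam z \<alpha>\<close>). Joined with
  the change of the Gaussian it supplies the term 4 m \<open>lam $ j\<close> of the weight.\<close>

lemma holomorphic_mode_translate:
  fixes f :: "'d::finite pt \<Rightarrow> complex" and lam :: "int ^ 'd"
  assumes f: "continuous_on UNIV f" and per: "\<And>z t. f (z, t + pi) = f (z, t)"
    and tr: "\<And>\<theta> \<theta>'. complex_of_real \<theta>' = \<theta> + shift lam z \<alpha> \<Longrightarrow>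
      f (z + \<alpha>, \<theta>') = f (z, \<theta>) * exp (\<Sum>j\<in>UNIV. of_int (int k * \<bar>lam $ j\<bar>) * (z $ j * cnj (\<alpha> $ j) + 1 / 2 * (\<alpha> $ j * cnj (\<alpha> $ j))))"
  shows "holomorphic_mode lam m f (z + \<alpha>) = holomorphic_mode lam m f z *
     exp (\<Sum>j\<in>UNIV. of_int (weight lam k m j) * (z $ j * cnj (\<alpha> $ j) + 1 / 2 * (\<alpha> $ j * cnj (\<alpha> $ j))))"
proof -
  define T where "T = (\<Sum>j\<in>UNIV. of_int (int k * \<bar>lam $ j\<bar>) * (z $ j * cnj (\<alpha> $ j) + 1 / 2 * (\<alpha> $ j * cnj (\<alpha> $ j))))"
  define \<sigma> where "\<sigma> = Re (shift lam z \<alpha>)"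
  \<comment> \<open>The sum in \<open>shift\<close> is a number minus its conjugate, hence
    imaginary, and the factor \<i> makes it real.\<close>
  have "cnj (shift lam z \<alpha>) = shift lam z \<alpha>"
    unfolding shift_def by (simp add: sum_negf[symmetric] sum_distrib_left algebra_simps)
  then have \<sigma>: "shift lam z \<alpha> = of_real \<sigma>" unfolding \<sigma>_def by (metis Reals_cnj_iff of_real_Re)
  let ?g = "\<lambda>t. f (z + \<alpha>, t) * exp (- (2 * \<i> * of_int m * of_real t))"
  have cg: "continuous_on UNIV ?g"
    by (intro continuous_intros continuous_on_compose2[OF f]) auto
  have pg: "?g (t + pi) = ?g t" for t
  proof -
    have "exp (2 * of_int (- m) * pi * \<i>) = 1" by (rule exp_integer_2pi) simp
    moreover have "- (2 * \<i> * of_int m * of_real (t + pi)) = - (2 * \<i> * of_int m * of_real t) + 2 * of_int (- m) * pi * \<i>"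
      by (simp add: algebra_simps)
    ultimately show ?thesis by (simp only: per exp_add mult_1_right)
  qed
  have "fourier_mode m f (z + \<alpha>) = integral {\<sigma>..\<sigma> + pi} ?g"
    unfolding fourier_mode_def fourier_coeff_def by (rule integral_period_translate[OF cg pg, symmetric]) simp
  also have "\<dots> = integral {0..pi} (\<lambda>t. ?g (t + \<sigma>))"
    using integral_translate_real[OF cg, of 0 pi \<sigma>] by (simp add: add.commute)
  also have "(\<lambda>t. ?g (t + \<sigma>)) = (\<lambda>t. exp (T - 2 * \<i> * of_int m * shift lam z \<alpha>) * (f (z, t) * exp (- (2 * \<i> * of_int m * of_real t))))"
  proof
    fix t
    have "f (z + \<alpha>, t + \<sigma>) = f (z, t) * exp T" unfolding T_def by (rule tr) (simp add: \<sigma>)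
    moreover have "exp (- (2 * \<i> * of_int m * of_real (t + \<sigma>))) = exp (- (2 * \<i> * of_int m * shift lam z \<alpha>)) * exp (- (2 * \<i> * of_int m * of_real t))"
      unfolding exp_add[symmetric] \<sigma> by (simp add: algebra_simps)
    ultimately show "?g (t + \<sigma>) = exp (T - 2 * \<i> * of_int m * shift lam z \<alpha>) * (f (z, t) * exp (- (2 * \<i> * of_int m * of_real t)))"
      by (simp add: exp_diff exp_minus divide_inverse)
  qed
  also have "integral {0..pi} \<dots> = exp (T - 2 * \<i> * of_int m * shift lam z \<alpha>) * fourier_mode m f z"
    unfolding fourier_mode_def fourier_coeff_def by (rule integral_mult_right)
  finally have F: "fourier_mode m f (z + \<alpha>) = exp (T - 2 * \<i> * of_int m * shift lam z \<alpha>) * fourier_mode m f z" .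
  have "- (2 * \<i> * of_int m * shift lam z \<alpha>) = (\<Sum>j\<in>UNIV. 2 * of_int (m * lam $ j) * (z $ j * cnj (\<alpha> $ j) - cnj (z $ j) * \<alpha> $ j))"
    unfolding shift_def sum_distrib_left sum_negf[symmetric]
    by (intro sum.cong refl) (simp add: algebra_simps)
  then have "(\<Sum>j\<in>UNIV. 2 * of_int (m * lam $ j) * ((z + \<alpha>) $ j * cnj ((z + \<alpha>) $ j))) + (T - 2 * \<i> * of_int m * shift lam z \<alpha>)
    = (\<Sum>j\<in>UNIV. 2 * of_int (m * lam $ j) * ((z + \<alpha>) $ j * cnj ((z + \<alpha>) $ j))) + T
      + (\<Sum>j\<in>UNIV. 2 * of_int (m * lam $ j) * (z $ j * cnj (\<alpha> $ j) - cnj (z $ j) * \<alpha> $ j))"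
    by (simp only: diff_conv_add_uminus add.assoc)
  also have "\<dots> = (\<Sum>j\<in>UNIV. 2 * of_int (m * lam $ j) * (z $ j * cnj (z $ j)))
      + (\<Sum>j\<in>UNIV. of_int (weight lam k m j) * (z $ j * cnj (\<alpha> $ j) + 1 / 2 * (\<alpha> $ j * cnj (\<alpha> $ j))))"
    unfolding T_def weight_def sum.distrib[symmetric] by (intro sum.cong refl) (simp add: field_simps)
  finally have E: "exp (\<Sum>j\<in>UNIV. 2 * of_int (m * lam $ j) * ((z + \<alpha>) $ j * cnj ((z + \<alpha>) $ j))) * exp (T - 2 * \<i> * of_int m * shift lam z \<alpha>)
    = exp (\<Sum>j\<in>UNIV. 2 * of_int (m * lam $ j) * (z $ j * cnj (z $ j)))
      * exp (\<Sum>j\<in>UNIV. of_int (weight lam k m j) * (z $ j * cnj (\<alpha> $ j) + 1 / 2 * (\<alpha> $ j * cnj (\<alpha> $ j))))"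
    unfolding exp_add[symmetric] by (rule arg_cong)
  have r: "a * (b * c) = a' * c * b'" if "a * b = a' * b'" for a b c a' b' :: complex
    using that by (metis mult.assoc mult.commute)
  show ?thesis unfolding holomorphic_mode_def F by (rule r[OF E])
qed

lemma holomorphic_modes_zero_imp_zero:
  fixes f :: "'d::finite pt \<Rightarrow> complex"
  assumes f: "continuous_on UNIV f" and per: "\<And>z t. f (z, t + pi) = f (z, t)"
    and zero: "\<And>m z. holomorphic_mode lam m f z = 0"
  shows "f p = 0"
proof -
  have "continuous_on UNIV (\<lambda>t. f (fst p, t))"
    by (intro continuous_on_compose2[OF f] continuous_intros) auto
  moreover have "fourier_coeff m (\<lambda>t. f (fst p, t)) = 0" for m
    using zero[of m "fst p"] by (simp add: holomorphic_mode_def fourier_mode_def)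
  ultimately have "(\<lambda>t. f (fst p, t)) (snd p) = 0"
    using per by (intro fourier_coeff_zero_imp_zero[where \<phi> = "\<lambda>t. f (fst p, t)"])
  then show ?thesis by simp
qed

section \<open>Quasi-periodic entire functions\<close>

lemma heis_lattice_translate_into_cube:
  fixes z :: "complex ^ 'd::finite"
  shows "\<exists>\<alpha>\<in>heis_lattice. \<forall>j. Re ((z + \<alpha>) $ j) \<in> {0..sqrt (2 * pi)} \<and> Im ((z + \<alpha>) $ j) \<in> {0..sqrt (2 * pi)}"
proof -
  define s where "s = sqrt (2 * pi)"
  have s: "s > 0" by (simp add: s_def)
  define n where "n x = - \<lfloor>x / s\<rfloor>" for x
  have n: "x + s * of_int (n x) \<in> {0..s}" for x
  proof -
    have "s * of_int \<lfloor>x / s\<rfloor> \<le> s * (x / s)" using s by (intro mult_left_mono) auto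
    moreover have "s * (x / s) \<le> s * (of_int \<lfloor>x / s\<rfloor> + 1)" using s by (intro mult_left_mono) linarith+
    ultimately show ?thesis using s by (simp add: n_def algebra_simps)
  qed
  define \<alpha> where "\<alpha> = (\<chi> j. complex_of_real s * (of_int (n (Re (z $ j))) + \<i> * of_int (n (Im (z $ j)))))"
  have "\<alpha> \<in> heis_lattice" unfolding heis_lattice_def \<alpha>_def s_def by auto
  moreover have "Re ((z + \<alpha>) $ j) \<in> {0..s} \<and> Im ((z + \<alpha>) $ j) \<in> {0..s}" for j
    using n[of "Re (z $ j)"] n[of "Im (z $ j)"] by (simp add: \<alpha>_def)
  ultimately show ?thesis unfolding s_def by blast
qed

definition quasi_periodic :: "('d \<Rightarrow> int) \<Rightarrow> (complex ^ 'd::finite \<Rightarrow> complex) \<Rightarrow> bool" where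
  "quasi_periodic c g \<longleftrightarrow> (\<forall>z. \<forall>\<alpha>\<in>heis_lattice. g (z + \<alpha>) = g z *
     exp (\<Sum>j\<in>UNIV. of_int (c j) * (z $ j * cnj (\<alpha> $ j) + 1 / 2 * (\<alpha> $ j * cnj (\<alpha> $ j)))))"

text \<open>The pointwise Hermitian norm of the section of a line bundle over the torus that a
  quasi-periodic g represents.\<close>

definition amplitude :: "('d \<Rightarrow> int) \<Rightarrow> (complex ^ 'd::finite \<Rightarrow> complex) \<Rightarrow> complex ^ 'd \<Rightarrow> real" where
  "amplitude c g z = norm (g z) * exp (- (\<Sum>j\<in>UNIV. of_int (c j) * (norm (z $ j))\<^sup>2 / 2))"

lemma norm_eq_amplitude:
  "norm (g z) = amplitude c g z * exp (\<Sum>j\<in>UNIV. of_int (c j) * (norm (z $ j))\<^sup>2 / 2)"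
  unfolding amplitude_def mult.assoc exp_add[symmetric] by simp

lemma cmod_add_squared: "(cmod (a + b))\<^sup>2 = (cmod a)\<^sup>2 + 2 * Re (b * cnj a) + (cmod b)\<^sup>2"
  unfolding cmod_power2 by (simp add: power2_eq_square algebra_simps)

text \<open>The real part of z cnj \<alpha> + \<alpha> cnj \<alpha> / 2 is half the increase of the
  squared norm from z to z + \<alpha>.\<close>

lemma amplitude_periodic:
  assumes g: "quasi_periodic c g" and \<alpha>: "\<alpha> \<in> heis_lattice"
  shows "amplitude c g (z + \<alpha>) = amplitude c g z"
proof -
  define B where "B = (\<Sum>j\<in>UNIV. of_int (c j) * (z $ j * cnj (\<alpha> $ j) + 1 / 2 * (\<alpha> $ j * cnj (\<alpha> $ j))))"
  have "Re B = (\<Sum>j\<in>UNIV. of_int (c j) * (norm ((z + \<alpha>) $ j))\<^sup>2 / 2 - of_int (c j) * (norm (z $ j))\<^sup>2 / 2)"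
    unfolding B_def Re_sum
  proof (intro sum.cong refl)
    fix j
    have "Re (\<alpha> $ j * cnj (\<alpha> $ j)) = (norm (\<alpha> $ j))\<^sup>2" by (simp add: complex_norm_square[symmetric] del: of_real_power)
    then have "Re (of_int (c j) * (z $ j * cnj (\<alpha> $ j) + 1 / 2 * (\<alpha> $ j * cnj (\<alpha> $ j))))
       = of_int (c j) * (Re (z $ j * cnj (\<alpha> $ j)) + (norm (\<alpha> $ j))\<^sup>2 / 2)" by simp
    moreover have "Re (z $ j * cnj (\<alpha> $ j)) = Re (\<alpha> $ j * cnj (z $ j))" by simp
    moreover have "C * (R + A / 2) = C * (Z + 2 * R + A) / 2 - C * Z / 2" for A C R Z :: real
      by (simp add: field_simps)
    ultimately show "Re (of_int (c j) * (z $ j * cnj (\<alpha> $ j) + 1 / 2 * (\<alpha> $ j * cnj (\<alpha> $ j))))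
       = of_int (c j) * (norm ((z + \<alpha>) $ j))\<^sup>2 / 2 - of_int (c j) * (norm (z $ j))\<^sup>2 / 2"
      unfolding vector_add_component cmod_add_squared by (simp only:)
  qed
  then have "Re B - (\<Sum>j\<in>UNIV. of_int (c j) * (norm ((z + \<alpha>) $ j))\<^sup>2 / 2) = - (\<Sum>j\<in>UNIV. of_int (c j) * (norm (z $ j))\<^sup>2 / 2)"
    unfolding sum_subtractf by simp
  moreover have "norm (g (z + \<alpha>)) = norm (g z) * exp (Re B)"
    using g \<alpha> unfolding quasi_periodic_def B_def by (simp add: norm_mult norm_exp_eq_Re)
  ultimately show ?thesis
    unfolding amplitude_def by (simp add: mult.assoc exp_add[symmetric])
qed

lemma amplitude_attains_max:
  fixes g :: "complex ^ 'd::finite \<Rightarrow> complex"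
  assumes g: "quasi_periodic c g" "continuous_on UNIV g"
  shows "\<exists>z0. (\<forall>j. Re (z0 $ j) \<in> {0..sqrt (2 * pi)} \<and> Im (z0 $ j) \<in> {0..sqrt (2 * pi)})
    \<and> (\<forall>z. amplitude c g z \<le> amplitude c g z0)"
proof -
  define Q where "Q = {z :: complex ^ 'd. \<forall>j. Re (z $ j) \<in> {0..sqrt (2 * pi)} \<and> Im (z $ j) \<in> {0..sqrt (2 * pi)}}"
  have "bounded Q"
    unfolding bounded_iff
  proof (intro exI ballI)
    fix z assume z: "z \<in> Q"
    have "norm z \<le> (\<Sum>j\<in>UNIV. norm (z $ j))" unfolding norm_vec_def by (intro L2_set_le_sum) auto
    also have "\<dots> \<le> (\<Sum>j\<in>(UNIV :: 'd set). 2 * sqrt (2 * pi))"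
    proof (rule sum_mono)
      fix j
      have "norm (z $ j) \<le> \<bar>Re (z $ j)\<bar> + \<bar>Im (z $ j)\<bar>" by (rule cmod_le)
      moreover have "Re (z $ j) \<in> {0..sqrt (2 * pi)}" "Im (z $ j) \<in> {0..sqrt (2 * pi)}" using z by (auto simp: Q_def)
      ultimately show "norm (z $ j) \<le> 2 * sqrt (2 * pi)" by simp
    qed
    finally show "norm z \<le> (\<Sum>j\<in>(UNIV :: 'd set). 2 * sqrt (2 * pi))" .
  qed
  moreover have "closed Q"
  proof -
    have "Q = (\<Inter>j. (\<lambda>z. Re (z $ j)) -` {0..sqrt (2 * pi)} \<inter> (\<lambda>z. Im (z $ j)) -` {0..sqrt (2 * pi)})"
      by (auto simp: Q_def)
    also have "closed \<dots>"
      by (intro closed_INT ballI closed_Int continuous_closed_vimage closed_atLeastAtMost) (auto intro!: continuous_intros)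
    finally show ?thesis .
  qed
  ultimately have "compact Q" by (simp add: compact_eq_bounded_closed)
  moreover have "Q \<noteq> {}" by (auto simp: Q_def intro: exI[of _ 0])
  moreover have "continuous_on Q (amplitude c g)"
    unfolding amplitude_def[abs_def] by (intro continuous_intros continuous_on_subset[OF g(2)]) auto
  ultimately obtain z0 where z0: "z0 \<in> Q" "\<And>z. z \<in> Q \<Longrightarrow> amplitude c g z \<le> amplitude c g z0"
    using continuous_attains_sup by metis
  have "amplitude c g z \<le> amplitude c g z0" for z
  proof -
    obtain \<alpha> where "\<alpha> \<in> heis_lattice" "z + \<alpha> \<in> Q"
      using heis_lattice_translate_into_cube[of z] unfolding Q_def by blast
    then show ?thesis using z0(2)[of "z + \<alpha>"] amplitude_periodic[OF g(1)] by simp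
  qed
  then show ?thesis using z0(1) unfolding Q_def by blast
qed

section \<open>Vanishing when some weight is negative\<close>

lemma gaussian_tendsto_0: "b > 0 \<Longrightarrow> ((\<lambda>t :: complex. K * exp (- b * (norm (a + t))\<^sup>2)) \<longlongrightarrow> 0) at_infinity"
proof -
  assume b: "b > 0"
  have "filterlim (\<lambda>t :: complex. a + t) at_infinity at_infinity"
    by (intro tendsto_add_filterlim_at_infinity[OF tendsto_const] filterlim_ident)
  then have "filterlim (\<lambda>t :: complex. norm (a + t)) at_top at_infinity"
    by (rule filterlim_compose[OF filterlim_norm_at_top])
  then have "filterlim (\<lambda>t :: complex. b * (norm (a + t))\<^sup>2) at_top at_infinity"
    using b by (intro filterlim_tendsto_pos_mult_at_top[OF tendsto_const] filterlim_pow_at_top) auto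
  then have "filterlim (\<lambda>t :: complex. - b * (norm (a + t))\<^sup>2) at_bot at_infinity"
    by (simp add: filterlim_uminus_at_top)
  then have "((\<lambda>t :: complex. exp (- b * (norm (a + t))\<^sup>2)) \<longlongrightarrow> 0) at_infinity"
    by (rule filterlim_compose[OF exp_at_bot])
  from tendsto_mult_right_zero[OF this] show ?thesis .
qed

text \<open>A bounded amplitude bounds g by a Gaussian of exponent \<open>c j\<close> / 2 along the
  j-th axis, the other coordinates being frozen in \<open>K\<close>. For negative \<open>c j\<close>
  an entire function of one variable then tends to 0 at infinity.\<close>

lemma quasi_periodic_negative_imp_zero:
  fixes g :: "complex ^ 'd::finite \<Rightarrow> complex"
  assumes g: "quasi_periodic c g" "continuous_on UNIV g" "entire_on_lines g" and j: "c j < 0"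
  shows "g z = 0"
proof -
  obtain z0 where "\<And>j. Re (z0 $ j) \<in> {0..sqrt (2 * pi)} \<and> Im (z0 $ j) \<in> {0..sqrt (2 * pi)}"
    and z0: "\<And>z. amplitude c g z \<le> amplitude c g z0"
    using amplitude_attains_max[OF g(1,2)] by blast
  define M where "M = amplitude c g z0"
  define K where "K = M * exp (\<Sum>i\<in>UNIV - {j}. of_int (c i) * (norm (z $ i))\<^sup>2 / 2)"
  define b where "b = - of_int (c j) / (2 :: real)"
  let ?h = "\<lambda>t. g (z + t *s axis j 1)"
  have "norm (?h t) \<le> K * exp (- b * (norm (z $ j + t))\<^sup>2)" for t
  proof -
    have "(\<Sum>i\<in>UNIV. of_int (c i) * (norm ((z + t *s axis j 1) $ i))\<^sup>2 / 2)
        = of_int (c j) * (norm ((z + t *s axis j 1) $ j))\<^sup>2 / 2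
          + (\<Sum>i\<in>UNIV - {j}. of_int (c i) * (norm ((z + t *s axis j 1) $ i))\<^sup>2 / 2)"
      by (rule sum.remove) auto
    also have "\<dots> = (\<Sum>i\<in>UNIV - {j}. of_int (c i) * (norm (z $ i))\<^sup>2 / 2) + - b * (norm (z $ j + t))\<^sup>2"
      by (auto simp: b_def axis_def intro!: sum.cong)
    finally have "norm (?h t) = amplitude c g (z + t *s axis j 1) *
        exp ((\<Sum>i\<in>UNIV - {j}. of_int (c i) * (norm (z $ i))\<^sup>2 / 2) + - b * (norm (z $ j + t))\<^sup>2)"
      using norm_eq_amplitude[of g "z + t *s axis j 1" c] by simp
    also have "\<dots> \<le> M * exp ((\<Sum>i\<in>UNIV - {j}. of_int (c i) * (norm (z $ i))\<^sup>2 / 2) + - b * (norm (z $ j + t))\<^sup>2)"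
      unfolding M_def by (intro mult_right_mono z0) auto
    finally show ?thesis unfolding K_def exp_add mult.assoc .
  qed
  moreover have "((\<lambda>t. K * exp (- b * (norm (z $ j + t))\<^sup>2)) \<longlongrightarrow> 0) at_infinity"
    using j by (intro gaussian_tendsto_0) (simp add: b_def)
  ultimately have "(?h \<longlongrightarrow> 0) at_infinity"
    by (rule Lim_null_comparison[OF always_eventually[OF allI]])
  moreover have "?h holomorphic_on UNIV" using g(3) by (simp add: entire_on_lines_def)
  ultimately have "?h 0 = 0" using Liouville_weak_0 by blast
  then show ?thesis by simp
qed

section \<open>Vanishing on a sufficiently fine grid\<close>

definition grid_point :: "nat \<Rightarrow> ('d::finite \<Rightarrow> nat \<times> nat) \<Rightarrow> complex ^ 'd" where
  "grid_point N p = (\<chi> j. Complex (sqrt (2 * pi) * real (fst (p j)) / real N) (sqrt (2 * pi) * real (snd (p j)) / real N))"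

lemma nearest_grid_point:
  assumes N: "0 < N" and z: "\<And>j. Re (z $ j) \<in> {0..sqrt (2 * pi)} \<and> Im (z $ j) \<in> {0..sqrt (2 * pi)}"
  obtains p where "p \<in> PiE UNIV (\<lambda>_. {..N} \<times> {..N})"
    "\<And>j. (norm ((grid_point N p - z) $ j))\<^sup>2 \<le> 4 * pi / (real N)\<^sup>2"
proof -
  define s where "s = sqrt (2 * pi)"
  have s: "s > 0" "s\<^sup>2 = 2 * pi" by (auto simp: s_def)
  \<comment> \<open>The end x = s of the side gets the index N, which is why the grid has N + 1
    nodes per side.\<close>
  define n where "n x = nat \<lfloor>x * real N / s\<rfloor>" for x
  have n: "n x \<le> N" "\<bar>s * real (n x) / real N - x\<bar> \<le> s / real N" if "x \<in> {0..s}" for x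
  proof -
    have 0: "0 \<le> x * real N / s" using that s by simp
    have "x * real N \<le> s * real N" using that by (intro mult_right_mono) auto
    then have "x * real N / s \<le> real N" using s by (simp add: field_simps)
    then show "n x \<le> N" unfolding n_def by linarith
    have e: "real (n x) = of_int \<lfloor>x * real N / s\<rfloor>" unfolding n_def using 0 by simp
    have "\<bar>real (n x) - x * real N / s\<bar> \<le> 1" unfolding e by linarith
    then have "\<bar>real (n x) - x * real N / s\<bar> * (s / real N) \<le> 1 * (s / real N)"
      using s by (intro mult_right_mono) auto
    moreover have "\<bar>real (n x) - x * real N / s\<bar> * (s / real N) = \<bar>(real (n x) - x * real N / s) * (s / real N)\<bar>"
      using s by (simp add: abs_mult)
    moreover have "(real (n x) - x * real N / s) * (s / real N) = s * real (n x) / real N - x"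
      using s N by (simp add: field_simps)
    ultimately show "\<bar>s * real (n x) / real N - x\<bar> \<le> s / real N" by (metis mult_1)
  qed
  define p where "p j = (n (Re (z $ j)), n (Im (z $ j)))" for j
  show thesis
  proof (rule that)
    show "p \<in> PiE UNIV (\<lambda>_. {..N} \<times> {..N})" using n(1) z by (auto simp: p_def s_def)
    fix j
    have sq: "y\<^sup>2 \<le> (s / real N)\<^sup>2" if "\<bar>y\<bar> \<le> s / real N" for y
      using power_mono[OF that, of 2] by simp
    have "(norm ((grid_point N p - z) $ j))\<^sup>2
      = (s * real (n (Re (z $ j))) / real N - Re (z $ j))\<^sup>2 + (s * real (n (Im (z $ j))) / real N - Im (z $ j))\<^sup>2"
      unfolding cmod_power2 by (simp add: grid_point_def p_def s_def)
    also have "\<dots> \<le> (s / real N)\<^sup>2 + (s / real N)\<^sup>2"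
      using z unfolding s_def[symmetric] by (intro add_mono sq n) auto
    also have "\<dots> = 4 * pi / (real N)\<^sup>2" by (simp add: power_divide s)
    finally show "(norm ((grid_point N p - z) $ j))\<^sup>2 \<le> 4 * pi / (real N)\<^sup>2" .
  qed
qed

text \<open>At a maximum \<open>z0\<close> of the amplitude, with \<open>w\<close> the vector from \<open>z0\<close> to a zero of \<open>g\<close>, the entire
  function \<open>G t = g (z0 + t w) exp (- t \<Sum> c w cnj z0)\<close> satisfies \<open>\<bar>G t\<bar> \<le> \<bar>G 0\<bar> exp (S \<bar>t\<bar>\<^sup>2)\<close>.  For small \<open>S\<close>,
  Cauchy's estimate for \<open>G'\<close> contradicts \<open>G 1 = 0\<close> unless \<open>G 0 = 0\<close>.\<close>

lemma quasi_periodic_grid_zero_imp_zero: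
  fixes g :: "complex ^ 'd::finite \<Rightarrow> complex"
  assumes g: "quasi_periodic c g" "continuous_on UNIV g" "entire_on_lines g"
    and c: "\<And>j. 0 \<le> c j" and N: "0 < N" "64 * pi * of_int (\<Sum>j\<in>UNIV. c j) \<le> (real N)\<^sup>2"
    and zero: "\<And>p. p \<in> PiE UNIV (\<lambda>_. {..N} \<times> {..N}) \<Longrightarrow> g (grid_point N p) = 0"
  shows "g z = 0"
proof -
  obtain z0 where z0: "\<And>j. Re (z0 $ j) \<in> {0..sqrt (2 * pi)} \<and> Im (z0 $ j) \<in> {0..sqrt (2 * pi)}"
    "\<And>z. amplitude c g z \<le> amplitude c g z0"
    using amplitude_attains_max[OF g(1,2)] by blast
  obtain p where p: "p \<in> PiE UNIV (\<lambda>_. {..N} \<times> {..N})"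
    "\<And>j. (norm ((grid_point N p - z0) $ j))\<^sup>2 \<le> 4 * pi / (real N)\<^sup>2"
    using nearest_grid_point[OF N(1) z0(1)] by blast
  define w where "w = grid_point N p - z0"
  define S where "S = (\<Sum>j\<in>UNIV. of_int (c j) * (norm (w $ j))\<^sup>2 / 2)"
  \<comment> \<open>This is 2 pi (sum of c) / N^2, so the constant 64 pi in the hypothesis yields S
    \<le> 1 / 32.\<close>
  have "S \<le> (\<Sum>j\<in>UNIV. of_int (c j) * (4 * pi / (real N)\<^sup>2) / 2)"
    unfolding S_def w_def using c by (intro sum_mono divide_right_mono mult_left_mono p(2)) auto
  also have "\<dots> = (64 * pi * of_int (\<Sum>j\<in>UNIV. c j)) / (real N)\<^sup>2 / 32"
    by (simp add: sum_distrib_left sum_distrib_right sum_divide_distrib field_simps)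
  also have "\<dots> \<le> 1 / 32" using N by (intro divide_right_mono) (auto simp: field_simps)
  finally have S: "S \<le> 1 / 32" .
  define B where "B = (\<Sum>j\<in>UNIV. of_int (c j) * (w $ j * cnj (z0 $ j)))"
  \<comment> \<open>The exponential removes the cross term Re (t B) in the weighted squared norm of
    z0 + t w, leaving a bound that is purely quadratic in t.\<close>
  define G where "G t = g (z0 + t *s w) * exp (- (t * B))" for t
  have hol: "G holomorphic_on A" for A
    using g(3) unfolding G_def entire_on_lines_def
    by (intro holomorphic_intros) (auto intro: holomorphic_on_subset)
  have G0: "G 0 = g z0" and G1: "G 1 = 0"
    using zero[OF p(1)] by (simp_all add: G_def w_def)
  have bound: "norm (G t) \<le> norm (g z0) * exp ((norm t)\<^sup>2 * S)" for t
  proof -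
    have "(\<Sum>j\<in>UNIV. of_int (c j) * (norm ((z0 + t *s w) $ j))\<^sup>2 / 2)
       = (\<Sum>j\<in>UNIV. of_int (c j) * (norm (z0 $ j))\<^sup>2 / 2 + Re (t * (of_int (c j) * (w $ j * cnj (z0 $ j))))
           + (norm t)\<^sup>2 * (of_int (c j) * (norm (w $ j))\<^sup>2 / 2))"
    proof (intro sum.cong refl)
      fix j
      have e: "Re (t * (of_int (c j) * (w $ j * cnj (z0 $ j)))) = of_int (c j) * Re ((t * w $ j) * cnj (z0 $ j))"
        by (simp add: algebra_simps)
      have "C * (A + 2 * R + T * W) / 2 = C * A / 2 + C * R + T * (C * W / 2)" for A C R T W :: real
        by (simp add: field_simps)
      then show "of_int (c j) * (norm ((z0 + t *s w) $ j))\<^sup>2 / 2 = of_int (c j) * (norm (z0 $ j))\<^sup>2 / 2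
          + Re (t * (of_int (c j) * (w $ j * cnj (z0 $ j)))) + (norm t)\<^sup>2 * (of_int (c j) * (norm (w $ j))\<^sup>2 / 2)"
        unfolding e vector_add_component vector_smult_component cmod_add_squared norm_mult power_mult_distrib .
    qed
    also have "\<dots> = (\<Sum>j\<in>UNIV. of_int (c j) * (norm (z0 $ j))\<^sup>2 / 2) + (Re (t * B) + (norm t)\<^sup>2 * S)"
      unfolding sum.distrib Re_sum[symmetric] sum_distrib_left[symmetric] B_def S_def by simp
    finally have "norm (g (z0 + t *s w)) = amplitude c g (z0 + t *s w)
        * exp ((\<Sum>j\<in>UNIV. of_int (c j) * (norm (z0 $ j))\<^sup>2 / 2) + (Re (t * B) + (norm t)\<^sup>2 * S))"
      using norm_eq_amplitude[of g "z0 + t *s w" c] by simp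
    also have "\<dots> \<le> amplitude c g z0
        * exp ((\<Sum>j\<in>UNIV. of_int (c j) * (norm (z0 $ j))\<^sup>2 / 2) + (Re (t * B) + (norm t)\<^sup>2 * S))"
      by (intro mult_right_mono z0) auto
    also have "\<dots> = norm (g z0) * exp (Re (t * B) + (norm t)\<^sup>2 * S)"
      unfolding norm_eq_amplitude[of g z0 c] mult.assoc exp_add[symmetric] ..
    finally have "norm (g (z0 + t *s w)) * exp (- Re (t * B)) \<le> norm (g z0) * exp (Re (t * B) + (norm t)\<^sup>2 * S) * exp (- Re (t * B))"
      by (intro mult_right_mono) auto
    then show ?thesis
      unfolding G_def norm_mult norm_exp_eq_Re by (simp add: mult.assoc exp_add[symmetric])
  qed
  have S0: "0 \<le> S" unfolding S_def using c by (intro sum_nonneg) auto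
  \<comment> \<open>The radius is 4 = 1 + 3, since circles of radius 3 about points of the unit disc
    stay inside; there the exponent is at most 16 / 32. Cauchy's estimate then gives a derivative of
    at most 2 / 3 of \<bar>G 0\<bar>, too small to reach G 1 = 0 unless G 0 = 0.\<close>
  have big: "norm (G y) \<le> norm (g z0) * 2" if "norm y \<le> 4" for y
  proof -
    have "(norm y)\<^sup>2 * S \<le> 4\<^sup>2 * S" using that S0 by (intro mult_right_mono power_mono) auto
    then have "exp ((norm y)\<^sup>2 * S) \<le> exp (1 / 2 :: real)" using S by simp
    also have "\<dots> \<le> 2" by (rule exp_half_le2)
    finally have "norm (g z0) * exp ((norm y)\<^sup>2 * S) \<le> norm (g z0) * 2" by (intro mult_left_mono) auto
    then show ?thesis using bound[of y] by linarith
  qed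
  have d: "norm (deriv G x) \<le> norm (g z0) * 2 / 3" if x: "x \<in> cball 0 1" for x
  proof -
    have "norm ((deriv ^^ 1) G x) \<le> fact 1 * (norm (g z0) * 2) / 3 ^ 1"
    proof (rule Cauchy_inequality)
      fix y assume "norm (x - y) = 3"
      then have "norm y \<le> 4" using x norm_triangle_ineq4[of x "x - y"] by simp
      then show "norm (G y) \<le> norm (g z0) * 2" by (rule big)
    qed (use hol holomorphic_on_imp_continuous_on in auto)
    then show ?thesis by simp
  qed
  have "norm (G 0 - G 1) \<le> norm (g z0) * 2 / 3 * norm (0 - 1 :: complex)"
  proof (rule field_differentiable_bound[of "cball 0 1"])
    fix x :: complex
    show "(G has_field_derivative deriv G x) (at x within cball 0 1)"
      using holomorphic_derivI[OF hol[of UNIV]] by (auto intro: has_field_derivative_at_within)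
  qed (use d in auto)
  then have "norm (g z0) = 0" using G0 G1 by simp
  then have "amplitude c g z \<le> 0" using z0(2)[of z] by (simp add: amplitude_def)
  then show ?thesis by (simp add: amplitude_def mult_le_0_iff)
qed

section \<open>The upper bound\<close>

text \<open>The grid must be fine enough for \<open>quasi_periodic_grid_zero_imp_zero\<close> and
  yet have only O(k) nodes per complex coordinate. L times the rounded-up square root of k achieves
  both.\<close>

lemma grid_size_exists:
  fixes L :: nat
  assumes "1 \<le> L" "1 \<le> k"
  obtains N where "0 < N" "L * k \<le> N ^ 2" "(N + 1) ^ 2 \<le> 16 * L ^ 2 * k"
proof -
  define r where "r = nat \<lceil>sqrt (real k)\<rceil>"
  have k: "1 \<le> sqrt (real k)" using assms by simp
  have r: "sqrt (real k) \<le> real r" "real r \<le> sqrt (real k) + 1" unfolding r_def using k by linarith+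
  then have r1: "real r \<le> 2 * sqrt (real k)" "1 \<le> r" using k by linarith+
  have "(sqrt (real k))\<^sup>2 \<le> (real r)\<^sup>2" "(real r)\<^sup>2 \<le> (2 * sqrt (real k))\<^sup>2"
    using r r1 by (intro power_mono; simp)+
  then have rk: "real k \<le> (real r)\<^sup>2" "(real r)\<^sup>2 \<le> 4 * real k" by (simp_all add: power_mult_distrib)
  then have rk': "k \<le> r\<^sup>2" "r\<^sup>2 \<le> 4 * k" by (metis of_nat_le_iff of_nat_power, metis of_nat_le_iff of_nat_power of_nat_mult of_nat_numeral)
  show thesis
  proof (rule that[of "L * r"])
    show "0 < L * r" using assms r1 by simp
    have "L * k \<le> L * r\<^sup>2" using rk' by simp
    also have "\<dots> \<le> L\<^sup>2 * r\<^sup>2" using assms by (simp add: power2_eq_square)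
    finally show "L * k \<le> (L * r)\<^sup>2" by (simp add: power_mult_distrib)
    have "(L * r + 1)\<^sup>2 \<le> (2 * (L * r))\<^sup>2" using assms r1 by (intro power_mono) auto
    also have "\<dots> = 4 * L\<^sup>2 * r\<^sup>2" by (simp add: power_mult_distrib)
    also have "\<dots> \<le> 4 * L\<^sup>2 * (4 * k)" using rk' by (intro mult_left_mono) auto
    finally show "(L * r + 1)\<^sup>2 \<le> 16 * L\<^sup>2 * k" by simp
  qed
qed

lemma coord_H0b_periodic:
  fixes f :: "'d::finite pt \<Rightarrow> complex" and lam :: "int ^ 'd"
  assumes \<mu>: "\<mu> = (\<chi> j t. if j = t then \<bar>lam $ j\<bar> else 0)" and f: "f \<in> coord lam ` H0b lam \<mu> k"
  shows "f (z, t + pi) = f (z, t)"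
proof -
  have "\<exists>m :: int. complex_of_real (t + pi) = t + shift lam z 0 + pi * of_int m"
    by (intro exI[of _ 1]) simp
  then have "f (z + 0, t + pi) = f (z, t) * exp (\<Sum>j\<in>UNIV. of_int (int k * \<bar>lam $ j\<bar>)
      * (z $ j * cnj ((0 :: complex ^ 'd) $ j) + 1 / 2 * ((0 :: complex ^ 'd) $ j * cnj ((0 :: complex ^ 'd) $ j))))"
    using f heis_lattice_0 unfolding coord_H0b_iff[OF \<mu>] by blast
  then show ?thesis by simp
qed

text \<open>Either some weight is negative, or the indices j1 and j2 force 4 m \<le> k and - k \<le>
  4 m. In the second case m is among the tested modes and the weights are at most 2 k
  \<bar>\<open>lam $ j\<close>\<bar>.\<close>

lemma holomorphic_mode_zero_of_grid_zero:
  fixes f :: "'d::finite pt \<Rightarrow> complex" and lam :: "int ^ 'd"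
  assumes \<mu>: "\<mu> = (\<chi> j t. if j = t then \<bar>lam $ j\<bar> else 0)" and f: "f \<in> coord lam ` H0b lam \<mu> k"
    and sgn: "lam $ j1 < 0" "0 < lam $ j2"
    and N: "0 < N" "512 * real k * of_int (\<Sum>j\<in>UNIV. \<bar>lam $ j\<bar>) \<le> (real N)\<^sup>2"
    and zero: "\<And>m p. m \<in> {- int k..int k} \<Longrightarrow> p \<in> PiE UNIV (\<lambda>_. {..N} \<times> {..N}) \<Longrightarrow> fourier_mode m f (grid_point N p) = 0"
  shows "holomorphic_mode lam m f z = 0"
proof -
  have f': "smooth f" "cauchy_riemann lam f"
    and tr: "\<And>z \<theta> \<alpha> \<theta>'. \<alpha> \<in> heis_lattice \<Longrightarrow> \<exists>m :: int. complex_of_real \<theta>' = \<theta> + shift lam z \<alpha> + pi * of_int m \<Longrightarrow> 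
      f (z + \<alpha>, \<theta>') = f (z, \<theta>) * exp (\<Sum>j\<in>UNIV. of_int (int k * \<bar>lam $ j\<bar>) * (z $ j * cnj (\<alpha> $ j) + 1 / 2 * (\<alpha> $ j * cnj (\<alpha> $ j))))"
    using f unfolding coord_H0b_iff[OF \<mu>] by auto
  note per = coord_H0b_periodic[OF \<mu> f]
  define g where "g = holomorphic_mode lam m f"
  have g: "entire_on_lines g" "continuous_on UNIV g"
    unfolding g_def by (rule holomorphic_mode_entire[OF f' per])+
  have qp: "quasi_periodic (weight lam k m) g"
    unfolding quasi_periodic_def g_def
  proof (intro allI ballI)
    fix z \<alpha> :: "complex ^ 'd" assume \<alpha>: "\<alpha> \<in> heis_lattice"
    show "holomorphic_mode lam m f (z + \<alpha>) = holomorphic_mode lam m f z *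
       exp (\<Sum>j\<in>UNIV. of_int (weight lam k m j) * (z $ j * cnj (\<alpha> $ j) + 1 / 2 * (\<alpha> $ j * cnj (\<alpha> $ j))))"
    proof (rule holomorphic_mode_translate[OF smooth_continuous_on[OF f'(1)] per])
      fix \<theta> \<theta>' :: real assume "complex_of_real \<theta>' = \<theta> + shift lam z \<alpha>"
      then show "f (z + \<alpha>, \<theta>') = f (z, \<theta>) * exp (\<Sum>j\<in>UNIV. of_int (int k * \<bar>lam $ j\<bar>) * (z $ j * cnj (\<alpha> $ j) + 1 / 2 * (\<alpha> $ j * cnj (\<alpha> $ j))))"
        using \<alpha> by (intro tr) (auto intro: exI[of _ 0])
    qed
  qed
  show ?thesis
  proof (cases "\<exists>j. weight lam k m j < 0")
    case True
    then show ?thesis using quasi_periodic_negative_imp_zero[OF qp g(2,1)] unfolding g_def by blast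
  next
    case False
    then have w: "0 \<le> weight lam k m j" for j by (simp add: not_less)
    have "0 \<le> (int k - 4 * m) * - (lam $ j1)" "0 \<le> (int k + 4 * m) * lam $ j2"
      using w[of j1] w[of j2] sgn by (simp_all add: weight_def algebra_simps)
    then have m: "4 * m \<le> int k" "- int k \<le> 4 * m" using sgn by (auto simp: zero_le_mult_iff mult_le_0_iff)
    have wle: "weight lam k m j \<le> 2 * int k * \<bar>lam $ j\<bar>" for j
    proof -
      have "4 * m * lam $ j \<le> \<bar>4 * m\<bar> * \<bar>lam $ j\<bar>" by (metis abs_ge_self abs_mult)
      also have "\<dots> \<le> int k * \<bar>lam $ j\<bar>" using m by (intro mult_right_mono) auto
      finally show ?thesis by (simp add: weight_def)
    qed
    have "g z = 0"
    proof (rule quasi_periodic_grid_zero_imp_zero[OF qp g(2,1) w N(1)])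
      have "(\<Sum>j\<in>UNIV. weight lam k m j) \<le> 2 * int k * (\<Sum>j\<in>UNIV. \<bar>lam $ j\<bar>)"
        unfolding sum_distrib_left by (intro sum_mono wle)
      then have le: "real_of_int (\<Sum>j\<in>UNIV. weight lam k m j) \<le> 2 * real k * of_int (\<Sum>j\<in>UNIV. \<bar>lam $ j\<bar>)"
        by (metis (no_types, lifting) of_int_le_iff of_int_mult of_int_numeral of_int_of_nat_eq)
      \<comment> \<open>Here 64 pi \<le> 256, and the factor 2 in the bound on the weights turns 256
        into the 512 of the hypothesis on N.\<close>
      have "64 * pi * real_of_int (\<Sum>j\<in>UNIV. weight lam k m j) \<le> 256 * (2 * real k * of_int (\<Sum>j\<in>UNIV. \<bar>lam $ j\<bar>))"
        using pi_less_4 le w by (intro mult_mono) (auto intro!: sum_nonneg simp del: of_int_sum)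
      also have "\<dots> \<le> (real N)\<^sup>2" using N(2) by simp
      finally show "64 * pi * of_int (\<Sum>j\<in>UNIV. weight lam k m j) \<le> (real N)\<^sup>2" .
      fix p :: "'d \<Rightarrow> nat \<times> nat" assume "p \<in> PiE UNIV (\<lambda>_. {..N} \<times> {..N})"
      then show "g (grid_point N p) = 0"
        using m zero[of m p] unfolding g_def holomorphic_mode_def by simp
    qed
    then show ?thesis by (simp add: g_def)
  qed
qed

lemma coord_H0b_finite_span:
  fixes lam :: "int ^ 'd::finite"
  assumes \<mu>: "\<mu> = (\<chi> j t. if j = t then \<bar>lam $ j\<bar> else 0)"
    and sgn: "lam $ j1 < 0" "0 < lam $ j2" and k: "1 \<le> k"
  defines "L \<equiv> 512 * nat (\<Sum>j\<in>UNIV. \<bar>lam $ j\<bar>)"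
  shows "\<exists>S. finite S \<and> card S \<le> 3 * (16 * L ^ 2) ^ CARD('d) * k ^ (CARD('d) + 1) \<and> coord lam ` H0b lam \<mu> k \<subseteq> cfun.span S"
proof -
  have "0 < \<bar>lam $ j1\<bar>" using sgn by simp
  also have "\<dots> \<le> (\<Sum>j\<in>UNIV. \<bar>lam $ j\<bar>)" by (rule member_le_sum) auto
  finally have \<Lambda>: "0 < (\<Sum>j\<in>UNIV. \<bar>lam $ j\<bar>)" .
  then have "1 \<le> L" by (simp add: L_def)
  then obtain N where N: "0 < N" "L * k \<le> N ^ 2" "(N + 1) ^ 2 \<le> 16 * L ^ 2 * k"
    using grid_size_exists[OF _ k] by metis
  have "real (L * k) \<le> (real N)\<^sup>2" using N(2) by (metis of_nat_le_iff of_nat_power)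
  then have N': "512 * real k * of_int (\<Sum>j\<in>UNIV. \<bar>lam $ j\<bar>) \<le> (real N)\<^sup>2"
    using \<Lambda> by (simp add: L_def mult_ac del: of_int_sum)
  have \<mu>s: "\<forall>j t. \<mu> $ j $ t = \<mu> $ t $ j" by (simp add: \<mu>)
  define I where "I = {- int k..int k} \<times> (PiE UNIV (\<lambda>_. {..N} \<times> {..N}) :: ('d \<Rightarrow> nat \<times> nat) set)"
  define \<phi> where "\<phi> i f = fourier_mode (fst i) f (grid_point N (snd i))" for i :: "int \<times> ('d \<Rightarrow> nat \<times> nat)" and f :: "'d pt \<Rightarrow> complex"
  have sm: "smooth f" if "f \<in> coord lam ` H0b lam \<mu> k" for f using that unfolding coord_H0b_iff[OF \<mu>] by blast
  have cont: "continuous_on {0..pi} (\<lambda>t. f (z, t))" if "f \<in> coord lam ` H0b lam \<mu> k" for f z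
    by (intro continuous_on_compose2[OF smooth_continuous_on[OF sm[OF that], of UNIV]] continuous_intros) auto
  have "\<exists>S. finite S \<and> card S \<le> card I \<and> coord lam ` H0b lam \<mu> k \<subseteq> cfun.span S"
  proof (rule cfun.finite_spanning_of_separating_functionals[where \<phi> = \<phi>])
    show "finite I" unfolding I_def by (intro finite_cartesian_product finite_PiE) auto
    show "cfun.subspace (coord lam ` H0b lam \<mu> k)" by (rule subspace_coord_H0b[OF \<mu>s])
    show "\<phi> i (x + y) = \<phi> i x + \<phi> i y" if "x \<in> coord lam ` H0b lam \<mu> k" "y \<in> coord lam ` H0b lam \<mu> k" for i x y
      unfolding \<phi>_def fourier_mode_def plus_fun_apply by (rule fourier_coeff_add[OF cont[OF that(1)] cont[OF that(2)]])
    show "\<phi> i (\<lambda>p. c * x p) = c * \<phi> i x" for i c x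
      unfolding \<phi>_def fourier_mode_def by (rule fourier_coeff_cmult)
    fix f assume f: "f \<in> coord lam ` H0b lam \<mu> k" and z: "\<And>i. i \<in> I \<Longrightarrow> \<phi> i f = 0"
    have hz: "holomorphic_mode lam m f z = 0" for m z
    proof (rule holomorphic_mode_zero_of_grid_zero[OF \<mu> f sgn N(1) N'])
      show "fourier_mode m f (grid_point N p) = 0" if "m \<in> {- int k..int k}" "p \<in> PiE UNIV (\<lambda>_. {..N} \<times> {..N})" for m p
        using z[of "(m, p)"] that by (simp add: I_def \<phi>_def)
    qed
    have "f p = 0" for p
      by (rule holomorphic_modes_zero_imp_zero[OF smooth_continuous_on[OF sm[OF f]] coord_H0b_periodic[OF \<mu> f] hz])
    then show "f = 0" by (simp add: fun_eq_iff)
  qed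
  moreover have "card I \<le> 3 * (16 * L ^ 2) ^ CARD('d) * k ^ (CARD('d) + 1)"
  proof -
    \<comment> \<open>The square is there because each complex coordinate carries a two-dimensional
      grid.\<close>
    have "card I = (2 * k + 1) * ((N + 1)\<^sup>2) ^ CARD('d)"
      unfolding I_def card_cartesian_product by (simp add: card_PiE power2_eq_square nat_add_distrib)
    also have "\<dots> \<le> (3 * k) * (16 * L ^ 2 * k) ^ CARD('d)"
      using k N(3) by (intro mult_mono power_mono) auto
    also have "\<dots> = 3 * (16 * L ^ 2) ^ CARD('d) * k ^ (CARD('d) + 1)"
      by (simp add: power_mult_distrib mult_ac)
    finally show ?thesis .
  qed
  ultimately show ?thesis by (meson order_trans)
qed

theorem theorem1p4:
  fixes n n_minus :: nat
    and lam :: "int ^ 'd::finite"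
    and \<mu> :: "int ^ 'd ^ 'd"
    and e :: "nat \<Rightarrow> 'd"
  assumes "bij_betw e {1..n - 1} (UNIV :: 'd set)"
    and "\<forall>i \<in> {1..n - 1}. lam $ e i \<noteq> 0"
    and "\<forall>i \<in> {1..n_minus}. lam $ e i < 0"
    and "\<forall>i \<in> {n_minus + 1..n - 1}. lam $ e i > 0"
    and "\<mu> = (\<chi> j t. if j = t then \<bar>lam $ j\<bar> else 0)"
    and "n_minus \<ge> 2"
    and "n - 1 - n_minus \<ge> 2"
  shows "\<exists>c > 0. \<exists>C > 0. \<exists>k0 :: nat. \<forall>k \<ge> k0.
           c * real k ^ n \<le> real (dim_H0b lam \<mu> k) \<and> real (dim_H0b lam \<mu> k) \<le> C * real k ^ n"
proof -
  have "CARD('d) = n - 1" using bij_betw_same_card[OF assms(1)] by simp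
  \<comment> \<open>The last two hypotheses exclude n = 0, where the truncated n - 1 would spoil
    this.\<close>
  then have n: "n = CARD('d) + 1" using assms(6,7) by linarith
  have nz: "lam $ j \<noteq> 0" for j
    using assms(1,2) by (metis UNIV_I bij_betw_imp_surj_on imageE)
  have sgn: "lam $ e 1 < 0" "0 < lam $ e (n - 1)" using assms(3,4,6,7) by auto
  define C where "C = 3 * (16 * (512 * nat (\<Sum>j\<in>UNIV. \<bar>lam $ j\<bar>)) ^ 2) ^ CARD('d)"
  have "1 / 8 * real k ^ n \<le> real (dim_H0b lam \<mu> k) \<and> real (dim_H0b lam \<mu> k) \<le> real (C + 1) * real k ^ n"
    if k: "1 \<le> k" for k
  proof -
    obtain S where S: "finite S" "card S \<le> C * k ^ n" "coord lam ` H0b lam \<mu> k \<subseteq> cfun.span S"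
      using coord_H0b_finite_span[OF assms(5) sgn k] unfolding C_def n by blast
    have "dim_H0b lam \<mu> k \<le> C * k ^ n"
      unfolding dim_H0b_def using cfun.dim_le_card[OF S(3,1)] S(2) by linarith
    \<comment> \<open>Passing to C + 1 makes the constant evidently positive.\<close>
    also have "\<dots> \<le> (C + 1) * k ^ n" by simp
    finally have "real (dim_H0b lam \<mu> k) \<le> real (C + 1) * real k ^ n"
      by (metis of_nat_le_iff of_nat_mult of_nat_power)
    moreover have "1 / 8 * real k ^ n \<le> real (dim_H0b lam \<mu> k)"
      using dim_H0b_lower_bound[OF assms(5) _ nz S(1,3)] k unfolding n by simp
    ultimately show ?thesis by blast
  qed
  moreover have "0 < real (C + 1)" "0 < (1 / 8 :: real)" by simp_all
  ultimately show ?thesis by blast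
qed

end
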